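(* Let $K$ be an infinite field and $R=K[x_1,\dots,x_n]$. Let $I=\bigcap_{i=1}^r\mathfrak q_i$, where each $\mathfrak q_i$ is a monomial ideal that is $\mathfrak p_i$-primary, each $\mathfrak p_i$ is disjointly generated from the others, and every variable of $R$ is a generator of some $\mathfrak p_i$. Then $$\ell(I)=n-r+1.$$
   Context: Two monomial ideals are called disjointly generated if the set of variables appearing in the minimal monomial generators of one and the set of variables appearing in the minimal monomial generators of the other are disjoint. The analytic spread of $I$ is $\ell(I)=\dim\left(R[It]\otimes_R R/\mathfrak m\right)$ (Krull dimension), where $R[It]$ is the Rees algebra and $\mathfrak m=(x_1,\dots,x_n)$.
   Formalization: The primes p_i are assumed nonzero: the zero ideal is vacuously disjointly generated from the others, and with n=r=2, p_1=q_1=(x_1,x_2), p_2=q_2=0 one gets I=0 and ℓ(I)=0, not n-r+1=1. It is also understood that n is at least 1. *)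

theory Defs
  imports
    "HOL-Algebra.Algebra"
    "HOL-Algebra.Algebraic_Closure_Type"
    "HOL-Library.Poly_Mapping"
    "HOL-Library.Extended_Real"
begin

section \<open>Krull dimension and primary ideals\<close>

text \<open>
  The dimension is the supremum of the lengths of chains of prime ideals. It lies in the
  extended reals, so that it may be infinite, and is \<open>-\<infinity>\<close> for the zero ring.
\<close>

definition prime_chain :: "('a, 'b) ring_scheme \<Rightarrow> nat \<Rightarrow> (nat \<Rightarrow> 'a set) \<Rightarrow> bool" where
  "prime_chain R k P \<longleftrightarrow> (\<forall>i\<le>k. primeideal (P i) R) \<and> (\<forall>i<k. P i \<subset> P (Suc i))"

definition krull_dim :: "('a, 'b) ring_scheme \<Rightarrow> ereal" where
  "krull_dim R = Sup {ereal (real k) | k. \<exists>P. prime_chain R k P}"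

definition radical :: "('a, 'b) ring_scheme \<Rightarrow> 'a set \<Rightarrow> 'a set" where
  "radical R J = {a \<in> carrier R. \<exists>k::nat. a [^]\<^bsub>R\<^esub> k \<in> J}"

definition primary_ideal :: "('a, 'b) ring_scheme \<Rightarrow> 'a set \<Rightarrow> bool" where
  "primary_ideal R q \<longleftrightarrow> ideal q R \<and> q \<noteq> carrier R \<and>
     (\<forall>a\<in>carrier R. \<forall>b\<in>carrier R. a \<otimes>\<^bsub>R\<^esub> b \<in> q \<longrightarrow> a \<in> q \<or> (\<exists>k::nat. b [^]\<^bsub>R\<^esub> k \<in> q))"

definition primary_to :: "('a, 'b) ring_scheme \<Rightarrow> 'a set \<Rightarrow> 'a set \<Rightarrow> bool" where
  "primary_to R p q \<longleftrightarrow> primary_ideal R q \<and> radical R q = p"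


section \<open>Tensor products of commutative algebras\<close>

text \<open>
  The integral monoid ring of \<open>M\<close>: formal \<open>\<int>\<close>-combinations of elements of \<open>M\<close>,
  with \<open>frag_of x \<cdot> frag_of y = frag_of (x \<otimes> y)\<close> extended bilinearly.
\<close>

definition int_monoid_ring :: "('a, 'b) monoid_scheme \<Rightarrow> ('a \<Rightarrow>\<^sub>0 int) ring" where
  "int_monoid_ring M =
     \<lparr>carrier = {c. Poly_Mapping.keys c \<subseteq> carrier M},
      monoid.mult = (\<lambda>c d. frag_extend (\<lambda>x. frag_extend (\<lambda>y. frag_of (x \<otimes>\<^bsub>M\<^esub> y)) d) c),
      monoid.one = frag_of \<one>\<^bsub>M\<^esub>,
      ring.zero = 0,
      ring.add = (+)\<rparr>"

text \<open>
  \<open>A\<close> and \<open>B\<close> are \<open>R\<close>-algebras via ring homomorphisms \<open>f : R \<rightarrow> A\<close> and \<open>g : R \<rightarrow> B\<close>.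
  \<open>A \<otimes>\<^sub>R B\<close> is the free abelian group on the symbols \<open>(a, b)\<close> modulo the relations below,
  with \<open>(a \<otimes> b)(a' \<otimes> b') = aa' \<otimes> bb'\<close>. The product of a symbol with a relation is again a
  relation, so the subgroup generated by the relations is the same as the ideal they generate
  in the monoid ring of \<open>A \<times> B\<close>.
\<close>

definition tensor_relations ::
  "('r, 'x) ring_scheme \<Rightarrow> ('a, 'y) ring_scheme \<Rightarrow> ('r \<Rightarrow> 'a) \<Rightarrow>
   ('b, 'z) ring_scheme \<Rightarrow> ('r \<Rightarrow> 'b) \<Rightarrow> ('a \<times> 'b \<Rightarrow>\<^sub>0 int) set" where
  "tensor_relations R A f B g =
     {frag_of (a \<oplus>\<^bsub>A\<^esub> a', b) - frag_of (a, b) - frag_of (a', b) | a a' b.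
        a \<in> carrier A \<and> a' \<in> carrier A \<and> b \<in> carrier B}
   \<union> {frag_of (a, b \<oplus>\<^bsub>B\<^esub> b') - frag_of (a, b) - frag_of (a, b') | a b b'.
        a \<in> carrier A \<and> b \<in> carrier B \<and> b' \<in> carrier B}
   \<union> {frag_of (f r \<otimes>\<^bsub>A\<^esub> a, b) - frag_of (a, g r \<otimes>\<^bsub>B\<^esub> b) | r a b.
        r \<in> carrier R \<and> a \<in> carrier A \<and> b \<in> carrier B}"

definition tensor_algebra ::
  "('r, 'x) ring_scheme \<Rightarrow> ('a, 'y) ring_scheme \<Rightarrow> ('r \<Rightarrow> 'a) \<Rightarrow>
   ('b, 'z) ring_scheme \<Rightarrow> ('r \<Rightarrow> 'b) \<Rightarrow> ('a \<times> 'b \<Rightarrow>\<^sub>0 int) set ring" where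
  "tensor_algebra R A f B g =
     int_monoid_ring (A \<times>\<times> B) Quot
       (Idl\<^bsub>int_monoid_ring (A \<times>\<times> B)\<^esub> (tensor_relations R A f B g))"


section \<open>Rees algebra and analytic spread\<close>

definition rees_algebra :: "('a, 'b) ring_scheme \<Rightarrow> 'a set \<Rightarrow> ('a, nat \<Rightarrow> 'a) up_ring" where
  "rees_algebra R I = (UP R)\<lparr>carrier :=
     {f \<in> carrier (UP R). \<forall>i. up_ring.coeff (UP R) f i \<in> I [^]\<^bsub>ideals_set R\<^esub> i}\<rparr>"

definition analytic_spread :: "('a, 'b) ring_scheme \<Rightarrow> 'a set \<Rightarrow> 'a set \<Rightarrow> ereal" where
  "analytic_spread R m I =
     krull_dim (tensor_algebra R
       (rees_algebra R I) (\<lambda>a. up_ring.monom (UP R) a 0)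
       (R Quot m) (\<lambda>a. m +>\<^bsub>R\<^esub> a))"


section \<open>Monomial ideals in polynomial rings\<close>

text \<open>Polynomials with variables indexed by \<open>'v\<close>: finitely supported functions on exponents.\<close>

type_synonym ('v, 'k) mpoly = "('v \<Rightarrow>\<^sub>0 nat) \<Rightarrow>\<^sub>0 'k"

abbreviation mpoly_ring :: "('v, 'k::comm_ring_1) mpoly ring" where
  "mpoly_ring \<equiv> ring_of_type_algebra"

definition monomial :: "('v \<Rightarrow>\<^sub>0 nat) \<Rightarrow> ('v, 'k::comm_ring_1) mpoly" where
  "monomial e = Poly_Mapping.single e 1"

definition Var :: "'v \<Rightarrow> ('v, 'k::comm_ring_1) mpoly" where
  "Var v = monomial (Poly_Mapping.single v 1)"

definition irrelevant_ideal :: "('v, 'k::comm_ring_1) mpoly set" where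
  "irrelevant_ideal = Idl\<^bsub>mpoly_ring\<^esub> (range Var)"

definition monomial_ideal :: "('v, 'k::comm_ring_1) mpoly set \<Rightarrow> bool" where
  "monomial_ideal J \<longleftrightarrow> (\<exists>E. J = Idl\<^bsub>mpoly_ring\<^esub> (monomial ` E))"

definition min_monomial_gens :: "('v, 'k::comm_ring_1) mpoly set \<Rightarrow> ('v, 'k) mpoly set" where
  "min_monomial_gens J =
     {f \<in> J \<inter> range monomial. \<forall>g \<in> J \<inter> range monomial. g dvd f \<longrightarrow> g = f}"

definition gen_vars :: "('v, 'k::comm_ring_1) mpoly set \<Rightarrow> 'v set" where
  "gen_vars J = {v. \<exists>e. monomial e \<in> min_monomial_gens J \<and> v \<in> Poly_Mapping.keys e}"

definition disjointly_generated ::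
  "('v, 'k::comm_ring_1) mpoly set \<Rightarrow> ('v, 'k) mpoly set \<Rightarrow> bool" where
  "disjointly_generated J J' \<longleftrightarrow> gen_vars J \<inter> gen_vars J' = {}"

end

theory Submission
  imports Defs "HOL-Analysis.Cartesian_Space"
begin

text \<open>
  Tensoring with \<open>R/m\<close> turns the Rees algebra into its quotient by \<open>m\<close>, the fibre ring, with the
  minimal monomial generators of the powers of \<open>I\<close> as a basis. The primary components live in
  disjoint blocks of variables, so a minimal generator of \<open>I^j\<close> is determined by its exponents
  outside one chosen variable per block; as the exponents are at most \<open>K j\<close>, the fibre ring grows
  like a polynomial of degree \<open>n - r + 1\<close>. Any \<open>n - r + 2\<close> of its elements are therefore
  algebraically dependent, which bounds the length of chains of primes.

  Conversely, on each block a vertex of the polyhedron of weights \<open>w\<close> with \<open>w \<cdot> a \<ge> 1\<close> for all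
  exponents \<open>a\<close> of the component has spanning tight constraints. The generators of \<open>I\<close> of least
  weight then have rank \<open>n - r + 1\<close>; they cut out a toric quotient of the fibre ring, in which
  setting the variables to \<open>1\<close> one after the other gives a chain of primes of that length.
\<close>

\<comment> \<open>It would clash with the coordinates of \<open>rat^'v\<close>.\<close>
no_notation fps_nth (infixl \<open>$\<close> 75)

section \<open>Tensor products and Krull dimension\<close>

text \<open>The number n - r + 1 arises in two ways. For the upper bound, a minimal generator of a
  power has n - r free exponents and its degree. For the lower bound, n independent tight exponents
  leave, in a block of n_i variables, n_i - 1 independent differences, and all blocks together
  contribute one common sum. The kernel of the map from the monoid algebra of
  \<open>\<Gamma>\<close>, the exponents of the Rees algebra, to the fibre ring is never determined
  as a set of exponents. Primes of the fibre ring are primes of that algebra containing the kernel,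
  and both bounds only use which primes contain the variables placed in degree 0. Disjointness
  matters because membership in a component looks at one block only: two exponents can be recombined
  block by block, even inside a power of I, and least weight can be attained in all blocks at the
  same time. The weights are strictly positive, so the variables in degree 0 lie off the face and
  vanish in the toric quotient.\<close>

lemma int_monoid_ring_simps:
  "carrier (int_monoid_ring M) = {c. Poly_Mapping.keys c \<subseteq> carrier M}"
  "\<one>\<^bsub>int_monoid_ring M\<^esub> = frag_of \<one>\<^bsub>M\<^esub>"
  "\<zero>\<^bsub>int_monoid_ring M\<^esub> = 0"
  "c \<oplus>\<^bsub>int_monoid_ring M\<^esub> d = c + d"
  by (simp_all add: int_monoid_ring_def)

lemma int_monoid_ring_mult:
  "frag_of x \<otimes>\<^bsub>int_monoid_ring M\<^esub> frag_of y = frag_of (x \<otimes>\<^bsub>M\<^esub> y)"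
  "(a - b) \<otimes>\<^bsub>int_monoid_ring M\<^esub> d = a \<otimes>\<^bsub>int_monoid_ring M\<^esub> d - b \<otimes>\<^bsub>int_monoid_ring M\<^esub> d"
  "d \<otimes>\<^bsub>int_monoid_ring M\<^esub> (a - b) = d \<otimes>\<^bsub>int_monoid_ring M\<^esub> a - d \<otimes>\<^bsub>int_monoid_ring M\<^esub> b"
  "(a + b) \<otimes>\<^bsub>int_monoid_ring M\<^esub> d = a \<otimes>\<^bsub>int_monoid_ring M\<^esub> d + b \<otimes>\<^bsub>int_monoid_ring M\<^esub> d"
  "d \<otimes>\<^bsub>int_monoid_ring M\<^esub> (a + b) = d \<otimes>\<^bsub>int_monoid_ring M\<^esub> a + d \<otimes>\<^bsub>int_monoid_ring M\<^esub> b"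
  "0 \<otimes>\<^bsub>int_monoid_ring M\<^esub> d = 0"
  "d \<otimes>\<^bsub>int_monoid_ring M\<^esub> 0 = 0"
proof -
  have cmul_diff: "frag_cmul c (x - y) = frag_cmul c x - frag_cmul c y"
    for c and x y :: "'a \<Rightarrow>\<^sub>0 int"
    by (rule poly_mapping_eqI) (simp add: lookup_minus algebra_simps)
  have sub: "frag_extend (\<lambda>x. f x - g x) c = frag_extend f c - frag_extend g c"
    for f g :: "'a \<Rightarrow> 'a \<Rightarrow>\<^sub>0 int" and c
    by (simp add: frag_extend_def cmul_diff sum_subtractf)
  have z: "frag_extend (\<lambda>x. 0 :: 'a \<Rightarrow>\<^sub>0 int) c = 0" for c :: "'a \<Rightarrow>\<^sub>0 int"
    by (simp add: frag_extend_def)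
  have add: "frag_extend (\<lambda>x. f x + g x) c = frag_extend f c + frag_extend g c"
    for f g :: "'a \<Rightarrow> 'a \<Rightarrow>\<^sub>0 int" and c
    by (simp add: frag_extend_def frag_cmul_distrib2 sum.distrib)
  show "frag_of x \<otimes>\<^bsub>int_monoid_ring M\<^esub> frag_of y = frag_of (x \<otimes>\<^bsub>M\<^esub> y)"
    "(a - b) \<otimes>\<^bsub>int_monoid_ring M\<^esub> d = a \<otimes>\<^bsub>int_monoid_ring M\<^esub> d - b \<otimes>\<^bsub>int_monoid_ring M\<^esub> d"
    "d \<otimes>\<^bsub>int_monoid_ring M\<^esub> (a - b) = d \<otimes>\<^bsub>int_monoid_ring M\<^esub> a - d \<otimes>\<^bsub>int_monoid_ring M\<^esub> b"
    "(a + b) \<otimes>\<^bsub>int_monoid_ring M\<^esub> d = a \<otimes>\<^bsub>int_monoid_ring M\<^esub> d + b \<otimes>\<^bsub>int_monoid_ring M\<^esub> d"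
    "d \<otimes>\<^bsub>int_monoid_ring M\<^esub> (a + b) = d \<otimes>\<^bsub>int_monoid_ring M\<^esub> a + d \<otimes>\<^bsub>int_monoid_ring M\<^esub> b"
    "0 \<otimes>\<^bsub>int_monoid_ring M\<^esub> d = 0"
    "d \<otimes>\<^bsub>int_monoid_ring M\<^esub> 0 = 0"
    by (simp_all add: int_monoid_ring_def frag_extend_diff frag_extend_add sub add z)
qed

lemma cring_int_monoid_ring:
  assumes "comm_monoid M"
  shows "cring (int_monoid_ring M)"
proof -
  interpret comm_monoid M by fact
  let ?Z = "int_monoid_ring M"
  note [simp] = int_monoid_ring_simps int_monoid_ring_mult
  have kd: "Poly_Mapping.keys (a - b) \<subseteq> carrier M"
    if "Poly_Mapping.keys a \<subseteq> carrier M" "Poly_Mapping.keys b \<subseteq> carrier M" for a b :: "'a \<Rightarrow>\<^sub>0 int"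
    using that keys_diff[of a b] by blast
  have ka: "Poly_Mapping.keys (a + b) \<subseteq> carrier M"
    if "Poly_Mapping.keys a \<subseteq> carrier M" "Poly_Mapping.keys b \<subseteq> carrier M" for a b :: "'a \<Rightarrow>\<^sub>0 int"
    using that keys_add[of a b] by blast
  have closed: "x \<otimes>\<^bsub>?Z\<^esub> y \<in> carrier ?Z" if "x \<in> carrier ?Z" "y \<in> carrier ?Z" for x y
  proof -
    have x: "Poly_Mapping.keys x \<subseteq> carrier M" and y: "Poly_Mapping.keys y \<subseteq> carrier M"
      using that by auto
    from x show ?thesis
    proof (induction x rule: frag_induction)
      case (one a)
      from y show ?case
        by (induction y rule: frag_induction) (use one kd in simp_all)
    qed (use kd in simp_all)
  qed
  have comm: "x \<otimes>\<^bsub>?Z\<^esub> y = y \<otimes>\<^bsub>?Z\<^esub> x" if "x \<in> carrier ?Z" "y \<in> carrier ?Z" for x y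
  proof -
    have x: "Poly_Mapping.keys x \<subseteq> carrier M" and y: "Poly_Mapping.keys y \<subseteq> carrier M"
      using that by auto
    from x show ?thesis
    proof (induction x rule: frag_induction)
      case (one a)
      from y show ?case
        by (induction y rule: frag_induction) (use one in \<open>auto simp: m_comm\<close>)
    qed auto
  qed
  have assoc: "x \<otimes>\<^bsub>?Z\<^esub> y \<otimes>\<^bsub>?Z\<^esub> z = x \<otimes>\<^bsub>?Z\<^esub> (y \<otimes>\<^bsub>?Z\<^esub> z)"
    if "x \<in> carrier ?Z" "y \<in> carrier ?Z" "z \<in> carrier ?Z" for x y z
  proof -
    have x: "Poly_Mapping.keys x \<subseteq> carrier M" and y: "Poly_Mapping.keys y \<subseteq> carrier M"
      and z: "Poly_Mapping.keys z \<subseteq> carrier M"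
      using that by auto
    from x show ?thesis
    proof (induction x rule: frag_induction)
      case (one a)
      from y show ?case
      proof (induction y rule: frag_induction)
        case b: (one b)
        from z show ?case
          by (induction z rule: frag_induction) (use one b in \<open>auto simp: m_assoc\<close>)
      qed auto
    qed auto
  qed
  have one: "\<one>\<^bsub>?Z\<^esub> \<otimes>\<^bsub>?Z\<^esub> x = x" if "x \<in> carrier ?Z" for x
  proof -
    have "Poly_Mapping.keys x \<subseteq> carrier M" using that by auto
    then show ?thesis
      by (induction x rule: frag_induction) auto
  qed
  show ?thesis
  proof (rule cringI)
    show "abelian_group ?Z"
    proof (rule abelian_groupI)
      show "\<exists>y\<in>carrier ?Z. y \<oplus>\<^bsub>?Z\<^esub> x = \<zero>\<^bsub>?Z\<^esub>" if "x \<in> carrier ?Z" for x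
        using that by (intro bexI[of _ "- x"]) auto
    qed (use ka in \<open>simp_all add: add_ac\<close>)
    show "comm_monoid ?Z"
      by (rule comm_monoidI) (fact closed | fact comm | fact assoc | fact one | simp)+
  qed simp_all
qed

text \<open>The free abelian group supplies the additive extension; multiplicativity is then checked
  on generators, in one argument at a time. This is the source of maps out of a tensor
  product.\<close>

lemma int_monoid_ring_hom_exists:
  fixes M :: "('a, 'b) monoid_scheme" and D :: "('c, 'd) ring_scheme"
  assumes "comm_monoid M" "cring D" and \<mu>: "\<mu> \<in> hom M D" "\<mu> \<one>\<^bsub>M\<^esub> = \<one>\<^bsub>D\<^esub>"
  obtains h where "h \<in> ring_hom (int_monoid_ring M) D" "\<And>x. x \<in> carrier M \<Longrightarrow> h (frag_of x) = \<mu> x"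
proof -
  interpret M: comm_monoid M by fact
  interpret D: cring D by fact
  interpret Z: cring "int_monoid_ring M" using cring_int_monoid_ring[OF assms(1)] .
  let ?Z = "int_monoid_ring M"
  have ran: "\<mu> ` carrier M \<subseteq> carrier (add_monoid D)" using \<mu>(1) by (auto simp: hom_def)
  obtain h where h: "h \<in> hom (free_Abelian_group (carrier M)) (add_monoid D)"
    "\<And>x. x \<in> carrier M \<Longrightarrow> h (frag_of x) = \<mu> x"
    by (rule comm_group.free_Abelian_group_universal[OF D.a_comm_group ran]) blast
  interpret h: group_hom "free_Abelian_group (carrier M)" "add_monoid D" h
    using h(1) by (simp add: group_hom_def group_hom_axioms_def D.a_group)
  note [simp] = int_monoid_ring_simps int_monoid_ring_mult
  have hcl: "h x \<in> carrier D" if "Poly_Mapping.keys x \<subseteq> carrier M" for x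
    using h.hom_closed[of x] that by simp
  have hadd: "h (x + y) = h x \<oplus>\<^bsub>D\<^esub> h y"
    if "Poly_Mapping.keys x \<subseteq> carrier M" "Poly_Mapping.keys y \<subseteq> carrier M" for x y
    using h.hom_mult[of x y] that by simp
  have h0: "h 0 = \<zero>\<^bsub>D\<^esub>" using h.hom_one by simp
  have hdiff: "h (x - y) = h x \<ominus>\<^bsub>D\<^esub> h y"
    if "Poly_Mapping.keys x \<subseteq> carrier M" "Poly_Mapping.keys y \<subseteq> carrier M" for x y
  proof -
    have "Poly_Mapping.keys (x - y) \<subseteq> carrier M" using keys_diff[of x y] that by blast
    then have "h (x - y + y) = h (x - y) \<oplus>\<^bsub>D\<^esub> h y" using that by (intro hadd)
    then show ?thesis
      using that \<open>Poly_Mapping.keys (x - y) \<subseteq> carrier M\<close> hcl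
      by (simp add: D.minus_eq D.a_assoc D.r_neg)
  qed
  have kd: "Poly_Mapping.keys (a - b) \<subseteq> carrier M"
    if "Poly_Mapping.keys a \<subseteq> carrier M" "Poly_Mapping.keys b \<subseteq> carrier M" for a b :: "'a \<Rightarrow>\<^sub>0 int"
    using that keys_diff[of a b] by blast
  have zc: "Poly_Mapping.keys (x \<otimes>\<^bsub>?Z\<^esub> y) \<subseteq> carrier M"
    if "Poly_Mapping.keys x \<subseteq> carrier M" "Poly_Mapping.keys y \<subseteq> carrier M" for x y
    using Z.m_closed[of x y] that by simp
  \<comment> \<open>The support condition is repeated in the claim because the difference case of
    the induction supplies nothing but the claim for the two parts.\<close>
  have hm: "Poly_Mapping.keys x \<subseteq> carrier M \<and> h (x \<otimes>\<^bsub>?Z\<^esub> y) = h x \<otimes>\<^bsub>D\<^esub> h y"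
    if x: "Poly_Mapping.keys x \<subseteq> carrier M" and y: "Poly_Mapping.keys y \<subseteq> carrier M" for x y
    using x
  proof (induction x rule: frag_induction)
    case zero
    show ?case using y hcl by (simp add: h0)
  next
    case (one a)
    have "Poly_Mapping.keys y \<subseteq> carrier M \<and> h (frag_of a \<otimes>\<^bsub>?Z\<^esub> y) = h (frag_of a) \<otimes>\<^bsub>D\<^esub> h y"
      using y
    proof (induction y rule: frag_induction)
      case zero
      show ?case using one hcl by (simp add: h0)
    next
      case b: (one b)
      then show ?case using one \<mu>(1) h(2) by (auto simp: hom_def)
    next
      case (diff b c)
      have "h (frag_of a \<otimes>\<^bsub>?Z\<^esub> (b - c)) = h (frag_of a) \<otimes>\<^bsub>D\<^esub> h (b - c)"
        using diff one hcl[of "frag_of a"] hcl[of b] hcl[of c]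
        by (simp add: hdiff zc D.minus_eq D.r_distr D.r_minus del: h)
      with diff kd show ?case by blast
    qed
    with one show ?case by simp
  next
    case (diff b c)
    have "h ((b - c) \<otimes>\<^bsub>?Z\<^esub> y) = h (b - c) \<otimes>\<^bsub>D\<^esub> h y"
      using diff y hcl[of y] hcl[of b] hcl[of c]
      by (simp add: hdiff zc D.minus_eq D.l_distr D.l_minus)
    with diff kd show ?case by blast
  qed
  have "h \<in> ring_hom ?Z D"
    by (rule ring_hom_memI) (use hcl hadd hm h(2) \<mu>(2) in auto)
  with h(2) that show thesis by blast
qed

section \<open>Primes and their chains along a surjection\<close>

lemma primeideal_vimage:
  assumes "cring A" "cring T" and h: "h \<in> ring_hom A T" and "primeideal P T"
  shows "primeideal {a \<in> carrier A. h a \<in> P} A"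
proof -
  interpret A: cring A by fact
  interpret T: cring T by fact
  interpret P: primeideal P T by fact
  interpret h: ring_hom_cring A T h using h by unfold_locales
  show ?thesis
  proof (rule primeidealI)
    show "ideal {a \<in> carrier A. h a \<in> P} A"
      using h.ring.ideal_vimage[OF P.is_ideal] .
    show "carrier A \<noteq> {a \<in> carrier A. h a \<in> P}"
    proof
      assume "carrier A = {a \<in> carrier A. h a \<in> P}"
      then have "h \<one>\<^bsub>A\<^esub> \<in> P" by blast
      then show False using P.one_imp_carrier P.I_notcarr by simp
    qed
  qed (use P.I_prime A.is_cring in auto)
qed

text \<open>Elements with the same image differ by an element of the kernel, which lies in
  \<open>Q\<close>.\<close>

lemma mem_of_image_mem:
  assumes "cring A" "cring T" and h: "h \<in> ring_hom A T" and "ideal Q A"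
    and ker: "\<And>a. a \<in> carrier A \<Longrightarrow> h a = \<zero>\<^bsub>T\<^esub> \<Longrightarrow> a \<in> Q"
    and a: "a \<in> carrier A" "h a \<in> h ` Q"
  shows "a \<in> Q"
proof -
  interpret A: cring A by fact
  interpret T: cring T by fact
  interpret Q: ideal Q A by fact
  interpret h: ring_hom_cring A T h using h by unfold_locales
  obtain b where b: "b \<in> Q" "h a = h b" using a by blast
  have bA: "b \<in> carrier A" using b Q.Icarr by blast
  have "h (a \<ominus>\<^bsub>A\<^esub> b) = \<zero>\<^bsub>T\<^esub>"
    using a bA b(2) by (simp add: A.minus_eq T.r_neg)
  then have "a \<ominus>\<^bsub>A\<^esub> b \<in> Q" using ker a bA by simp
  then have "(a \<ominus>\<^bsub>A\<^esub> b) \<oplus>\<^bsub>A\<^esub> b \<in> Q" using b(1) by (simp add: Q.a_closed)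
  then show ?thesis using a bA by (simp add: A.minus_eq A.a_assoc A.l_neg)
qed

lemma primeideal_image:
  assumes "cring A" "cring T" and h: "h \<in> ring_hom A T" and surj: "h ` carrier A = carrier T"
    and "primeideal Q A" and ker: "\<And>a. a \<in> carrier A \<Longrightarrow> h a = \<zero>\<^bsub>T\<^esub> \<Longrightarrow> a \<in> Q"
  shows "primeideal (h ` Q) T"
proof -
  interpret A: cring A by fact
  interpret T: cring T by fact
  interpret Q: primeideal Q A by fact
  interpret h: ring_hom_cring A T h using h by unfold_locales
  note mem = mem_of_image_mem[OF assms(1,2) h Q.is_ideal ker]
  show ?thesis
  proof (rule primeidealI)
    show "ideal (h ` Q) T"
    proof (rule idealI)
      show "subgroup (h ` Q) (add_monoid T)"
      proof (rule T.add.subgroupI)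
        show "h ` Q \<subseteq> carrier T" using Q.a_subset surj by blast
        show "h ` Q \<noteq> {}" using Q.zero_closed by blast
        show "\<ominus>\<^bsub>T\<^esub> a \<in> h ` Q" if "a \<in> h ` Q" for a
          using that Q.Icarr Q.a_inv_closed by (auto simp flip: h.hom_a_inv)
        show "a \<oplus>\<^bsub>T\<^esub> b \<in> h ` Q" if "a \<in> h ` Q" "b \<in> h ` Q" for a b
          using that Q.Icarr Q.a_closed by (auto simp flip: h.hom_add)
      qed
    next
      fix a x assume a: "a \<in> h ` Q" and x: "x \<in> carrier T"
      obtain b y where b: "b \<in> Q" "a = h b" and y: "y \<in> carrier A" "x = h y"
        using a x surj by blast
      have bc: "b \<in> carrier A" using b Q.Icarr by blast
      have "h (y \<otimes>\<^bsub>A\<^esub> b) \<in> h ` Q" using b y Q.I_l_closed by blast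
      then show "x \<otimes>\<^bsub>T\<^esub> a \<in> h ` Q" using b y bc by simp
      have "h (b \<otimes>\<^bsub>A\<^esub> y) \<in> h ` Q" using b y Q.I_r_closed by blast
      then show "a \<otimes>\<^bsub>T\<^esub> x \<in> h ` Q" using b y bc by simp
    qed (fact T.ring_axioms)
    show "carrier T \<noteq> h ` Q"
    proof
      assume "carrier T = h ` Q"
      moreover have "h \<one>\<^bsub>A\<^esub> \<in> carrier T" by simp
      ultimately have "\<one>\<^bsub>A\<^esub> \<in> Q" by (intro mem) simp_all
      then show False using Q.one_imp_carrier Q.I_notcarr by simp
    qed
    fix a b assume a: "a \<in> carrier T" and b: "b \<in> carrier T" and ab: "a \<otimes>\<^bsub>T\<^esub> b \<in> h ` Q"
    obtain x y where x: "x \<in> carrier A" "a = h x" and y: "y \<in> carrier A" "b = h y"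
      using a b surj by blast
    have "x \<otimes>\<^bsub>A\<^esub> y \<in> Q" using x y ab by (intro mem) auto
    then show "a \<in> h ` Q \<or> b \<in> h ` Q" using Q.I_prime x y by blast
  qed (fact T.is_cring)
qed

lemma prime_chain_mono:
  assumes "prime_chain R k P" "i \<le> j" "j \<le> k"
  shows "P i \<subseteq> P j"
  using assms(2,3)
proof (induction j rule: dec_induct)
  case (step n)
  then have "P n \<subset> P (Suc n)" using assms(1) by (auto simp: prime_chain_def)
  with step show ?case by auto
qed auto

text \<open>Correspondence of primes: preimages stay strictly increasing because \<open>h\<close> is
  onto, images because every prime of the chain contains the kernel. As chains increase, it is
  enough to ask this of \<open>P 0\<close>. Dimensions of quotients can thus be studied in the ring
  upstairs.\<close>

lemma krull_dim_image:
  assumes "cring A" "cring T" and h: "h \<in> ring_hom A T" and surj: "h ` carrier A = carrier T"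
  shows "krull_dim T = Sup {ereal (real k) | k. \<exists>P. prime_chain A k P \<and>
           (\<forall>a\<in>carrier A. h a = \<zero>\<^bsub>T\<^esub> \<longrightarrow> a \<in> P 0)}"
proof -
  interpret A: cring A by fact
  interpret T: cring T by fact
  interpret h: ring_hom_cring A T h using h by unfold_locales
  have "(\<exists>P. prime_chain T k P) \<longleftrightarrow>
        (\<exists>P. prime_chain A k P \<and> (\<forall>a\<in>carrier A. h a = \<zero>\<^bsub>T\<^esub> \<longrightarrow> a \<in> P 0))" for k
  proof
    assume "\<exists>P. prime_chain T k P"
    then obtain P where P: "prime_chain T k P" by blast
    let ?P = "\<lambda>i. {a \<in> carrier A. h a \<in> P i}"
    have pr: "primeideal (P i) T" if "i \<le> k" for i using P that by (simp add: prime_chain_def)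
    have "?P i \<subset> ?P (Suc i)" if "i < k" for i
    proof -
      have st: "P i \<subset> P (Suc i)" using P that by (simp add: prime_chain_def)
      then obtain y where y: "y \<in> P (Suc i)" "y \<notin> P i" by blast
      have "y \<in> carrier T" using ideal.Icarr[OF primeideal.axioms(1)[OF pr[of "Suc i"]], of y] y(1) that by simp
      then obtain a where "a \<in> carrier A" "y = h a" using surj by blast
      with y st show ?thesis by blast
    qed
    moreover have "primeideal (?P i) A" if "i \<le> k" for i
      using primeideal_vimage[OF assms(1,2) h pr[OF that]] .
    moreover have "\<forall>a\<in>carrier A. h a = \<zero>\<^bsub>T\<^esub> \<longrightarrow> a \<in> ?P 0"
      using additive_subgroup.zero_closed[OF ideal.axioms(1)[OF primeideal.axioms(1)[OF pr[of 0]]]]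
      by simp
    ultimately show "\<exists>P. prime_chain A k P \<and> (\<forall>a\<in>carrier A. h a = \<zero>\<^bsub>T\<^esub> \<longrightarrow> a \<in> P 0)"
      by (intro exI[of _ ?P]) (simp add: prime_chain_def)
  next
    assume "\<exists>P. prime_chain A k P \<and> (\<forall>a\<in>carrier A. h a = \<zero>\<^bsub>T\<^esub> \<longrightarrow> a \<in> P 0)"
    then obtain P where P: "prime_chain A k P"
      and ker0: "\<And>a. a \<in> carrier A \<Longrightarrow> h a = \<zero>\<^bsub>T\<^esub> \<Longrightarrow> a \<in> P 0" by blast
    have pr: "primeideal (P i) A" if "i \<le> k" for i using P that by (simp add: prime_chain_def)
    have ker: "a \<in> P i" if "a \<in> carrier A" "h a = \<zero>\<^bsub>T\<^esub>" "i \<le> k" for a i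
      using ker0 that prime_chain_mono[OF P, of 0 i] by blast
    have "h ` P i \<subset> h ` P (Suc i)" if "i < k" for i
    proof -
      have st: "P i \<subset> P (Suc i)" using P that by (simp add: prime_chain_def)
      then obtain y where y: "y \<in> P (Suc i)" "y \<notin> P i" by blast
      have "y \<in> carrier A" using ideal.Icarr[OF primeideal.axioms(1)[OF pr[of "Suc i"]], of y] y(1) that by simp
      moreover have "y \<in> P i" if "h y \<in> h ` P i"
        using mem_of_image_mem[OF assms(1,2) h primeideal.axioms(1)[OF pr[of i]] ker[of _ i]
            \<open>y \<in> carrier A\<close> that] \<open>i < k\<close> by (meson less_imp_le)
      ultimately have "h y \<notin> h ` P i" using y(2) by blast
      with y st show ?thesis by blast
    qed
    moreover have "primeideal (h ` P i) T" if "i \<le> k" for i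
      using primeideal_image[OF assms(1,2) h surj pr[OF that]] ker that by blast
    ultimately show "\<exists>P. prime_chain T k P"
      by (intro exI[of _ "\<lambda>i. h ` P i"]) (simp add: prime_chain_def)
  qed
  then show ?thesis unfolding krull_dim_def by simp
qed

section \<open>The tensor product with a quotient of the base ring\<close>

lemma (in ideal) quot_zero_iff:
  assumes "a \<in> carrier R"
  shows "I +> a = \<zero>\<^bsub>R Quot I\<^esub> \<longleftrightarrow> a \<in> I"
proof -
  have z: "\<zero>\<^bsub>R Quot I\<^esub> = I" by (simp add: FactRing_def)
  show ?thesis unfolding z using assms a_coset_join1 a_coset_join2 a_rcos_const 
    by (metis a_rcos_self)
qed

lemma ring_hom_factor:
  assumes "cring R" "cring B" "cring D" and g: "g \<in> ring_hom R B" and surj: "g ` carrier R = carrier B"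
    and k: "k \<in> ring_hom R D"
    and ker: "\<And>r. r \<in> carrier R \<Longrightarrow> g r = \<zero>\<^bsub>B\<^esub> \<Longrightarrow> k r = \<zero>\<^bsub>D\<^esub>"
  obtains \<gamma> where "\<gamma> \<in> ring_hom B D" "\<And>r. r \<in> carrier R \<Longrightarrow> \<gamma> (g r) = k r"
proof -
  interpret R: cring R by fact
  interpret B: cring B by fact
  interpret D: cring D by fact
  interpret g: ring_hom_cring R B g using g by unfold_locales
  interpret k: ring_hom_cring R D k using k by unfold_locales
  define \<gamma> where "\<gamma> b = k (SOME r. r \<in> carrier R \<and> g r = b)" for b
  have \<gamma>: "\<gamma> (g r) = k r" if r: "r \<in> carrier R" for r
  proof -
    define s where "s = (SOME s. s \<in> carrier R \<and> g s = g r)"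
    have s: "s \<in> carrier R \<and> g s = g r"
      unfolding s_def by (rule someI[of _ r]) (use r in simp)
    have "k (s \<ominus>\<^bsub>R\<^esub> r) = \<zero>\<^bsub>D\<^esub>"
      by (rule ker) (use s r in \<open>simp_all add: R.minus_eq B.r_neg\<close>)
    then have "k s \<ominus>\<^bsub>D\<^esub> k r = \<zero>\<^bsub>D\<^esub>" using s r by (simp add: R.minus_eq D.minus_eq)
    then have "k s = k r" using s r by simp
    then show ?thesis unfolding \<gamma>_def s_def .
  qed
  have "\<gamma> \<in> ring_hom B D"
  proof (rule ring_hom_memI)
    show "\<gamma> x \<in> carrier D" if "x \<in> carrier B" for x
      using that \<gamma> by (auto simp flip: surj)
    show "\<gamma> \<one>\<^bsub>B\<^esub> = \<one>\<^bsub>D\<^esub>" using \<gamma>[of "\<one>\<^bsub>R\<^esub>"] by simp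
    fix x y assume "x \<in> carrier B" "y \<in> carrier B"
    then obtain r s where rs: "r \<in> carrier R" "x = g r" "s \<in> carrier R" "y = g s"
      using surj by blast
    show "\<gamma> (x \<otimes>\<^bsub>B\<^esub> y) = \<gamma> x \<otimes>\<^bsub>D\<^esub> \<gamma> y" using rs \<gamma>[of "r \<otimes>\<^bsub>R\<^esub> s"] \<gamma> by simp
    show "\<gamma> (x \<oplus>\<^bsub>B\<^esub> y) = \<gamma> x \<oplus>\<^bsub>D\<^esub> \<gamma> y" using rs \<gamma>[of "r \<oplus>\<^bsub>R\<^esub> s"] \<gamma> by simp
  qed
  with \<gamma> that show thesis by blast
qed

text \<open>Since \<open>g\<close> is onto, \<open>a \<otimes> g r = f r a \<otimes> 1\<close> moves
  everything into the first factor, so \<open>a \<otimes> 1\<close> already gives all elements. That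
  the kernel is no larger than the extended ideal \<open>N\<close> follows from a map of the tensor
  product to \<open>A Quot N\<close> which sends \<open>a \<otimes> 1\<close> to the class of
  \<open>a\<close>.\<close>

lemma tensor_algebra_surj:
  fixes R :: "('r, 'x) ring_scheme" and A :: "('a, 'y) ring_scheme" and B :: "('b, 'z) ring_scheme"
  assumes "cring R" "cring A" "cring B" and f: "f \<in> ring_hom R A"
    and g: "g \<in> ring_hom R B" and surj: "g ` carrier R = carrier B"
  obtains h where "cring (tensor_algebra R A f B g)" "h \<in> ring_hom A (tensor_algebra R A f B g)"
    "h ` carrier A = carrier (tensor_algebra R A f B g)"
    "\<And>a. a \<in> carrier A \<Longrightarrow> h a = \<zero>\<^bsub>tensor_algebra R A f B g\<^esub> \<longleftrightarrow>
       a \<in> Idl\<^bsub>A\<^esub> (f ` {r \<in> carrier R. g r = \<zero>\<^bsub>B\<^esub>})"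
proof -
  interpret R: cring R by fact
  interpret A: cring A by fact
  interpret B: cring B by fact
  interpret f: ring_hom_cring R A f using f by unfold_locales
  interpret g: ring_hom_cring R B g using g by unfold_locales
  define M where "M = A \<times>\<times> B"
  define Z where "Z = int_monoid_ring M"
  define rel where "rel = tensor_relations R A f B g"
  define J where "J = Idl\<^bsub>Z\<^esub> rel"
  have M_simps: "carrier M = carrier A \<times> carrier B" "\<one>\<^bsub>M\<^esub> = (\<one>\<^bsub>A\<^esub>, \<one>\<^bsub>B\<^esub>)"
    "(a, b) \<otimes>\<^bsub>M\<^esub> (a', b') = (a \<otimes>\<^bsub>A\<^esub> a', b \<otimes>\<^bsub>B\<^esub> b')" for a a' b b'
    by (simp_all add: M_def)
  interpret M: comm_monoid M
    by (rule comm_monoidI) (auto simp: M_simps A.m_ac B.m_ac)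
  interpret Z: cring Z unfolding Z_def by (rule cring_int_monoid_ring) (fact M.comm_monoid_axioms)
  have Z_simps: "x \<in> carrier Z \<longleftrightarrow> Poly_Mapping.keys x \<subseteq> carrier A \<times> carrier B"
    "\<one>\<^bsub>Z\<^esub> = frag_of (\<one>\<^bsub>A\<^esub>, \<one>\<^bsub>B\<^esub>)" "\<zero>\<^bsub>Z\<^esub> = 0" "x \<oplus>\<^bsub>Z\<^esub> y = x + y" for x y
    by (simp_all add: Z_def int_monoid_ring_simps M_simps)
  have Z_mult: "frag_of (a, b) \<otimes>\<^bsub>Z\<^esub> frag_of (a', b') = frag_of (a \<otimes>\<^bsub>A\<^esub> a', b \<otimes>\<^bsub>B\<^esub> b')" for a b a' b'
    by (simp add: Z_def int_monoid_ring_mult M_simps)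
  have Z_uminus: "\<ominus>\<^bsub>Z\<^esub> x = - x" if "x \<in> carrier Z" for x
    using that by (intro Z.minus_equality) (auto simp: Z_simps)
  have Z_minus: "x \<ominus>\<^bsub>Z\<^esub> y = x - y" if "x \<in> carrier Z" "y \<in> carrier Z" for x y
    using that by (simp add: Z.minus_eq Z_uminus Z_simps)
  have zd: "x - y \<in> carrier Z" if "x \<in> carrier Z" "y \<in> carrier Z" for x y
    using Z.minus_closed[OF that] Z_minus[OF that] by simp
  have fz: "frag_of (a, b) \<in> carrier Z" if "a \<in> carrier A" "b \<in> carrier B" for a b
    using that by (simp add: Z_simps)
  have rel_Z: "rel \<subseteq> carrier Z"
    unfolding rel_def tensor_relations_def by (auto intro!: zd fz)
  interpret J: ideal J Z unfolding J_def by (rule Z.genideal_ideal) (fact rel_Z)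
  have rel_J: "rel \<subseteq> J" unfolding J_def by (rule Z.genideal_self) (fact rel_Z)
  have rel1: "frag_of (a \<oplus>\<^bsub>A\<^esub> a', b) - frag_of (a, b) - frag_of (a', b) \<in> J"
    if "a \<in> carrier A" "a' \<in> carrier A" "b \<in> carrier B" for a a' b
    using rel_J that unfolding rel_def tensor_relations_def by blast
  have rel3: "frag_of (f r \<otimes>\<^bsub>A\<^esub> a, b) - frag_of (a, g r \<otimes>\<^bsub>B\<^esub> b) \<in> J"
    if "r \<in> carrier R" "a \<in> carrier A" "b \<in> carrier B" for r a b
    using rel_J that unfolding rel_def tensor_relations_def by blast
  have T: "tensor_algebra R A f B g = Z Quot J"
    by (simp add: tensor_algebra_def J_def rel_def Z_def M_def)
  interpret T: cring "Z Quot J" by (rule J.quotient_is_cring) (fact Z.is_cring)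
  define \<pi> where "\<pi> = (+>\<^bsub>Z\<^esub>) J"
  interpret \<pi>: ring_hom_cring Z "Z Quot J" \<pi>
    unfolding \<pi>_def by (rule J.rcos_ring_hom_cring) (fact Z.is_cring)
  have \<pi>_eq: "\<pi> x = \<pi> y" if "x \<in> carrier Z" "y \<in> carrier Z" "x - y \<in> J" for x y
    unfolding \<pi>_def using Z.quotient_eq_iff_same_a_r_cos[OF J.is_ideal that(1,2)] that Z_minus by simp
  define h where "h a = \<pi> (frag_of (a, \<one>\<^bsub>B\<^esub>))" for a
  have h_hom: "h \<in> ring_hom A (Z Quot J)"
  proof (rule ring_hom_memI)
    fix x y assume x: "x \<in> carrier A" and y: "y \<in> carrier A"
    show "h x \<in> carrier (Z Quot J)" unfolding h_def by (rule \<pi>.hom_closed) (simp add: fz x)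
    show "h (x \<otimes>\<^bsub>A\<^esub> y) = h x \<otimes>\<^bsub>Z Quot J\<^esub> h y"
      unfolding h_def by (subst \<pi>.hom_mult[symmetric]) (simp_all add: fz x y Z_mult)
    have "h (x \<oplus>\<^bsub>A\<^esub> y) = \<pi> (frag_of (x, \<one>\<^bsub>B\<^esub>) \<oplus>\<^bsub>Z\<^esub> frag_of (y, \<one>\<^bsub>B\<^esub>))"
      unfolding h_def
    proof (rule \<pi>_eq)
      show "frag_of (x, \<one>\<^bsub>B\<^esub>) \<oplus>\<^bsub>Z\<^esub> frag_of (y, \<one>\<^bsub>B\<^esub>) \<in> carrier Z" by (simp add: fz x y)
    qed (use rel1[OF x y, of "\<one>\<^bsub>B\<^esub>"] x y fz in \<open>simp_all add: Z_simps(4) algebra_simps\<close>)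
    then show "h (x \<oplus>\<^bsub>A\<^esub> y) = h x \<oplus>\<^bsub>Z Quot J\<^esub> h y"
      unfolding h_def by (simp add: fz x y)
  next
    show "h \<one>\<^bsub>A\<^esub> = \<one>\<^bsub>Z Quot J\<^esub>" using \<pi>.hom_one by (simp add: h_def Z_simps(2))
  qed
  interpret h: ring_hom_cring A "Z Quot J" h using h_hom by unfold_locales
  have \<pi>_in: "c \<in> carrier Z \<and> \<pi> c \<in> h ` carrier A" if "Poly_Mapping.keys c \<subseteq> carrier A \<times> carrier B" for c
    using that
  proof (induction c rule: frag_induction)
    case zero
    have "\<pi> 0 = h \<zero>\<^bsub>A\<^esub>" using \<pi>.hom_zero h.hom_zero Z_simps(3) by simp
    then show ?case using Z.zero_closed Z_simps(3) A.zero_closed by (metis imageI)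
  next
    case (one x)
    then obtain a b where ab: "x = (a, b)" "a \<in> carrier A" "b \<in> carrier B" by blast
    obtain r where r: "r \<in> carrier R" "b = g r" using ab(3) surj by blast
    have "\<pi> (frag_of x) = h (f r \<otimes>\<^bsub>A\<^esub> a)"
      unfolding h_def
    proof (rule \<pi>_eq[symmetric])
      show "frag_of (f r \<otimes>\<^bsub>A\<^esub> a, \<one>\<^bsub>B\<^esub>) - frag_of x \<in> J"
        using rel3[OF r(1) ab(2) B.one_closed] r ab by simp
    qed (use ab r fz in auto)
    moreover have "f r \<otimes>\<^bsub>A\<^esub> a \<in> carrier A" using ab r by simp
    ultimately show ?case using ab fz by blast
  next
    case (diff c d)
    then obtain a b where ab: "a \<in> carrier A" "b \<in> carrier A" "\<pi> c = h a" "\<pi> d = h b" by blast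
    have "\<pi> (c - d) = h (a \<ominus>\<^bsub>A\<^esub> b)"
      using diff ab Z_minus[of c d, symmetric] by (simp add: Z.minus_eq A.minus_eq)
    then show ?case using diff ab zd A.minus_closed by blast
  qed
  have h_surj: "h ` carrier A = carrier (Z Quot J)"
  proof
    show "carrier (Z Quot J) \<subseteq> h ` carrier A"
    proof
      fix x assume "x \<in> carrier (Z Quot J)"
      then obtain c where "c \<in> carrier Z" "x = \<pi> c"
        by (auto simp: FactRing_def A_RCOSETS_def' \<pi>_def)
      then show "x \<in> h ` carrier A" using \<pi>_in Z_simps(1) by blast
    qed
  qed auto
  define I where "I = {r \<in> carrier R. g r = \<zero>\<^bsub>B\<^esub>}"
  define N where "N = Idl\<^bsub>A\<^esub> (f ` I)"
  have fI: "f ` I \<subseteq> carrier A" by (auto simp: I_def)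
  interpret N: ideal N A unfolding N_def by (rule A.genideal_ideal) (fact fI)
  have fN: "f ` I \<subseteq> N" unfolding N_def by (rule A.genideal_self) (fact fI)
  have h_frag: "h a = \<zero>\<^bsub>Z Quot J\<^esub> \<longleftrightarrow> frag_of (a, \<one>\<^bsub>B\<^esub>) \<in> J" if "a \<in> carrier A" for a
    unfolding h_def \<pi>_def using J.quot_zero_iff[OF fz[OF that B.one_closed]] .
  have "N \<subseteq> {a \<in> carrier A. h a \<in> {\<zero>\<^bsub>Z Quot J\<^esub>}}"
    unfolding N_def
  proof (rule A.genideal_minimal)
    show "ideal {a \<in> carrier A. h a \<in> {\<zero>\<^bsub>Z Quot J\<^esub>}} A"
      by (rule h.ring.ideal_vimage) (rule T.zeroideal)
    \<comment> \<open>Both sides are the symbol \<open>1 \<otimes> 0\<close>: the balancing relation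
      applies to \<open>r\<close>, which \<open>g\<close> sends to 0, and again to the zero of
      \<open>R\<close>.\<close>
    have "h (f r) = \<zero>\<^bsub>Z Quot J\<^esub>" if "r \<in> I" for r
    proof -
      have r: "r \<in> carrier R" "g r = \<zero>\<^bsub>B\<^esub>" using that by (auto simp: I_def)
      have "h (f r) = \<pi> (frag_of (\<one>\<^bsub>A\<^esub>, \<zero>\<^bsub>B\<^esub>))"
        unfolding h_def using rel3[OF r(1) A.one_closed B.one_closed] r fz by (intro \<pi>_eq) simp_all
      also have "\<dots> = h (f \<zero>\<^bsub>R\<^esub>)"
        unfolding h_def using rel3[OF R.zero_closed A.one_closed B.one_closed] r fz
        by (intro \<pi>_eq[symmetric]) simp_all
      finally show ?thesis using h.hom_zero by simp
    qed
    then show "f ` I \<subseteq> {a \<in> carrier A. h a \<in> {\<zero>\<^bsub>Z Quot J\<^esub>}}" using fI by auto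
  qed
  then have ker1: "h a = \<zero>\<^bsub>Z Quot J\<^esub>" if "a \<in> N" for a using that by blast
  interpret D: cring "A Quot N" by (rule N.quotient_is_cring) (fact A.is_cring)
  define \<nu> where "\<nu> = (+>\<^bsub>A\<^esub>) N"
  interpret \<nu>: ring_hom_cring A "A Quot N" \<nu>
    unfolding \<nu>_def by (rule N.rcos_ring_hom_cring) (fact A.is_cring)
  have \<nu>0: "\<nu> a = \<zero>\<^bsub>A Quot N\<^esub> \<longleftrightarrow> a \<in> N" if "a \<in> carrier A" for a
    unfolding \<nu>_def using N.quot_zero_iff[OF that] .
  obtain \<gamma> where \<gamma>: "\<gamma> \<in> ring_hom B (A Quot N)" "\<And>r. r \<in> carrier R \<Longrightarrow> \<gamma> (g r) = \<nu> (f r)"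
  proof (rule ring_hom_factor[OF R.is_cring B.is_cring D.is_cring g surj, of "\<lambda>r. \<nu> (f r)"])
    show "(\<lambda>r. \<nu> (f r)) \<in> ring_hom R (A Quot N)" by (rule ring_hom_memI) auto
    show "\<nu> (f r) = \<zero>\<^bsub>A Quot N\<^esub>" if "r \<in> carrier R" "g r = \<zero>\<^bsub>B\<^esub>" for r
      using \<nu>0 that fN by (auto simp: I_def)
  qed blast
  interpret \<gamma>: ring_hom_cring B "A Quot N" \<gamma> using \<gamma>(1) by unfold_locales
  \<comment> \<open>The balanced map \<open>(a, b)\<close> to \<open>a b\<close>; it will kill all
    tensor relations and so bound the kernel of \<open>h\<close> from above.\<close>
  define \<mu> where "\<mu> = (\<lambda>(a, b). \<nu> a \<otimes>\<^bsub>A Quot N\<^esub> \<gamma> b)"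
  have "\<mu> \<in> hom M (A Quot N)"
    by (rule homI) (auto simp: \<mu>_def M_simps D.m_ac)
  moreover have "\<mu> \<one>\<^bsub>M\<^esub> = \<one>\<^bsub>A Quot N\<^esub>" by (simp add: \<mu>_def M_simps)
  ultimately obtain \<Phi> where \<Phi>: "\<Phi> \<in> ring_hom Z (A Quot N)"
    "\<And>x. x \<in> carrier M \<Longrightarrow> \<Phi> (frag_of x) = \<mu> x"
    unfolding Z_def using int_monoid_ring_hom_exists[OF M.comm_monoid_axioms D.is_cring] by metis
  interpret \<Phi>: ring_hom_cring Z "A Quot N" \<Phi> using \<Phi>(1) by unfold_locales
  have \<Phi>_frag: "\<Phi> (frag_of (a, b)) = \<nu> a \<otimes>\<^bsub>A Quot N\<^esub> \<gamma> b" if "a \<in> carrier A" "b \<in> carrier B" for a b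
    using \<Phi>(2)[of "(a, b)"] that by (simp add: \<mu>_def M_simps)
  have \<Phi>_diff: "\<Phi> (x - y) = \<Phi> x \<ominus>\<^bsub>A Quot N\<^esub> \<Phi> y" if "x \<in> carrier Z" "y \<in> carrier Z" for x y
    using Z_minus[OF that, symmetric] that by (simp add: Z.minus_eq D.minus_eq)
  have "J \<subseteq> {c \<in> carrier Z. \<Phi> c \<in> {\<zero>\<^bsub>A Quot N\<^esub>}}"
    unfolding J_def
  proof (rule Z.genideal_minimal)
    show "ideal {c \<in> carrier Z. \<Phi> c \<in> {\<zero>\<^bsub>A Quot N\<^esub>}} Z"
      by (rule \<Phi>.ring.ideal_vimage) (rule D.zeroideal)
    have cancel: "(x \<oplus>\<^bsub>A Quot N\<^esub> y) \<ominus>\<^bsub>A Quot N\<^esub> x \<ominus>\<^bsub>A Quot N\<^esub> y = \<zero>\<^bsub>A Quot N\<^esub>"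
      if "x \<in> carrier (A Quot N)" "y \<in> carrier (A Quot N)" for x y
    proof -
      have "(x \<oplus>\<^bsub>A Quot N\<^esub> y) \<ominus>\<^bsub>A Quot N\<^esub> x \<ominus>\<^bsub>A Quot N\<^esub> y
          = (x \<oplus>\<^bsub>A Quot N\<^esub> \<ominus>\<^bsub>A Quot N\<^esub> x) \<oplus>\<^bsub>A Quot N\<^esub> (y \<oplus>\<^bsub>A Quot N\<^esub> \<ominus>\<^bsub>A Quot N\<^esub> y)"
        using that by (simp only: D.minus_eq D.a_ac D.a_closed D.a_inv_closed)
      then show ?thesis using that by (simp add: D.r_neg)
    qed
    have "\<Phi> c = \<zero>\<^bsub>A Quot N\<^esub>" if "c \<in> rel" for c
      using that unfolding rel_def tensor_relations_def
    proof (elim UnE CollectE exE conjE)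
      fix a a' b assume c: "c = frag_of (a \<oplus>\<^bsub>A\<^esub> a', b) - frag_of (a, b) - frag_of (a', b)"
        and ab: "a \<in> carrier A" "a' \<in> carrier A" "b \<in> carrier B"
      show ?thesis unfolding c using ab cancel
        by (simp add: \<Phi>_diff zd fz \<Phi>_frag D.l_distr)
    next
      fix a b b' assume c: "c = frag_of (a, b \<oplus>\<^bsub>B\<^esub> b') - frag_of (a, b) - frag_of (a, b')"
        and ab: "a \<in> carrier A" "b \<in> carrier B" "b' \<in> carrier B"
      show ?thesis unfolding c using ab cancel
        by (simp add: \<Phi>_diff zd fz \<Phi>_frag D.r_distr)
    next
      fix r a b assume c: "c = frag_of (f r \<otimes>\<^bsub>A\<^esub> a, b) - frag_of (a, g r \<otimes>\<^bsub>B\<^esub> b)"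
        and ab: "r \<in> carrier R" "a \<in> carrier A" "b \<in> carrier B"
      show ?thesis unfolding c using ab
        by (simp add: \<Phi>_diff fz \<Phi>_frag \<gamma>(2) D.m_ac D.minus_eq D.r_neg)
    qed
    then show "rel \<subseteq> {c \<in> carrier Z. \<Phi> c \<in> {\<zero>\<^bsub>A Quot N\<^esub>}}" using rel_Z by auto
  qed
  then have \<Phi>J: "\<Phi> c = \<zero>\<^bsub>A Quot N\<^esub>" if "c \<in> J" for c using that by blast
  have ker2: "a \<in> N" if a: "a \<in> carrier A" and "h a = \<zero>\<^bsub>Z Quot J\<^esub>" for a
  proof -
    have "\<Phi> (frag_of (a, \<one>\<^bsub>B\<^esub>)) = \<zero>\<^bsub>A Quot N\<^esub>" using that h_frag \<Phi>J by simp
    then show ?thesis using a by (simp add: \<Phi>_frag flip: \<nu>0)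
  qed
  have ker: "h a = \<zero>\<^bsub>Z Quot J\<^esub> \<longleftrightarrow> a \<in> Idl\<^bsub>A\<^esub> (f ` {r \<in> carrier R. g r = \<zero>\<^bsub>B\<^esub>})"
    if "a \<in> carrier A" for a
    using ker1 ker2[OF that] unfolding N_def I_def by blast
  show thesis
    by (rule that[unfolded T, OF T.is_cring h_hom h_surj ker])
qed

section \<open>Chains of primes in monoid algebras of polynomial growth\<close>

lemma type_algebra_simps [simp]:
  "carrier ring_of_type_algebra = UNIV"
  "x \<otimes>\<^bsub>ring_of_type_algebra\<^esub> y = x * y"
  "\<one>\<^bsub>ring_of_type_algebra\<^esub> = 1"
  "x \<oplus>\<^bsub>ring_of_type_algebra\<^esub> y = x + y"
  "\<zero>\<^bsub>ring_of_type_algebra\<^esub> = 0"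
  by (simp_all add: ring_of_type_algebra_def)

lemma type_algebra_update_simps [simp]:
  "x \<otimes>\<^bsub>ring_of_type_algebra\<lparr>carrier := C\<rparr>\<^esub> y = x * y"
  "\<one>\<^bsub>ring_of_type_algebra\<lparr>carrier := C\<rparr>\<^esub> = 1"
  "x \<oplus>\<^bsub>ring_of_type_algebra\<lparr>carrier := C\<rparr>\<^esub> y = x + y"
  "\<zero>\<^bsub>ring_of_type_algebra\<lparr>carrier := C\<rparr>\<^esub> = 0"
  by (simp_all add: ring_of_type_algebra_def)

lemma cring_type_algebra_update:
  fixes C :: "'a::comm_ring_1 set"
  assumes "1 \<in> C" "\<And>x y. x \<in> C \<Longrightarrow> y \<in> C \<Longrightarrow> x * y \<in> C" "\<And>x y. x \<in> C \<Longrightarrow> y \<in> C \<Longrightarrow> x - y \<in> C"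
  shows "cring (ring_of_type_algebra\<lparr>carrier := C\<rparr>)"
proof -
  have z: "0 \<in> C" using assms(3)[OF assms(1,1)] by simp
  have m: "- x \<in> C" if "x \<in> C" for x using assms(3)[OF z that] by simp
  have p: "x + y \<in> C" if "x \<in> C" "y \<in> C" for x y using assms(3)[OF that(1) m[OF that(2)]] by simp
  show ?thesis
  proof (rule cringI)
    show "abelian_group (ring_of_type_algebra\<lparr>carrier := C\<rparr>)"
    proof (rule abelian_groupI)
      fix x assume "x \<in> carrier (ring_of_type_algebra\<lparr>carrier := C\<rparr>)"
      then show "\<exists>y\<in>carrier (ring_of_type_algebra\<lparr>carrier := C\<rparr>).
          y \<oplus>\<^bsub>ring_of_type_algebra\<lparr>carrier := C\<rparr>\<^esub> x = \<zero>\<^bsub>ring_of_type_algebra\<lparr>carrier := C\<rparr>\<^esub>"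
        using m by (intro bexI[of _ "- x"]) auto
    qed (use z p in \<open>simp_all add: add_ac\<close>)
    show "comm_monoid (ring_of_type_algebra\<lparr>carrier := C\<rparr>)"
      by (rule comm_monoidI) (use assms in \<open>simp_all add: mult_ac\<close>)
  qed (simp add: algebra_simps)
qed

text \<open>Gaussian elimination: the equation \<open>b\<close> is solved for the unknown of a pivot
  \<open>a0\<close>, and \<open>M'\<close> is the system left for the other unknowns after
  substitution.\<close>

lemma homogeneous_system:
  fixes M :: "'a \<Rightarrow> 'b \<Rightarrow> 'k::field"
  assumes "finite B" "finite A" "card B < card A"
  shows "\<exists>c. (\<exists>a\<in>A. c a \<noteq> 0) \<and> (\<forall>b\<in>B. (\<Sum>a\<in>A. c a * M a b) = 0)"
  using assms
proof (induction B arbitrary: A M rule: finite_induct)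
  case empty
  then have "A \<noteq> {}" by auto
  then show ?case by (intro exI[of _ "\<lambda>_. 1"]) auto
next
  case (insert b B)
  show ?case
  proof (cases "\<forall>a\<in>A. M a b = 0")
    case True
    have "card B < card A" using insert by simp
    then obtain c where "\<exists>a\<in>A. c a \<noteq> 0" "\<forall>b\<in>B. (\<Sum>a\<in>A. c a * M a b) = 0"
      using insert.IH[OF insert.prems(1), of M] by blast
    with True show ?thesis by (intro exI[of _ c]) auto
  next
    case False
    then obtain a0 where a0: "a0 \<in> A" "M a0 b \<noteq> 0" by blast
    define M' where "M' a b' = M a b' - M a b / M a0 b * M a0 b'" for a b'
    have "card B < card (A - {a0})" using insert a0 by simp
    then obtain c where c: "\<exists>a\<in>A - {a0}. c a \<noteq> 0" "\<forall>b\<in>B. (\<Sum>a\<in>A - {a0}. c a * M' a b) = 0"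
      using insert.IH[of "A - {a0}" M'] insert.prems(1) by auto
    define t where "t = (\<Sum>a\<in>A - {a0}. c a * M a b) / M a0 b"
    define c' where "c' = c(a0 := - t)"
    have sum: "(\<Sum>a\<in>A. c' a * M a b') = (\<Sum>a\<in>A - {a0}. c a * M a b') - t * M a0 b'" for b'
    proof -
      have "(\<Sum>a\<in>A. c' a * M a b') = c' a0 * M a0 b' + (\<Sum>a\<in>A - {a0}. c' a * M a b')"
        using insert.prems(1) a0(1) by (rule sum.remove)
      also have "(\<Sum>a\<in>A - {a0}. c' a * M a b') = (\<Sum>a\<in>A - {a0}. c a * M a b')"
        by (rule sum.cong) (auto simp: c'_def)
      finally show ?thesis by (simp add: c'_def)
    qed
    have "(\<Sum>a\<in>A. c' a * M a b') = 0" if "b' \<in> B" for b'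
    proof -
      have "(\<Sum>a\<in>A - {a0}. c a * M' a b')
          = (\<Sum>a\<in>A - {a0}. c a * M a b') - (\<Sum>a\<in>A - {a0}. c a * M a b / M a0 b * M a0 b')"
        by (simp add: M'_def algebra_simps sum_subtractf)
      also have "(\<Sum>a\<in>A - {a0}. c a * M a b / M a0 b * M a0 b') = t * M a0 b'"
        by (simp add: t_def sum_divide_distrib sum_distrib_right)
      finally show ?thesis using c(2) that sum by simp
    qed
    moreover have "(\<Sum>a\<in>A. c' a * M a b) = 0" using sum a0(2) by (simp add: t_def)
    moreover have "\<exists>a\<in>A. c' a \<noteq> 0" using c(1) by (auto simp: c'_def)
    ultimately show ?thesis by (intro exI[of _ c']) auto
  qed
qed

text \<open>The offset \<open>s\<close> lets the elimination drop the first element without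
  renumbering the rest of the chain.\<close>

primrec mono_val :: "(nat \<Rightarrow> 'a::comm_semiring_1) \<Rightarrow> nat \<Rightarrow> nat list \<Rightarrow> 'a" where
  "mono_val x s [] = 1"
| "mono_val x s (a # l) = x s ^ a * mono_val x (Suc s) l"

text \<open>The elimination of Coquand and Lombardi: dividing the relation by the lowest power of
  \<open>x s\<close> leaves a relation, modulo the next prime, between the remaining elements.\<close>

lemma prime_chain_algebraic_relation:
  fixes C :: "'a::comm_ring_1 set" and c :: "nat list \<Rightarrow> 'a"
  defines "S \<equiv> ring_of_type_algebra\<lparr>carrier := C\<rparr>"
  assumes C: "1 \<in> C" "\<And>x y. x \<in> C \<Longrightarrow> y \<in> C \<Longrightarrow> x * y \<in> C" "\<And>x y. x \<in> C \<Longrightarrow> y \<in> C \<Longrightarrow> x - y \<in> C"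
    and "\<And>i. s \<le> i \<Longrightarrow> i \<le> s + m \<Longrightarrow> primeideal (P i) S"
    and "\<And>i. s \<le> i \<Longrightarrow> i < s + m \<Longrightarrow> P i \<subseteq> P (Suc i) \<and> x i \<in> P (Suc i) \<and> x i \<notin> P i"
    and "finite A" "A \<noteq> {}" "\<And>l. l \<in> A \<Longrightarrow> length l = m"
    and "\<And>l. l \<in> A \<Longrightarrow> c l \<in> C \<and> (\<exists>u\<in>C. u * c l = 1)"
    and "(\<Sum>l\<in>A. c l * mono_val x s l) \<in> P s"
  shows False
  using assms(5-)
proof (induction m arbitrary: s A c)
  case 0
  interpret P: primeideal "P s" S using 0(1) by simp
  \<comment> \<open>With no elements left the relation is a single invertible constant, which cannot
    lie in a prime.\<close>
  have "A = {[]}" using 0 by auto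
  then obtain u where u: "u \<in> C" "u * c [] = 1" and c: "c [] \<in> P s" using 0(6,7) by auto
  have "u * c [] \<in> P s" using P.I_l_closed[OF c, of u] u(1) by (simp add: S_def)
  then show False using P.one_imp_carrier P.I_notcarr u(2) by (simp add: S_def)
next
  case (Suc m)
  interpret P: primeideal "P s" S using Suc.prems(1) by simp
  interpret P': primeideal "P (Suc s)" S using Suc.prems(1) by simp
  have z: "0 \<in> C" using C(3)[OF C(1,1)] by simp
  have neg: "- y \<in> C" if "y \<in> C" for y using C(3)[OF z that] by simp
  have add: "y + w \<in> C" if "y \<in> C" "w \<in> C" for y w using C(3)[OF that(1) neg[OF that(2)]] by simp
  have sum: "sum g B \<in> C" if "\<And>b. b \<in> B \<Longrightarrow> g b \<in> C" for g :: "nat list \<Rightarrow> 'a" and B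
    using that by (induction B rule: infinite_finite_induct) (auto simp: z add)
  have pow: "y ^ n \<in> C" if "y \<in> C" for y n using that by (induction n) (auto simp: C)
  have xC: "x i \<in> C" if "s \<le> i" "i < s + Suc m" for i
  proof -
    have "primeideal (P (Suc i)) S" using Suc.prems(1)[of "Suc i"] that by simp
    then show ?thesis
      using ideal.Icarr[OF primeideal.axioms(1)] Suc.prems(2)[OF that] by (fastforce simp: S_def)
  qed
  have mv: "mono_val x i l \<in> C" if "s \<le> i" "i + length l \<le> s + Suc m" for i l
    using that by (induction l arbitrary: i) (auto simp: C pow xC)
  let ?y = "x s"
  have y: "?y \<in> P (Suc s)" "?y \<notin> P s" "?y \<in> C" "P s \<subseteq> P (Suc s)"
    using Suc.prems(2)[of s] xC[of s] by auto
  have ne: "hd ` A \<noteq> {}" "finite (hd ` A)" using Suc.prems(3,4) by auto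
  define a where "a = Min (hd ` A)"
  have a_le: "a \<le> hd l" if "l \<in> A" for l using that ne(2) by (simp add: a_def)
  have "a \<in> hd ` A" unfolding a_def using ne by (rule Min_in[rotated])
  then obtain l0 where l0: "l0 \<in> A" "hd l0 = a" by blast
  define A' where "A' = {l. a # l \<in> A}"
  have A_cons: "l = hd l # tl l" if "l \<in> A" for l using Suc.prems(5)[OF that] by (cases l) auto
  have split: "A = (#) a ` A' \<union> {l \<in> A. a < hd l}"
  proof (intro equalityI subsetI)
    fix l assume l: "l \<in> A"
    show "l \<in> (#) a ` A' \<union> {l \<in> A. a < hd l}"
    proof (cases "hd l = a")
      case True
      then have "l = a # tl l" using A_cons[OF l] by simp
      then show ?thesis using l by (auto simp: A'_def)
    next
      case False
      then show ?thesis using l a_le[OF l] by simp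
    qed
  qed (auto simp: A'_def)
  have fin: "finite A'" unfolding A'_def
    using finite_vimageI[OF Suc.prems(3), of "(#) a"] by (simp add: vimage_def inj_def)
  have "a # tl l0 \<in> A" using A_cons[OF l0(1)] l0 by metis
  then have A'_ne: "A' \<noteq> {}" by (auto simp: A'_def)
  \<comment> \<open>After division by the lowest power \<open>x s ^ a\<close>, the relation reads
    \<open>v + x s * w\<close>, where the monomials of \<open>v\<close> no longer involve
    \<open>x s\<close>.\<close>
  define v where "v = (\<Sum>l\<in>A'. c (a # l) * mono_val x (Suc s) l)"
  define w where "w = (\<Sum>l\<in>{l \<in> A. a < hd l}. c l * (?y ^ (hd l - Suc a) * mono_val x (Suc s) (tl l)))"
  have lenA: "length l = Suc m" if "l \<in> A" for l using Suc.prems(5)[OF that] .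
  have vC: "v \<in> C" unfolding v_def
  proof (rule sum)
    fix l assume "l \<in> A'"
    then have "a # l \<in> A" by (simp add: A'_def)
    then show "c (a # l) * mono_val x (Suc s) l \<in> C"
      using Suc.prems(6)[of "a # l"] lenA[of "a # l"] by (intro C mv) auto
  qed
  have wC: "w \<in> C" unfolding w_def
    using Suc.prems(6) lenA by (intro sum C mv pow y) auto
  have "(\<Sum>l\<in>A. c l * mono_val x s l) = (\<Sum>l\<in>(#) a ` A'. c l * mono_val x s l)
      + (\<Sum>l\<in>{l \<in> A. a < hd l}. c l * mono_val x s l)"
    by (subst split, rule sum.union_disjoint) (use fin Suc.prems(3) in auto)
  also have "(\<Sum>l\<in>(#) a ` A'. c l * mono_val x s l) = ?y ^ a * v"
    unfolding v_def by (subst sum.reindex) (auto simp: sum_distrib_left mult_ac)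
  also have "(\<Sum>l\<in>{l \<in> A. a < hd l}. c l * mono_val x s l) = ?y ^ a * (?y * w)"
    unfolding w_def sum_distrib_left
  proof (rule sum.cong)
    fix l assume "l \<in> {l \<in> A. a < hd l}"
    then have l: "l \<in> A" "a < hd l" by auto
    have "mono_val x s l = ?y ^ hd l * mono_val x (Suc s) (tl l)"
      by (subst A_cons[OF l(1)]) simp
    also have "hd l = a + Suc (hd l - Suc a)" using l by simp
    then have "?y ^ hd l = ?y ^ a * (?y * ?y ^ (hd l - Suc a))" by (metis power_Suc power_add)
    finally show "c l * mono_val x s l
        = ?y ^ a * (?y * (c l * (?y ^ (hd l - Suc a) * mono_val x (Suc s) (tl l))))"
      by (simp add: mult_ac)
  qed simp
  finally have "?y ^ a * (v + ?y * w) \<in> P s" using Suc.prems(7) by (simp add: algebra_simps)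
  moreover have "v + ?y * w \<in> C" using vC wC y by (simp add: add C)
  moreover have "?y ^ n \<notin> P s" for n
  proof (induction n)
    case 0
    show ?case using P.one_imp_carrier P.I_notcarr by (auto simp: S_def)
  next
    case (Suc n)
    then show ?case using P.I_prime[of ?y "?y ^ n"] y pow by (auto simp: S_def)
  qed
  ultimately have "v + ?y * w \<in> P s"
    using P.I_prime[of "?y ^ a" "v + ?y * w"] pow y by (auto simp: S_def)
  then have "v + ?y * w \<in> P (Suc s)" using y by blast
  moreover have "- w * ?y \<in> P (Suc s)"
    using P'.I_l_closed[OF y(1), of "- w"] wC neg by (simp add: S_def)
  ultimately have "v + ?y * w + - w * ?y \<in> P (Suc s)"
    using P'.a_closed[of "v + ?y * w" "- w * ?y"] by (simp add: S_def)
  then have vP: "v \<in> P (Suc s)" by (simp add: algebra_simps)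
  show False
  proof (rule Suc.IH[of "Suc s" A' "\<lambda>l. c (a # l)"])
    show "(\<Sum>l\<in>A'. c (a # l) * mono_val x (Suc s) l) \<in> P (Suc s)" using vP by (simp add: v_def)
    show "length l = m" if "l \<in> A'" for l using lenA[of "a # l"] that by (simp add: A'_def)
  qed (use Suc.prems fin A'_ne in \<open>auto simp: A'_def\<close>)
qed

section \<open>Elements with prescribed support and maps between monoid algebras\<close>

lemma poly_mapping_expand: "f = (\<Sum>x\<in>Poly_Mapping.keys f. Poly_Mapping.single x (Poly_Mapping.lookup f x))"
  by (rule poly_mapping_eqI)
     (auto simp: lookup_sum lookup_single when_def in_keys_iff if_distrib cong: if_cong)

text \<open>For a set of exponents closed under adding arbitrary ones this is a monomial ideal; for
  a submonoid it is the monoid algebra. Both readings are used.\<close>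

definition keys_in :: "'a set \<Rightarrow> ('a \<Rightarrow>\<^sub>0 'b::zero) set" where
  "keys_in E = {f. Poly_Mapping.keys f \<subseteq> E}"

lemma keys_diff_subset: "Poly_Mapping.keys (f - g) \<subseteq> Poly_Mapping.keys f \<union> Poly_Mapping.keys g"
  for f g :: "'a \<Rightarrow>\<^sub>0 'b::ab_group_add"
proof
  fix x assume "x \<in> Poly_Mapping.keys (f - g)"
  then have "Poly_Mapping.lookup f x - Poly_Mapping.lookup g x \<noteq> 0"
    by (simp add: in_keys_iff lookup_minus)
  then show "x \<in> Poly_Mapping.keys f \<union> Poly_Mapping.keys g" by (auto simp: in_keys_iff)
qed

lemma keys_in_diff: "f \<in> keys_in E \<Longrightarrow> g \<in> keys_in E \<Longrightarrow> f - g \<in> keys_in E"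
  for f g :: "'a \<Rightarrow>\<^sub>0 'b::ab_group_add"
  unfolding keys_in_def using keys_diff_subset[of f g] by blast

lemma keys_in_add: "f \<in> keys_in E \<Longrightarrow> g \<in> keys_in E \<Longrightarrow> f + g \<in> keys_in E"
  for f g :: "'a \<Rightarrow>\<^sub>0 'b::monoid_add"
  using keys_add[of f g] by (auto simp: keys_in_def)

lemma keys_in_sum: "(\<And>i. i \<in> I \<Longrightarrow> f i \<in> keys_in E) \<Longrightarrow> sum f I \<in> keys_in E"
  for f :: "'i \<Rightarrow> 'a \<Rightarrow>\<^sub>0 'b::comm_monoid_add"
proof (induction I rule: infinite_finite_induct)
  case (insert i I)
  then show ?case by (simp add: keys_in_add)
qed (simp_all add: keys_in_def)

lemma keys_in_mult:
  fixes f g :: "'a::comm_monoid_add \<Rightarrow>\<^sub>0 'b::semiring_0"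
  assumes "f \<in> keys_in E" "g \<in> keys_in F" "\<And>x y. x \<in> E \<Longrightarrow> y \<in> F \<Longrightarrow> x + y \<in> G"
  shows "f * g \<in> keys_in G"
  using keys_mult[of f g] assms by (fastforce simp: keys_in_def)

lemma single_in_keys_in: "x \<in> E \<Longrightarrow> Poly_Mapping.single x c \<in> keys_in E"
  by (simp add: keys_in_def)

lemma lookup_single_0_mult:
  fixes f :: "'a::monoid_add \<Rightarrow>\<^sub>0 'b::semiring_1"
  shows "Poly_Mapping.lookup (Poly_Mapping.single 0 c * f) x = c * Poly_Mapping.lookup f x"
proof -
  have "Poly_Mapping.map ((*) c) f = Poly_Mapping.single 0 c * f" by (rule mult_map_scale_conv_mult)
  moreover have "Poly_Mapping.lookup (Poly_Mapping.map ((*) c) f) x = c * Poly_Mapping.lookup f x"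
    by (simp add: map.rep_eq when_def)
  ultimately show ?thesis by simp
qed

lemma keys_in_subalgebra:
  fixes \<Gamma> :: "'m::comm_monoid_add set"
  assumes "0 \<in> \<Gamma>" "\<And>x y. x \<in> \<Gamma> \<Longrightarrow> y \<in> \<Gamma> \<Longrightarrow> x + y \<in> \<Gamma>"
  shows "1 \<in> (keys_in \<Gamma> :: ('m \<Rightarrow>\<^sub>0 'k::comm_ring_1) set)"
    and "\<And>x y. x \<in> (keys_in \<Gamma> :: ('m \<Rightarrow>\<^sub>0 'k) set) \<Longrightarrow> y \<in> keys_in \<Gamma> \<Longrightarrow> x * y \<in> keys_in \<Gamma>"
    and "\<And>x y. x \<in> (keys_in \<Gamma> :: ('m \<Rightarrow>\<^sub>0 'k) set) \<Longrightarrow> y \<in> keys_in \<Gamma> \<Longrightarrow> x - y \<in> keys_in \<Gamma>"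
  using assms by (simp_all add: keys_in_diff keys_in_mult)
     (simp add: keys_in_def flip: single_one)

text \<open>The quotient map that kills the monomials off a face \<open>F\<close>, followed by the
  map of monoid algebras induced by \<open>h\<close>.\<close>

definition push :: "'a set \<Rightarrow> ('a \<Rightarrow> 'b) \<Rightarrow> ('a \<Rightarrow>\<^sub>0 'k::comm_monoid_add) \<Rightarrow> ('b \<Rightarrow>\<^sub>0 'k)" where
  "push F h f = (\<Sum>x\<in>Poly_Mapping.keys f. if x \<in> F then Poly_Mapping.single (h x) (Poly_Mapping.lookup f x) else 0)"

lemma push_superset:
  assumes "finite A" "Poly_Mapping.keys f \<subseteq> A"
  shows "push F h f = (\<Sum>x\<in>A. if x \<in> F then Poly_Mapping.single (h x) (Poly_Mapping.lookup f x) else 0)"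
  unfolding push_def
  by (rule sum.mono_neutral_left) (use assms in \<open>auto simp: in_keys_iff\<close>)

lemma push_0 [simp]: "push F h 0 = 0"
  by (simp add: push_def)

lemma push_single: "push F h (Poly_Mapping.single x c) = (if x \<in> F then Poly_Mapping.single (h x) c else 0)"
  by (simp add: push_def)

lemma push_add: "push F h (f + g) = push F h f + push F h g"
proof -
  let ?A = "Poly_Mapping.keys f \<union> Poly_Mapping.keys g"
  have "push F h (f + g) = (\<Sum>x\<in>?A. if x \<in> F then Poly_Mapping.single (h x) (Poly_Mapping.lookup (f + g) x) else 0)"
    by (rule push_superset) (use keys_add[of f g] in auto)
  also have "\<dots> = (\<Sum>x\<in>?A. if x \<in> F then Poly_Mapping.single (h x) (Poly_Mapping.lookup f x) else 0)
     + (\<Sum>x\<in>?A. if x \<in> F then Poly_Mapping.single (h x) (Poly_Mapping.lookup g x) else 0)"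
    by (subst sum.distrib[symmetric], rule sum.cong) (auto simp: lookup_add single_add)
  also have "\<dots> = push F h f + push F h g"
    by (subst (1 2) push_superset[of ?A]) auto
  finally show ?thesis .
qed

lemma push_sum: "push F h (sum f I) = (\<Sum>i\<in>I. push F h (f i))"
  by (induction I rule: infinite_finite_induct) (simp_all add: push_add)

lemma push_uminus: "push F h (- f) = - push F h f" for f :: "'a \<Rightarrow>\<^sub>0 'k::ab_group_add"
proof -
  have "push F h (- f + f) = push F h (- f) + push F h f" by (rule push_add)
  then show ?thesis by (simp add: eq_neg_iff_add_eq_0)
qed

lemma push_diff: "push F h (f - g) = push F h f - push F h g" for f g :: "'a \<Rightarrow>\<^sub>0 'k::ab_group_add"
  using push_add[of F h f "- g"] by (simp add: push_uminus)

lemma push_push: "push UNIV h' (push F h f) = push F (h' \<circ> h) f"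
  unfolding push_def[of F] push_sum
  by (rule sum.cong) (auto simp: push_single)

text \<open>Reduced to single terms, this is the face condition: a product of monomials survives
  exactly when both factors do.\<close>

lemma push_mult:
  fixes f g :: "'m::comm_monoid_add \<Rightarrow>\<^sub>0 'k::comm_semiring_1" and h :: "'m \<Rightarrow> 'n::comm_monoid_add"
  assumes "f \<in> keys_in E" "g \<in> keys_in E'"
    and F: "\<And>x y. x \<in> E \<Longrightarrow> y \<in> E' \<Longrightarrow> x + y \<in> F \<longleftrightarrow> x \<in> F \<and> y \<in> F"
    and h: "\<And>x y. h (x + y) = h x + h y"
  shows "push F h (f * g) = push F h f * push F h g"
proof -
  let ?f = "\<lambda>x. Poly_Mapping.single x (Poly_Mapping.lookup f x)"
  let ?g = "\<lambda>x. Poly_Mapping.single x (Poly_Mapping.lookup g x)"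
  have "f * g = (\<Sum>x\<in>Poly_Mapping.keys f. ?f x) * (\<Sum>x\<in>Poly_Mapping.keys g. ?g x)"
    by (simp flip: poly_mapping_expand)
  also have "\<dots> = (\<Sum>x\<in>Poly_Mapping.keys f. \<Sum>y\<in>Poly_Mapping.keys g. ?f x * ?g y)"
    by (rule sum_product)
  finally have "push F h (f * g) = (\<Sum>x\<in>Poly_Mapping.keys f. \<Sum>y\<in>Poly_Mapping.keys g. push F h (?f x * ?g y))"
    by (simp add: push_sum)
  also have "\<dots> = (\<Sum>x\<in>Poly_Mapping.keys f. \<Sum>y\<in>Poly_Mapping.keys g.
      (if x \<in> F then Poly_Mapping.single (h x) (Poly_Mapping.lookup f x) else 0) *
      (if y \<in> F then Poly_Mapping.single (h y) (Poly_Mapping.lookup g y) else 0))"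
  proof (intro sum.cong refl)
    fix x y assume "x \<in> Poly_Mapping.keys f" "y \<in> Poly_Mapping.keys g"
    then have "x + y \<in> F \<longleftrightarrow> x \<in> F \<and> y \<in> F"
      using assms(1,2) by (intro F) (auto simp: keys_in_def)
    then show "push F h (?f x * ?g y)
      = (if x \<in> F then Poly_Mapping.single (h x) (Poly_Mapping.lookup f x) else 0) *
        (if y \<in> F then Poly_Mapping.single (h y) (Poly_Mapping.lookup g y) else 0)"
      by (auto simp: mult_single push_single h)
  qed
  also have "\<dots> = push F h f * push F h g"
    unfolding push_def by (rule sum_product[symmetric])
  finally show ?thesis .
qed

lemma mono_val_degree:
  fixes x :: "nat \<Rightarrow> 'm::comm_monoid_add \<Rightarrow>\<^sub>0 'k::comm_ring_1" and deg :: "'m \<Rightarrow> nat"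
  assumes "deg 0 = 0" "\<And>a b. deg (a + b) = deg a + deg b"
    and "\<And>i b. i < s + length l \<Longrightarrow> b \<in> Poly_Mapping.keys (x i) \<Longrightarrow> deg b \<le> D"
  shows "mono_val x s l \<in> keys_in {b. deg b \<le> D * sum_list l}"
  using assms(3)
proof (induction l arbitrary: s)
  case Nil
  then show ?case using assms(1) by (simp add: keys_in_def)
next
  case (Cons n l)
  have "x s ^ n \<in> keys_in {b. deg b \<le> D * n}"
  proof (induction n)
    case 0
    then show ?case using assms(1) by (simp add: keys_in_def)
  next
    case (Suc n)
    have "x s \<in> keys_in {b. deg b \<le> D}" using Cons.prems[of s] by (auto simp: keys_in_def)
    from keys_in_mult[OF this Suc] show ?case
      using assms(2) by (simp add: add_mono)
  qed
  moreover have "mono_val x (Suc s) l \<in> keys_in {b. deg b \<le> D * sum_list l}"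
    using Cons.prems by (intro Cons.IH) auto
  ultimately show ?case
    unfolding mono_val.simps
    by (rule keys_in_mult) (simp add: assms(2) add_mono distrib_left)
qed

text \<open>If a chain were longer, the monomials with exponents at most \<open>N\<close> in the \<open>d + 1\<close> elements
  separating its first primes would, for large \<open>N\<close>, outnumber the coefficients at \<open>G\<close>
  that they involve, and so would be linearly dependent modulo the first prime.\<close>

lemma chain_length_bound:
  fixes \<Gamma> G :: "'m::comm_monoid_add set" and deg :: "'m \<Rightarrow> nat"
    and P :: "nat \<Rightarrow> ('m \<Rightarrow>\<^sub>0 'k::field) set"
  assumes \<Gamma>: "0 \<in> \<Gamma>" "\<And>x y. x \<in> \<Gamma> \<Longrightarrow> y \<in> \<Gamma> \<Longrightarrow> x + y \<in> \<Gamma>"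
    and deg: "deg 0 = 0" "\<And>a b. deg (a + b) = deg a + deg b"
    and growth: "\<And>N. finite {x \<in> G. deg x \<le> N} \<and> card {x \<in> G. deg x \<le> N} \<le> (K * N + 1) ^ d"
    and chain: "prime_chain (ring_of_type_algebra\<lparr>carrier := keys_in \<Gamma>\<rparr>) k P"
    and P0: "\<And>f. f \<in> keys_in (\<Gamma> - G) \<Longrightarrow> f \<in> P 0"
  shows "k \<le> d"
proof (rule ccontr)
  assume "\<not> k \<le> d"
  then have dk: "d < k" by simp
  let ?S = "ring_of_type_algebra\<lparr>carrier := keys_in \<Gamma> :: ('m \<Rightarrow>\<^sub>0 'k) set\<rparr>"
  have pr: "primeideal (P i) ?S" if "i \<le> Suc d" for i
    using chain dk that by (simp add: prime_chain_def)
  have "\<exists>y. y \<in> P (Suc i) \<and> y \<notin> P i" if "i < Suc d" for i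
  proof -
    have "P i \<subset> P (Suc i)" using chain dk that by (simp add: prime_chain_def)
    then show ?thesis by blast
  qed
  then obtain x where x: "\<And>i. i < Suc d \<Longrightarrow> x i \<in> P (Suc i) \<and> x i \<notin> P i" by metis
  have xS: "x i \<in> keys_in \<Gamma>" if "i < Suc d" for i
    using x[OF that] ideal.Icarr[OF primeideal.axioms(1)[OF pr[of "Suc i"]], of "x i"] that by simp
  define D where "D = Max (insert 0 (deg ` (\<Union>i<Suc d. Poly_Mapping.keys (x i))))"
  have D: "deg b \<le> D" if "i < Suc d" "b \<in> Poly_Mapping.keys (x i)" for i b
    unfolding D_def using that by (intro Max_ge) auto
  \<comment> \<open>A monomial with \<open>d + 1\<close> exponents at most \<open>N\<close> has
    degree at most \<open>c * N\<close>. The choice of \<open>N\<close> gives \<open>(K * c * N + 1)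
    ^ d \<le> ((K * c + 1) * (N + 1)) ^ d = N * (N + 1) ^ d\<close>, less than the number
    \<open>(N + 1) ^ (d + 1)\<close> of monomials.\<close>
  define c where "c = D * Suc d"
  define N where "N = (K * c + 1) ^ d"
  define L where "L = {l. set l \<subseteq> {..N} \<and> length l = Suc d}"
  define B where "B = {x \<in> G. deg x \<le> c * N}"
  have finL: "finite L" and cardL: "card L = (N + 1) ^ Suc d"
    unfolding L_def using finite_lists_length_eq[of "{..N}" "Suc d"] card_lists_length_eq[of "{..N}" "Suc d"]
    by simp_all
  have "card B \<le> (K * (c * N) + 1) ^ d" using growth unfolding B_def by blast
  also have "\<dots> \<le> ((K * c + 1) * (N + 1)) ^ d" by (rule power_mono) (auto simp: algebra_simps)
  also have "\<dots> = N * (N + 1) ^ d" by (simp only: power_mult_distrib flip: N_def)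
  also have "\<dots> < card L" unfolding cardL by simp
  finally have lt: "card B < card L" .
  have finB: "finite B" using growth unfolding B_def by blast
  obtain a where a: "\<exists>l\<in>L. a l \<noteq> 0"
    and a0: "\<forall>b\<in>B. (\<Sum>l\<in>L. a l * Poly_Mapping.lookup (mono_val x 0 l) b) = 0"
    using homogeneous_system[OF finB finL lt, of "\<lambda>l. Poly_Mapping.lookup (mono_val x 0 l)"] by blast
  \<comment> \<open>The elimination needs invertible coefficients, so the zero ones are left
    out.\<close>
  define A where "A = {l \<in> L. a l \<noteq> 0}"
  define f where "f = (\<Sum>l\<in>A. Poly_Mapping.single 0 (a l) * mono_val x 0 l)"
  have lookup_f: "Poly_Mapping.lookup f b = (\<Sum>l\<in>L. a l * Poly_Mapping.lookup (mono_val x 0 l) b)" for b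
    unfolding f_def lookup_sum lookup_single_0_mult A_def
    by (rule sum.mono_neutral_left) (use finL in auto)
  note S = keys_in_subalgebra[OF \<Gamma>, where ?'k = 'k]
  have mv\<Gamma>: "mono_val x s l \<in> keys_in \<Gamma>" if "s + length l \<le> Suc d" for s l
    using that
  proof (induction l arbitrary: s)
    case (Cons n l)
    have "x s ^ n \<in> keys_in \<Gamma>" using xS[of s] Cons.prems by (induction n) (auto simp: S)
    with Cons show ?case by (simp add: S)
  qed (simp add: S)
  have c\<Gamma>: "Poly_Mapping.single 0 t \<in> keys_in \<Gamma>" for t :: 'k
    using \<Gamma> by (simp add: single_in_keys_in)
  have "f \<in> keys_in \<Gamma>"
    unfolding f_def by (rule keys_in_sum) (auto intro!: S mv\<Gamma> c\<Gamma> simp: A_def L_def)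
  \<comment> \<open>Coefficients at \<open>G\<close> of degree up to \<open>c * N\<close> vanish by
    the linear system, those of larger degree because no monomial reaches them.\<close>
  moreover have "Poly_Mapping.lookup f b = 0" if b: "b \<in> G" for b
  proof (cases "deg b \<le> c * N")
    case True
    then show ?thesis using a0 b lookup_f by (simp add: B_def)
  next
    case False
    have "Poly_Mapping.lookup (mono_val x 0 l) b = 0" if l: "l \<in> L" for l
    proof -
      have m: "mono_val x 0 l \<in> keys_in {b. deg b \<le> D * sum_list l}"
        by (rule mono_val_degree) (use deg D l in \<open>auto simp: L_def\<close>)
      have "sum_list l \<le> length l * N"
      proof -
        have "set l \<subseteq> {..N}" using l by (simp add: L_def)
        then show ?thesis by (induction l) auto
      qed
      then have "D * sum_list l \<le> D * (length l * N)" by (rule mult_le_mono2)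
      moreover have "D * (length l * N) = c * N" using l by (simp add: c_def L_def algebra_simps)
      ultimately have "D * sum_list l \<le> c * N" by (rule ord_le_eq_trans)
      then show ?thesis using m False by (force simp: keys_in_def in_keys_iff)
    qed
    then show ?thesis by (simp add: lookup_f)
  qed
  ultimately have "f \<in> keys_in (\<Gamma> - G)" by (auto simp: keys_in_def in_keys_iff subset_iff)
  then have "f \<in> P 0" by (rule P0)
  have unit: "Poly_Mapping.single 0 (inverse (a l)) * Poly_Mapping.single (0 :: 'm) (a l) = 1"
    if "a l \<noteq> 0" for l
    using that by (simp add: mult_single)
  show False
  proof (rule prime_chain_algebraic_relation[of "keys_in \<Gamma>" 0 "Suc d" P x A "\<lambda>l. Poly_Mapping.single 0 (a l)"])
    show "P i \<subseteq> P (Suc i) \<and> x i \<in> P (Suc i) \<and> x i \<notin> P i" if "i < 0 + Suc d" for i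
      using x that prime_chain_mono[OF chain, of i "Suc i"] dk by simp
    show "(\<Sum>l\<in>A. Poly_Mapping.single 0 (a l) * mono_val x 0 l) \<in> P 0"
      using \<open>f \<in> P 0\<close> by (simp add: f_def)
    show "Poly_Mapping.single 0 (a l) \<in> keys_in \<Gamma> \<and> (\<exists>u\<in>keys_in \<Gamma>. u * Poly_Mapping.single 0 (a l) = 1)"
      if "l \<in> A" for l
      using unit[of l] that c\<Gamma> by (auto simp: A_def)
    show "finite A" using finL by (simp add: A_def)
  qed (use S pr a in \<open>auto simp: A_def L_def\<close>)
qed

section \<open>Rational exponent vectors\<close>

text \<open>Rational scalars, because vectors of a span will have to be turned back into differences
  of exponents by clearing denominators.\<close>

definition dotp :: "rat^'v \<Rightarrow> rat^'v \<Rightarrow> rat" where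
  "dotp w a = (\<Sum>v\<in>UNIV. w $ v * a $ v)"

lemma dotp_simps:
  "dotp w (a + b) = dotp w a + dotp w b" "dotp w (c *s a) = c * dotp w a" "dotp w 0 = 0"
  "dotp (w + u) a = dotp w a + dotp u a" "dotp (c *s w) a = c * dotp w a" "dotp (- w) a = - dotp w a"
  by (simp_all add: dotp_def algebra_simps sum.distrib sum_distrib_left sum_negf)

lemma dotp_sum: "dotp w (sum f I) = (\<Sum>i\<in>I. dotp w (f i))"
  by (induction I rule: infinite_finite_induct) (simp_all add: dotp_simps)

lemma dotp_axis: "dotp w (axis v 1) = w $ v"
proof -
  have "dotp w (axis v 1) = (\<Sum>u\<in>UNIV. if u = v then w $ u else 0)"
    unfolding dotp_def by (rule sum.cong) (auto simp: axis_def)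
  then show ?thesis by simp
qed

lemma dotp_span_eq_0:
  assumes "\<And>b. b \<in> B \<Longrightarrow> dotp u b = 0" "x \<in> vec.span B"
  shows "dotp u x = 0"
  using assms(2)
  by (induction rule: vec.span_induct_alt) (simp_all add: dotp_simps assms(1))

text \<open>A feasible point with the largest possible rank of tight constraints: if the tight
  constraints did not span, one could move orthogonally to them until a new one becomes tight.\<close>

lemma spanning_tight_constraints:
  fixes G :: "(rat^'v) set"
  assumes fin: "finite G" and span: "vec.span G = UNIV" and w0: "\<And>a. a \<in> G \<Longrightarrow> 1 \<le> dotp w0 a"
  shows "\<exists>w. (\<forall>a\<in>G. 1 \<le> dotp w a) \<and> vec.span {a \<in> G. dotp w a = 1} = UNIV"
proof -
  define feas where "feas w \<longleftrightarrow> (\<forall>a\<in>G. 1 \<le> dotp w a)" for w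
  define tight where "tight w = {a \<in> G. dotp w a = 1}" for w
  have bound: "vec.dim (tight w) < Suc CARD('v)" for w
    using dim_subset_UNIV_cart_gen[of "tight w"] by simp
  have "feas w0" using w0 by (simp add: feas_def)
  then obtain w where w: "feas w" and max: "\<And>w'. feas w' \<Longrightarrow> vec.dim (tight w') \<le> vec.dim (tight w)"
    using ex_has_greatest_nat[of feas w0 "\<lambda>w. vec.dim (tight w)" "Suc CARD('v)"] bound by blast
  have "vec.span (tight w) = UNIV"
  proof (rule ccontr)
    assume ns: "vec.span (tight w) \<noteq> UNIV"
    obtain B where B: "B \<subseteq> tight w" "vec.independent B" "tight w \<subseteq> vec.span B" "card B = vec.dim (tight w)"
      by (rule vec.basis_exists)
    have "vec.dim (tight w) \<noteq> CARD('v)" using ns vec.dim_eq_full[of "tight w"] by (simp add: vec.dimension_def card_cart_basis)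
    then have lt: "card B < card (UNIV :: 'v set)" using bound[of w] B(4) by simp
    have "tight w \<subseteq> G" by (auto simp: tight_def)
    then have "finite B" using finite_subset[OF _ fin] B(1) by simp
    \<comment> \<open>Orthogonality to a basis of the tight constraints is a system with fewer
      equations than coordinates.\<close>
    from homogeneous_system[OF this finite lt, of "\<lambda>v (b :: rat^'v). b $ v"]
    obtain u where u: "\<exists>v. u v \<noteq> 0" "\<forall>b\<in>B. (\<Sum>v\<in>UNIV. u v * b $ v) = 0"
      by auto
    define U0 where "U0 = (\<chi> v. u v)"
    have U0: "U0 \<noteq> 0" "\<And>x. x \<in> tight w \<Longrightarrow> dotp U0 x = 0"
      using u dotp_span_eq_0[of B U0] B(3) by (auto simp: U0_def vec_eq_iff dotp_def)
    have "\<exists>a\<in>G. dotp U0 a \<noteq> 0"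
    proof (rule ccontr)
      assume "\<not> ?thesis"
      then have "dotp U0 x = 0" for x using dotp_span_eq_0[of G U0 x] span by simp
      then have "U0 $ v = 0" for v using dotp_axis[of U0 v] by simp
      then show False using U0(1) by (simp add: vec_eq_iff)
    qed
    then obtain a1 where a1: "a1 \<in> G" "dotp U0 a1 \<noteq> 0" by blast
    \<comment> \<open>The sign is chosen so that at least one constraint decreases along
      \<open>U\<close>; otherwise moving along it might never reach a new tight one.\<close>
    define U where "U = (if dotp U0 a1 < 0 then U0 else - U0)"
    have U: "\<And>x. x \<in> tight w \<Longrightarrow> dotp U x = 0" "dotp U a1 < 0"
      using U0(2) a1(2) by (auto simp: U_def dotp_simps)
    define Gm where "Gm = {a \<in> G. dotp U a < 0}"
    \<comment> \<open>The distance along \<open>U\<close> at which the decreasing constraint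
      \<open>a\<close> becomes tight. Stopping at the smallest of these keeps all constraints
      satisfied.\<close>
    define \<theta> where "\<theta> a = (dotp w a - 1) / (- dotp U a)" for a
    have Gm: "finite Gm" "Gm \<noteq> {}" using fin a1 U by (auto simp: Gm_def)
    define t where "t = Min (\<theta> ` Gm)"
    have t_le: "t \<le> \<theta> a" if "a \<in> Gm" for a using that Gm by (simp add: t_def)
    have "t \<in> \<theta> ` Gm" unfolding t_def using Gm by (intro Min_in) auto
    then obtain a2 where a2: "a2 \<in> Gm" "\<theta> a2 = t" by blast
    have "0 \<le> \<theta> a2"
      unfolding \<theta>_def using a2(1) w by (intro divide_nonneg_pos) (auto simp: Gm_def feas_def)
    then have t0: "0 \<le> t" using a2(2) by simp
    define w' where "w' = w + t *s U"
    have dw': "dotp w' a = dotp w a + t * dotp U a" for a by (simp add: w'_def dotp_simps)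
    have "feas w'"
      unfolding feas_def dw'
    proof
      fix a assume a: "a \<in> G"
      show "1 \<le> dotp w a + t * dotp U a"
      proof (cases "dotp U a < 0")
        case True
        then have "t * (- dotp U a) \<le> \<theta> a * (- dotp U a)"
          using a by (intro mult_right_mono t_le) (auto simp: Gm_def)
        then show ?thesis using True by (simp add: \<theta>_def)
      next
        case False
        then have "0 \<le> t * dotp U a" using t0 by simp
        then show ?thesis using w a by (force simp: feas_def)
      qed
    qed
    moreover have "insert a2 (tight w) \<subseteq> tight w'"
    proof -
      have "dotp U a2 < 0" "a2 \<in> G" using a2(1) by (auto simp: Gm_def)
      then have "a2 \<in> tight w'" using a2(2) by (auto simp: tight_def dw' \<theta>_def field_simps)
      moreover have "tight w \<subseteq> tight w'" using U(1) by (auto simp: tight_def dw')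
      ultimately show ?thesis by simp
    qed
    then have "vec.dim (insert a2 (tight w)) \<le> vec.dim (tight w')" by (rule vec.dim_subset)
    \<comment> \<open>The functional \<open>U\<close> vanishes on the span of the old tight
      constraints but not at \<open>a2\<close>, so the rank has grown against maximality.\<close>
    moreover have "a2 \<notin> vec.span (tight w)"
      using dotp_span_eq_0[of "tight w" U a2] U(1) a2(1) by (auto simp: Gm_def)
    ultimately show False using max[of w'] by (simp add: vec.dim_insert)
  qed
  with w show ?thesis unfolding feas_def tight_def by blast
qed

section \<open>Ranks under coordinate projections\<close>

definition proj :: "'v set \<Rightarrow> rat^'v \<Rightarrow> rat^'v" where
  "proj U x = (\<chi> v. if v \<in> U then x $ v else 0)"

lemma linear_proj: "Vector_Spaces.linear (*s) (*s) (proj U)"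
  by unfold_locales (auto simp: proj_def vec_eq_iff algebra_simps)

lemma dim_proj_insert_le: "vec.dim (proj (insert v U) ` Z) \<le> Suc (vec.dim (proj U ` Z))"
proof -
  have "proj (insert v U) ` Z \<subseteq> vec.span (insert (axis v 1) (proj U ` Z))"
  proof
    fix y assume "y \<in> proj (insert v U) ` Z"
    then obtain x where x: "x \<in> Z" "y = proj (insert v U) x" by blast
    have "y = proj U x + (y $ v - proj U x $ v) *s axis v 1"
      unfolding x by (auto simp: proj_def vec_eq_iff axis_def)
    moreover have "proj U x + (y $ v - proj U x $ v) *s axis v 1 \<in> vec.span (insert (axis v 1) (proj U ` Z))"
      by (intro vec.span_add vec.span_scale vec.span_base) (use x in auto)
    ultimately show "y \<in> vec.span (insert (axis v 1) (proj U ` Z))" by simp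
  qed
  then have "vec.dim (proj (insert v U) ` Z) \<le> vec.dim (insert (axis v 1) (proj U ` Z))"
    by (rule vec.dim_mono)
  also have "\<dots> \<le> Suc (vec.dim (proj U ` Z))" by (simp add: vec.dim_insert)
  finally show ?thesis .
qed

text \<open>The hypothesis says that forgetting the coordinate \<open>v\<close> is injective on the
  span of the larger projection.\<close>

lemma dim_proj_insert_eq:
  assumes "\<And>x. x \<in> vec.span Z \<Longrightarrow> proj U x = 0 \<Longrightarrow> proj (insert v U) x = 0"
  shows "vec.dim (proj (insert v U) ` Z) = vec.dim (proj U ` Z)"
proof -
  interpret pU: Vector_Spaces.linear "(*s)" "(*s)" "proj U" by (rule linear_proj)
  interpret pvU: Vector_Spaces.linear "(*s)" "(*s)" "proj (insert v U)" by (rule linear_proj)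
  have comp: "proj U (proj (insert v U) x) = proj U x" for x by (simp add: proj_def vec_eq_iff)
  have "inj_on (proj U) (vec.span (proj (insert v U) ` Z))"
  proof (rule inj_onI)
    fix y z assume y: "y \<in> vec.span (proj (insert v U) ` Z)" and z: "z \<in> vec.span (proj (insert v U) ` Z)"
      and eq: "proj U y = proj U z"
    obtain y' z' where y': "y' \<in> vec.span Z" "y = proj (insert v U) y'"
      and z': "z' \<in> vec.span Z" "z = proj (insert v U) z'"
      using y z pvU.span_image[of Z] by auto
    have "proj (insert v U) (y' - z') = 0"
    proof (rule assms)
      show "y' - z' \<in> vec.span Z" using y' z' by (simp add: vec.span_diff)
      show "proj U (y' - z') = 0" using eq y' z' comp by (simp add: pU.diff)
    qed
    then show "y = z" using y' z' by (simp add: pvU.diff)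
  qed
  then have "vec.dim (proj U ` proj (insert v U) ` Z) = vec.dim (proj (insert v U) ` Z)"
    by (rule vec.dim_image_eq[OF linear_proj])
  moreover have "proj U ` proj (insert v U) ` Z = proj U ` Z" by (simp add: image_image comp)
  ultimately show ?thesis by simp
qed

lemma dim_Un_finite_le:
  assumes "finite Y"
  shows "vec.dim (Z \<union> Y) \<le> vec.dim Z + card Y"
  using assms
proof (induction Y rule: finite_induct)
  case (insert y Y)
  have "vec.dim (insert y (Z \<union> Y)) \<le> Suc (vec.dim (Z \<union> Y))" by (simp add: vec.dim_insert)
  with insert show ?case by simp
qed simp

definition exp_vec :: "('v \<Rightarrow>\<^sub>0 nat) \<Rightarrow> rat^'v" where
  "exp_vec e = (\<chi> v. of_nat (Poly_Mapping.lookup e v))"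

lemma exp_vec_add: "exp_vec (a + b) = exp_vec a + exp_vec b"
  by (simp add: exp_vec_def vec_eq_iff lookup_add)

lemma exp_vec_0: "exp_vec 0 = 0"
  by (simp add: exp_vec_def vec_eq_iff)

lemma exp_vec_sum: "exp_vec (sum f I) = (\<Sum>i\<in>I. exp_vec (f i))"
  by (induction I rule: infinite_finite_induct) (simp_all add: exp_vec_0 exp_vec_add)

text \<open>A linear relation among projected exponents can thus be written with two genuine
  elements of \<open>H\<close>, and so as a binomial of the monoid algebra.\<close>

lemma span_exp_vec_clear_denominators:
  fixes H :: "('v::finite \<Rightarrow>\<^sub>0 nat) set"
  assumes H: "0 \<in> H" "\<And>a b. a \<in> H \<Longrightarrow> b \<in> H \<Longrightarrow> a + b \<in> H"
    and x: "x \<in> vec.span (exp_vec ` H)"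
  shows "\<exists>n>0. \<exists>a\<in>H. \<exists>b\<in>H. of_nat n *s x = exp_vec a - exp_vec b"
proof -
  have mult: "\<exists>b\<in>H. exp_vec b = of_nat n *s exp_vec a" if "a \<in> H" for a n
  proof (induction n)
    case 0
    show ?case using H(1) by (intro bexI[of _ 0]) (simp_all add: exp_vec_0)
  next
    case (Suc n)
    then obtain b where "b \<in> H" "exp_vec b = of_nat n *s exp_vec a" by blast
    then have "a + b \<in> H" "exp_vec (a + b) = of_nat (Suc n) *s exp_vec a"
      using H that by (simp_all add: exp_vec_add vec.scale_left_distrib)
    then show ?case by blast
  qed
  show ?thesis
    using x
  proof (induction rule: vec.span_induct_alt)
    case base
    show ?case using H(1) by (intro exI[of _ 1]) auto
  next
    case (step c x y)
    obtain p where p: "p \<in> H" "x = exp_vec p" using step(1) by blast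
    obtain n a b where n: "n > 0" "a \<in> H" "b \<in> H" "of_nat n *s y = exp_vec a - exp_vec b"
      using step(2) by blast
    obtain s t where st: "c = Rat.Fract s t" "t > 0" by (cases c) auto
    have t0: "of_nat (nat t) = (of_int t :: rat)" using st(2) by simp
    have ct: "of_nat (nat t) * c = of_int s" using st unfolding t0 by (simp add: Rat.Fract_of_int_quotient)
    obtain a' where a': "a' \<in> H" "exp_vec a' = of_nat (nat t) *s exp_vec a" using mult n(2) by blast
    obtain b' where b': "b' \<in> H" "exp_vec b' = of_nat (nat t) *s exp_vec b" using mult n(3) by blast
    \<comment> \<open>At least one of \<open>nat s\<close> and \<open>nat (- s)\<close> is 0: a
      positive coefficient adds to the first exponent, a negative one to the subtracted
      exponent.\<close>
    obtain p1 where p1: "p1 \<in> H" "exp_vec p1 = of_nat (n * nat s) *s exp_vec p" using mult p(1) by blast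
    obtain p2 where p2: "p2 \<in> H" "exp_vec p2 = of_nat (n * nat (- s)) *s exp_vec p" using mult p(1) by blast
    have s: "of_int s = (of_nat (nat s) - of_nat (nat (- s)) :: rat)" by (cases "s \<ge> 0") auto
    have "of_nat (n * nat t) *s (c *s x + y) = of_nat n *s ((of_nat (nat t) * c) *s x) + of_nat (nat t) *s (of_nat n *s y)"
      by (simp add: vec.scale_right_distrib mult_ac)
    also have "\<dots> = exp_vec (a' + p1) - exp_vec (b' + p2)"
      unfolding ct n(4) s by (simp add: exp_vec_add a' b' p1 p2 p(2) vec_eq_iff algebra_simps)
    finally have "of_nat (n * nat t) *s (c *s x + y) = exp_vec (a' + p1) - exp_vec (b' + p2)" .
    moreover have "n * nat t > 0" using n(1) st(2) by simp
    moreover have "a' + p1 \<in> H" "b' + p2 \<in> H" using H a' b' p1 p2 by auto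
    ultimately show ?case by blast
  qed
qed

section \<open>Exponents of the powers of the intersection\<close>

definition exp_of :: "('v::finite \<Rightarrow> nat) \<Rightarrow> ('v \<Rightarrow>\<^sub>0 nat)" where
  "exp_of f = Abs_poly_mapping f"

lemma lookup_exp_of [simp]: "Poly_Mapping.lookup (exp_of f) v = f v"
  by (simp add: exp_of_def)

lemma exp_le_obtain:
  fixes a b :: "'v::finite \<Rightarrow>\<^sub>0 nat"
  assumes "\<And>v. Poly_Mapping.lookup a v \<le> Poly_Mapping.lookup b v"
  obtains c where "b = a + c"
  by (rule that[of "b - a"], rule poly_mapping_eqI) (use assms in \<open>simp add: lookup_add lookup_minus\<close>)

lemma exp_pos_obtain:
  fixes a :: "'v::finite \<Rightarrow>\<^sub>0 nat"
  assumes "Poly_Mapping.lookup a v \<noteq> 0"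
  obtains c where "a = c + Poly_Mapping.single v 1"
proof -
  obtain c where "a = Poly_Mapping.single v 1 + c"
    by (rule exp_le_obtain[of "Poly_Mapping.single v 1" a])
       (use assms in \<open>auto simp: lookup_single when_def\<close>)
  then show thesis using that by (simp add: add.commute)
qed

text \<open>By \<open>rem\<close> a variable outside \<open>V\<close> can be stripped one unit at a
  time; the induction is on the total exponent outside \<open>V\<close>.\<close>

lemma exp_restrict_mem:
  fixes Q :: "('v::finite \<Rightarrow>\<^sub>0 nat) set"
  assumes rem: "\<And>v e. v \<notin> V \<Longrightarrow> e + Poly_Mapping.single v 1 \<in> Q \<Longrightarrow> e \<in> Q" and "e \<in> Q"
  shows "exp_of (\<lambda>v. if v \<in> V then Poly_Mapping.lookup e v else 0) \<in> Q"
  using assms(2)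
proof (induction "\<Sum>v\<in>- V. Poly_Mapping.lookup e v" arbitrary: e)
  case 0
  then have "Poly_Mapping.lookup e v = 0" if "v \<notin> V" for v using that by simp
  then have "exp_of (\<lambda>v. if v \<in> V then Poly_Mapping.lookup e v else 0) = e"
    by (intro poly_mapping_eqI) auto
  then show ?case using 0 by simp
next
  case (Suc n)
  then have "\<exists>v\<in>- V. Poly_Mapping.lookup e v \<noteq> 0"
    by (metis (mono_tags, lifting) Zero_not_Suc sum.neutral)
  then obtain v where v: "v \<notin> V" "Poly_Mapping.lookup e v \<noteq> 0" by blast
  obtain c where c: "e = c + Poly_Mapping.single v 1" using exp_pos_obtain[OF v(2)] .
  have "(\<Sum>u\<in>- V. Poly_Mapping.lookup e u)
      = (\<Sum>u\<in>- V. Poly_Mapping.lookup c u) + (\<Sum>u\<in>- V. if u = v then 1 else 0)"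
    unfolding c by (subst sum.distrib[symmetric], rule sum.cong) (auto simp: lookup_add lookup_single when_def)
  also have "(\<Sum>u\<in>- V. if u = v then 1 else 0 :: nat) = 1" using v(1) by simp
  finally have "n = (\<Sum>u\<in>- V. Poly_Mapping.lookup c u)" using Suc.hyps(2) by simp
  moreover have "c \<in> Q" using rem[OF v(1)] Suc.prems c by simp
  ultimately have "exp_of (\<lambda>u. if u \<in> V then Poly_Mapping.lookup c u else 0) \<in> Q" by (rule Suc.hyps(1))
  moreover have "exp_of (\<lambda>u. if u \<in> V then Poly_Mapping.lookup c u else 0)
      = exp_of (\<lambda>u. if u \<in> V then Poly_Mapping.lookup e u else 0)"
    unfolding c by (intro poly_mapping_eqI) (use v(1) in \<open>auto simp: lookup_add lookup_single when_def\<close>)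
  ultimately show ?case by simp
qed

text \<open>\<open>Q i\<close> stands for the exponents of the i-th component, and
  \<open>blk v\<close> for the index of the one prime containing the variable \<open>v\<close>.
  \<open>Q_pure\<close> says that a variable of the radical has a power in the component,
  \<open>Q_indep\<close> that the other variables are nonzerodivisors modulo it. The equation for
  the range says that no block is empty.\<close>

locale block_ideals =
  fixes r :: nat and blk :: "'v::finite \<Rightarrow> nat" and Q :: "nat \<Rightarrow> ('v \<Rightarrow>\<^sub>0 nat) set"
  assumes blk_range: "range blk = {1..r}"
    and Q_up: "i \<in> {1..r} \<Longrightarrow> e \<in> Q i \<Longrightarrow> e + c \<in> Q i"
    and Q_zero: "i \<in> {1..r} \<Longrightarrow> 0 \<notin> Q i"
    and Q_pure: "\<exists>k. Poly_Mapping.single v k \<in> Q (blk v)"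
    and Q_indep: "i \<in> {1..r} \<Longrightarrow> blk v \<noteq> i \<Longrightarrow> e + Poly_Mapping.single v 1 \<in> Q i \<Longrightarrow> e \<in> Q i"
begin

lemma blk_mem: "blk v \<in> {1..r}"
  using blk_range by auto

definition restr :: "nat \<Rightarrow> ('v \<Rightarrow>\<^sub>0 nat) \<Rightarrow> ('v \<Rightarrow>\<^sub>0 nat)" where
  "restr i e = exp_of (\<lambda>v. if blk v = i then Poly_Mapping.lookup e v else 0)"

lemma Q_restr:
  assumes "i \<in> {1..r}" "e \<in> Q i"
  shows "restr i e \<in> Q i"
  using exp_restrict_mem[of "{v. blk v = i}" "Q i" e] Q_indep[OF assms(1)] assms(2)
  by (simp add: restr_def)

lemma Q_depends:
  assumes i: "i \<in> {1..r}" and e: "e \<in> Q i"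
    and le: "\<And>v. blk v = i \<Longrightarrow> Poly_Mapping.lookup e v \<le> Poly_Mapping.lookup e' v"
  shows "e' \<in> Q i"
proof -
  obtain c where "e' = restr i e + c"
    by (rule exp_le_obtain[of "restr i e" e']) (use le in \<open>auto simp: restr_def\<close>)
  then show ?thesis using Q_up[OF i Q_restr[OF i e]] by simp
qed

definition E1 :: "('v \<Rightarrow>\<^sub>0 nat) set" where
  "E1 = (\<Inter>i\<in>{1..r}. Q i)"

text \<open>The exponents of the \<open>j\<close>-th power of the ideal with exponents \<open>E1\<close>; the \<open>0\<close>-th power
  is the whole ring.\<close>

primrec E :: "nat \<Rightarrow> ('v \<Rightarrow>\<^sub>0 nat) set" where
  "E 0 = UNIV"
| "E (Suc j) = {x + y | x y. x \<in> E j \<and> y \<in> E1}"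

lemma E_up: "e \<in> E j \<Longrightarrow> e + c \<in> E j"
proof (induction j arbitrary: e c)
  case (Suc j)
  then obtain x y where xy: "e = x + y" "x \<in> E j" "y \<in> E1" by auto
  have "y + c \<in> E1" using Q_up xy(3) by (auto simp: E1_def)
  then show ?case using xy by (auto simp: add.assoc)
qed simp

lemma E_add: "x \<in> E j \<Longrightarrow> y \<in> E k \<Longrightarrow> x + y \<in> E (j + k)"
proof (induction k arbitrary: y)
  case 0
  then show ?case by (simp add: E_up)
next
  case (Suc k)
  then obtain u v where uv: "y = u + v" "u \<in> E k" "v \<in> E1" by auto
  have "x + u \<in> E (j + k)" using Suc uv by blast
  then have "(x + u) + v \<in> E (Suc (j + k))" using uv(3) by auto
  then show ?case by (simp add: uv(1) add.assoc)
qed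

text \<open>Here disjointness enters: each \<open>Q i\<close> sees a single block, so taking some
  blocks from one exponent and the rest from another stays in the intersection. In a power the same
  \<open>C\<close> is used for all factors, which keeps the decomposition into a sum.\<close>

definition mix :: "nat set \<Rightarrow> ('v \<Rightarrow>\<^sub>0 nat) \<Rightarrow> ('v \<Rightarrow>\<^sub>0 nat) \<Rightarrow> ('v \<Rightarrow>\<^sub>0 nat)" where
  "mix C e e' = exp_of (\<lambda>v. if blk v \<in> C then Poly_Mapping.lookup e v else Poly_Mapping.lookup e' v)"

lemma mix_add: "mix C (x + y) (x' + y') = mix C x x' + mix C y y'"
  by (rule poly_mapping_eqI) (simp add: mix_def lookup_add)

lemma mix_E1: "e \<in> E1 \<Longrightarrow> e' \<in> E1 \<Longrightarrow> mix C e e' \<in> E1"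
  unfolding E1_def
proof
  fix i assume i: "i \<in> {1..r}" and e: "e \<in> (\<Inter>i\<in>{1..r}. Q i)" "e' \<in> (\<Inter>i\<in>{1..r}. Q i)"
  show "mix C e e' \<in> Q i"
  proof (cases "i \<in> C")
    case True
    have "e \<in> Q i" using e i by blast
    then show ?thesis by (rule Q_depends[OF i]) (use True in \<open>auto simp: mix_def\<close>)
  next
    case False
    have "e' \<in> Q i" using e i by blast
    then show ?thesis by (rule Q_depends[OF i]) (use False in \<open>auto simp: mix_def\<close>)
  qed
qed

lemma mix_E: "e \<in> E j \<Longrightarrow> e' \<in> E j \<Longrightarrow> mix C e e' \<in> E j"
proof (induction j arbitrary: e e')
  case (Suc j)
  then obtain x y x' y' where xy: "e = x + y" "x \<in> E j" "y \<in> E1" "e' = x' + y'" "x' \<in> E j" "y' \<in> E1"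
    by auto
  then show ?case using mix_add[of C x y x' y'] Suc.IH[of x x'] mix_E1[of y y'] by auto
qed simp

definition kexp :: "'v \<Rightarrow> nat" where
  "kexp v = (SOME k. Poly_Mapping.single v k \<in> Q (blk v))"

lemma kexp: "Poly_Mapping.single v (kexp v) \<in> Q (blk v)"
  unfolding kexp_def using Q_pure by (rule someI_ex)

lemma kexp_pos: "kexp v > 0"
  using kexp[of v] Q_zero[OF blk_mem[of v]] by (metis gr0I single_zero)

text \<open>Every variable has a power of exponent at most \<open>K\<close> in its own component.
  Hence exponents of minimal generators of the j-th power are at most \<open>K * j\<close>.\<close>

definition K :: nat where "K = Max (range kexp)"

lemma kexp_le_K: "kexp v \<le> K"
  unfolding K_def by (rule Max_ge) auto

text \<open>Above \<open>K\<close>, lowering the exponent of \<open>v\<close> still leaves the pure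
  power that puts it into the component of its own block, and the other components ignore
  \<open>v\<close>.\<close>

lemma dec_E1:
  assumes "e \<in> E1" "Poly_Mapping.lookup e v > K"
  obtains e' where "e = e' + Poly_Mapping.single v 1" "e' \<in> E1"
proof -
  obtain e' where e': "e = e' + Poly_Mapping.single v 1" using exp_pos_obtain[of e v] assms(2) by auto
  have "e' \<in> Q i" if i: "i \<in> {1..r}" for i
  proof (cases "blk v = i")
    case True
    have "Poly_Mapping.single v (kexp v) \<in> Q i" using kexp[of v] True by simp
    then show ?thesis
    proof (rule Q_depends[OF i])
      fix u
      have "kexp v \<le> Poly_Mapping.lookup e' v"
        using assms(2) kexp_le_K[of v] by (simp add: e' lookup_add)
      then show "Poly_Mapping.lookup (Poly_Mapping.single v (kexp v)) u \<le> Poly_Mapping.lookup e' u"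
        by (auto simp: lookup_single when_def)
    qed
  next
    case False
    then show ?thesis using Q_indep[OF i False, of e'] assms(1) i e' by (auto simp: E1_def)
  qed
  then show thesis using that e' by (auto simp: E1_def)
qed

text \<open>Pigeonhole: an exponent above \<open>K * Suc j\<close> exceeds \<open>K * j\<close> in
  the first summand or \<open>K\<close> in the last.\<close>

lemma dec_E:
  assumes "e \<in> E j" "Poly_Mapping.lookup e v > K * j"
  shows "\<exists>e'. e = e' + Poly_Mapping.single v 1 \<and> e' \<in> E j"
  using assms
proof (induction j arbitrary: e)
  case 0
  then show ?case using exp_pos_obtain[of e v] by auto
next
  case (Suc j)
  then obtain x y where xy: "e = x + y" "x \<in> E j" "y \<in> E1" by auto
  show ?case
  proof (cases "Poly_Mapping.lookup x v > K * j")
    case True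
    then obtain x' where "x = x' + Poly_Mapping.single v 1" "x' \<in> E j" using Suc.IH xy by blast
    then show ?thesis using xy by (intro exI[of _ "x' + y"]) (auto simp: add_ac)
  next
    case False
    then have "Poly_Mapping.lookup y v > K" using Suc.prems(2) xy(1) by (simp add: lookup_add)
    then obtain y' where "y = y' + Poly_Mapping.single v 1" "y' \<in> E1" using dec_E1 xy(3) by blast
    then show ?thesis using xy by (intro exI[of _ "x + y'"]) (auto simp: add_ac)
  qed
qed

text \<open>The exponents of the Rees algebra, and among them those of the minimal generators of the
  powers, which form a basis of the fibre ring.\<close>

definition \<Gamma> :: "(('v \<Rightarrow>\<^sub>0 nat) \<times> nat) set" where
  "\<Gamma> = {(e, j). e \<in> E j}"

definition G :: "(('v \<Rightarrow>\<^sub>0 nat) \<times> nat) set" where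
  "G = {(e, j). e \<in> E j \<and> (\<forall>v e'. e = e' + Poly_Mapping.single v 1 \<longrightarrow> e' \<notin> E j)}"

lemma \<Gamma>_0: "0 \<in> \<Gamma>"
  by (simp add: \<Gamma>_def zero_prod_def)

lemma \<Gamma>_add: "x \<in> \<Gamma> \<Longrightarrow> y \<in> \<Gamma> \<Longrightarrow> x + y \<in> \<Gamma>"
  by (auto simp: \<Gamma>_def E_add)

lemma r_pos: "r \<ge> 1"
  using blk_mem[of undefined] by auto

definition rep :: "nat \<Rightarrow> 'v" where
  "rep i = (SOME v. blk v = i)"

lemma blk_rep: "i \<in> {1..r} \<Longrightarrow> blk (rep i) = i"
proof -
  assume "i \<in> {1..r}"
  then have "\<exists>v. blk v = i" using blk_range by (metis rangeE)
  then show ?thesis unfolding rep_def by (rule someI_ex)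
qed

lemma r_le_card: "r \<le> CARD('v)"
proof -
  have "card (range blk) \<le> CARD('v)" by (rule card_image_le) simp
  then show ?thesis using blk_range by simp
qed

text \<open>Two minimal generators that agree outside one coordinate per block are comparable on each
  block, so their minimum is a mixture of them and lies in the same power.\<close>

lemma G_unique:
  assumes e: "(e, j) \<in> G" and e': "(e', j) \<in> G"
    and eq: "\<And>v. v \<notin> rep ` {1..r} \<Longrightarrow> Poly_Mapping.lookup e v = Poly_Mapping.lookup e' v"
  shows "e = e'"
proof -
  define C where "C = {i. Poly_Mapping.lookup e (rep i) \<le> Poly_Mapping.lookup e' (rep i)}"
  define m where "m = mix C e e'"
  have m: "m \<in> E j" unfolding m_def using e e' by (intro mix_E) (auto simp: G_def)
  have le: "Poly_Mapping.lookup m v \<le> Poly_Mapping.lookup e v \<and> Poly_Mapping.lookup m v \<le> Poly_Mapping.lookup e' v" for v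
  proof (cases "v \<in> rep ` {1..r}")
    case True
    then obtain i where i: "i \<in> {1..r}" "v = rep i" by blast
    then show ?thesis using blk_rep[OF i(1)] by (auto simp: m_def mix_def C_def)
  next
    case False
    then show ?thesis using eq by (auto simp: m_def mix_def)
  qed
  have min: "d = m" if d: "(d, j) \<in> G" and dm: "\<And>v. Poly_Mapping.lookup m v \<le> Poly_Mapping.lookup d v" for d
  proof -
    obtain c where c: "d = m + c" using exp_le_obtain[of m d] dm by blast
    have "c = 0"
    proof (rule ccontr)
      assume "c \<noteq> 0"
      then obtain v where "Poly_Mapping.lookup c v \<noteq> 0" by (auto simp: poly_mapping_eq_iff fun_eq_iff)
      then obtain c' where "c = c' + Poly_Mapping.single v 1" using exp_pos_obtain by blast
      then have "d = (m + c') + Poly_Mapping.single v 1" using c by (simp add: add.assoc)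
      then show False using d E_up[OF m] by (auto simp: G_def)
    qed
    then show ?thesis using c by simp
  qed
  show ?thesis using min[OF e] min[OF e'] le by simp
qed

text \<open>By \<open>G_unique\<close> an element of \<open>G\<close> is determined by its degree
  and its exponents at the \<open>CARD('v) - r\<close> variables that are not representatives, and
  by \<open>dec_E\<close> these are at most \<open>K * N\<close>.\<close>

lemma growth:
  "finite {x \<in> G. snd x \<le> N} \<and> card {x \<in> G. snd x \<le> N} \<le> (K * N + 1) ^ (CARD('v) - r + 1)"
proof -
  let ?W = "UNIV - rep ` {1..r}"
  let ?A = "{x \<in> G. snd x \<le> N}"
  let ?B = "(?W \<rightarrow>\<^sub>E {..K * N}) \<times> {..K * N}"
  let ?f = "\<lambda>(e, j). (restrict (Poly_Mapping.lookup e) ?W, j :: nat)"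
  have "inj_on rep {1..r}" by (rule inj_onI) (metis blk_rep)
  then have cardW: "card ?W = CARD('v) - r"
    by (subst card_Diff_subset) (auto simp: card_image)
  \<comment> \<open>With this the degree fits into the range of the exponents, and the bound becomes
    a pure power.\<close>
  have "K \<ge> 1" using kexp_le_K[of undefined] kexp_pos[of undefined] by simp
  then have KN: "N \<le> K * N" by simp
  have inj: "inj_on ?f ?A"
  proof (rule inj_onI)
    fix x y assume x: "x \<in> ?A" and y: "y \<in> ?A" and eq: "?f x = ?f y"
    obtain e j e' j' where xy: "x = (e, j)" "y = (e', j')" by (metis surj_pair)
    have j: "j = j'" and re: "restrict (Poly_Mapping.lookup e) ?W = restrict (Poly_Mapping.lookup e') ?W"
      using eq by (auto simp: xy)
    have "e = e'"
    proof (rule G_unique)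
      show "(e, j) \<in> G" "(e', j) \<in> G" using x y j xy by auto
      show "Poly_Mapping.lookup e v = Poly_Mapping.lookup e' v" if "v \<notin> rep ` {1..r}" for v
        using fun_cong[OF re, of v] that by simp
    qed
    then show "x = y" using xy j by simp
  qed
  have sub: "?f ` ?A \<subseteq> ?B"
  proof
    fix z assume "z \<in> ?f ` ?A"
    then obtain e j where ej: "(e, j) \<in> G" "j \<le> N" "z = (restrict (Poly_Mapping.lookup e) ?W, j)" by auto
    have "Poly_Mapping.lookup e v \<le> K * N" for v
    proof (rule ccontr)
      assume "\<not> ?thesis"
      moreover have "K * j \<le> K * N" using ej(2) by simp
      ultimately have "Poly_Mapping.lookup e v > K * j" by linarith
      then show False using dec_E[of e j v] ej(1) by (auto simp: G_def)
    qed
    moreover have "j \<le> K * N" using ej(2) KN by linarith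
    ultimately show "z \<in> ?B" using ej by auto
  qed
  have finB: "finite ?B" by (intro finite_cartesian_product finite_PiE) auto
  have "card ?A = card (?f ` ?A)" using card_image[OF inj] by simp
  also have "\<dots> \<le> card ?B" by (rule card_mono[OF finB sub])
  also have "\<dots> = (K * N + 1) ^ (CARD('v) - r + 1)"
    unfolding card_cartesian_product by (subst card_PiE) (simp_all add: cardW[simplified])
  finally show ?thesis using finite_imageD[OF finite_subset[OF sub finB] inj] by simp
qed

end

section \<open>A chain of primes from a face of least weight\<close>

lemma domain_type_algebra: "domain (ring_of_type_algebra :: 'a::idom ring)"
proof -
  interpret cring "ring_of_type_algebra :: 'a ring" by (rule cring_from_type_algebra)
  show ?thesis by (rule domainI) (use is_cring in auto)
qed

text \<open>The target exponents are linearly ordered compatibly with addition, so leading terms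
  make the target ring a domain; the kernel is the preimage of its zero ideal.\<close>

lemma primeideal_push_kernel:
  fixes \<Gamma> F :: "'m::comm_monoid_add set"
    and h :: "'m \<Rightarrow> 'n::{linorder, ordered_cancel_comm_monoid_add}"
  assumes \<Gamma>: "0 \<in> \<Gamma>" "\<And>x y. x \<in> \<Gamma> \<Longrightarrow> y \<in> \<Gamma> \<Longrightarrow> x + y \<in> \<Gamma>"
    and F: "0 \<in> F" "\<And>x y. x \<in> \<Gamma> \<Longrightarrow> y \<in> \<Gamma> \<Longrightarrow> x + y \<in> F \<longleftrightarrow> x \<in> F \<and> y \<in> F"
    and h: "h 0 = 0" "\<And>x y. h (x + y) = h x + h y"
  shows "primeideal {f \<in> keys_in \<Gamma>. push F h f = (0 :: 'n \<Rightarrow>\<^sub>0 'k::idom)}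
           (ring_of_type_algebra\<lparr>carrier := keys_in \<Gamma>\<rparr>)"
proof -
  note S = keys_in_subalgebra[OF \<Gamma>, where ?'k = 'k]
  have A: "cring (ring_of_type_algebra\<lparr>carrier := keys_in \<Gamma> :: ('m \<Rightarrow>\<^sub>0 'k) set\<rparr>)"
    by (rule cring_type_algebra_update) (use S in auto)
  have T: "domain (ring_of_type_algebra :: ('n \<Rightarrow>\<^sub>0 'k) ring)" by (rule domain_type_algebra)
  have hom: "push F h \<in> ring_hom (ring_of_type_algebra\<lparr>carrier := keys_in \<Gamma> :: ('m \<Rightarrow>\<^sub>0 'k) set\<rparr>) ring_of_type_algebra"
  proof (rule ring_hom_memI)
    show "push F h \<one>\<^bsub>ring_of_type_algebra\<lparr>carrier := keys_in \<Gamma> :: ('m \<Rightarrow>\<^sub>0 'k) set\<rparr>\<^esub> = \<one>\<^bsub>ring_of_type_algebra\<^esub>"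
      using F(1) h(1) push_single[of F h 0 "1 :: 'k"] by simp
  qed (use push_mult[OF _ _ F(2) h(2)] push_add in auto)
  have "primeideal {\<zero>\<^bsub>ring_of_type_algebra\<^esub>} (ring_of_type_algebra :: ('n \<Rightarrow>\<^sub>0 'k) ring)"
    by (rule domain.zeroprimeideal[OF T])
  from primeideal_vimage[OF A domain.axioms(1)[OF T] hom this] show ?thesis by simp
qed

text \<open>Variables are numbered so that the exponents in the target carry a linear order.
  Coordinates outside \<open>U\<close> are forgotten, which amounts to setting those variables to
  1.\<close>

definition reindex :: "('v \<Rightarrow> nat) \<Rightarrow> 'v set \<Rightarrow> ('v \<Rightarrow>\<^sub>0 nat) \<Rightarrow> (nat \<Rightarrow>\<^sub>0 nat)" where
  "reindex idx U e = (\<Sum>v\<in>U. Poly_Mapping.single (idx v) (Poly_Mapping.lookup e v))"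

lemma reindex_0: "reindex idx U 0 = 0"
  by (simp add: reindex_def)

lemma reindex_add: "reindex idx U (x + y) = reindex idx U x + reindex idx U y"
  by (simp add: reindex_def lookup_add single_add sum.distrib)

lemma lookup_reindex:
  fixes idx :: "'v::finite \<Rightarrow> nat"
  assumes "inj idx"
  shows "Poly_Mapping.lookup (reindex idx U e) (idx v) = (if v \<in> U then Poly_Mapping.lookup e v else 0)"
proof -
  have "Poly_Mapping.lookup (reindex idx U e) (idx v) = (\<Sum>u\<in>U. if u = v then Poly_Mapping.lookup e u else 0)"
    unfolding reindex_def lookup_sum
    by (rule sum.cong) (auto simp: lookup_single when_def inj_eq[OF assms])
  then show ?thesis by simp
qed

text \<open>Projecting the face \<open>F\<close> to fewer and fewer coordinates gives homomorphisms to polynomial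
  rings whose kernels grow exactly when the rank of the projected exponents drops.\<close>

lemma face_chain:
  fixes \<Gamma> F :: "(('v::finite \<Rightarrow>\<^sub>0 nat) \<times> nat) set"
  assumes \<Gamma>: "0 \<in> \<Gamma>" "\<And>x y. x \<in> \<Gamma> \<Longrightarrow> y \<in> \<Gamma> \<Longrightarrow> x + y \<in> \<Gamma>"
    and F: "0 \<in> F" "\<And>x y. x \<in> \<Gamma> \<Longrightarrow> y \<in> \<Gamma> \<Longrightarrow> x + y \<in> F \<longleftrightarrow> x \<in> F \<and> y \<in> F"
  shows "\<exists>k P. vec.dim (exp_vec ` fst ` (\<Gamma> \<inter> F)) \<le> k \<and>
           prime_chain (ring_of_type_algebra\<lparr>carrier := keys_in \<Gamma> :: (('v \<Rightarrow>\<^sub>0 nat) \<times> nat \<Rightarrow>\<^sub>0 'k::idom) set\<rparr>) k P \<and>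
           keys_in (\<Gamma> - F) \<subseteq> P 0"
proof -
  let ?S = "ring_of_type_algebra\<lparr>carrier := keys_in \<Gamma> :: (('v \<Rightarrow>\<^sub>0 nat) \<times> nat \<Rightarrow>\<^sub>0 'k) set\<rparr>"
  obtain idx :: "'v \<Rightarrow> nat" where idx: "inj idx"
    using finite_imp_inj_to_nat_seg[of "UNIV :: 'v set"] by auto
  define rst where "rst U x = reindex idx U (fst x)" for U and x :: "('v \<Rightarrow>\<^sub>0 nat) \<times> nat"
  have lookup_rst: "Poly_Mapping.lookup (rst U x) (idx v) = (if v \<in> U then Poly_Mapping.lookup (fst x) v else 0)"
    for U x v
    unfolding rst_def by (rule lookup_reindex[OF idx])
  have rst_0: "rst U 0 = 0" for U by (simp add: rst_def reindex_0)
  have rst_add: "rst U (x + y) = rst U x + rst U y" for U x y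
    by (simp add: rst_def reindex_add)
  define ker where "ker U = {f \<in> keys_in \<Gamma>. push F (rst U) f = (0 :: (nat \<Rightarrow>\<^sub>0 nat) \<Rightarrow>\<^sub>0 'k)}" for U
  have ker_prime: "primeideal (ker U) ?S" for U
    unfolding ker_def by (rule primeideal_push_kernel[OF \<Gamma> F rst_0 rst_add])
  have ker_mono: "ker U \<subseteq> ker U'" if "U' \<subseteq> U" for U U'
  proof
    fix f assume f: "f \<in> ker U"
    \<comment> \<open>\<open>\<rho>\<close> forgets further coordinates, so the projection to
      \<open>U'\<close> factors through the one to \<open>U\<close>.\<close>
    define \<rho> where "\<rho> p = (\<Sum>v\<in>U'. Poly_Mapping.single (idx v) (Poly_Mapping.lookup p (idx v)))"
      for p :: "nat \<Rightarrow>\<^sub>0 nat"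
    have "(\<rho> \<circ> rst U) x = rst U' x" for x
      unfolding \<rho>_def comp_def lookup_rst unfolding rst_def reindex_def by (rule sum.cong) (use that in auto)
    then have "\<rho> \<circ> rst U = rst U'" by blast
    then have "push F (rst U') f = push UNIV \<rho> (push F (rst U) f)" by (simp add: push_push)
    then show "f \<in> ker U'" using f by (simp add: ker_def)
  qed
  let ?H = "fst ` (\<Gamma> \<inter> F)"
  let ?Z = "exp_vec ` ?H"
  have H0: "0 \<in> ?H" using \<Gamma>(1) F(1) by (metis IntI fst_zero imageI)
  have Hadd: "a + b \<in> ?H" if ab: "a \<in> ?H" "b \<in> ?H" for a b
  proof -
    obtain x y where "x \<in> \<Gamma> \<inter> F" "y \<in> \<Gamma> \<inter> F" "a = fst x" "b = fst y" using ab by blast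
    then have "x + y \<in> \<Gamma> \<inter> F" "a + b = fst (x + y)" using \<Gamma>(2) F(2) by auto
    then show ?thesis by blast
  qed
  have dim_eq: "vec.dim (proj (insert v U) ` ?Z) = vec.dim (proj U ` ?Z)"
    if ker_eq: "ker (insert v U) = ker U" for v U
  proof (rule dim_proj_insert_eq)
    fix x assume x: "x \<in> vec.span ?Z" and x0: "proj U x = 0"
    \<comment> \<open>A vector of the span vanishing on \<open>U\<close> becomes a binomial in
      \<open>ker U\<close>. If the binomial also lies in \<open>ker (insert v U)\<close>, its two
      exponents agree at \<open>v\<close>, and the vector vanishes there too.\<close>
    obtain n a b where n: "n > 0" "a \<in> ?H" "b \<in> ?H" "of_nat n *s x = exp_vec a - exp_vec b"
      using span_exp_vec_clear_denominators[OF H0 Hadd x] by blast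
    obtain i j where ij: "(a, i) \<in> \<Gamma> \<inter> F" "(b, j) \<in> \<Gamma> \<inter> F" using n(2,3) by auto
    have nx: "of_nat n * x $ u = of_nat (Poly_Mapping.lookup a u) - of_nat (Poly_Mapping.lookup b u)" for u
      using arg_cong[OF n(4), of "\<lambda>x. x $ u"] by (simp add: exp_vec_def)
    have xU: "x $ u = 0" if "u \<in> U" for u
      using arg_cong[OF x0, of "\<lambda>x. x $ u"] that by (simp add: proj_def)
    have "Poly_Mapping.lookup a u = Poly_Mapping.lookup b u" if "u \<in> U" for u
      using nx[of u] xU[OF that] by simp
    then have "rst U (a, i) = rst U (b, j)" unfolding rst_def reindex_def by (intro sum.cong) auto
    moreover define f where "f = Poly_Mapping.single (a, i) (1 :: 'k) - Poly_Mapping.single (b, j) 1"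
    ultimately have "f \<in> ker U"
      using ij by (auto simp: ker_def push_diff push_single intro!: keys_in_diff single_in_keys_in)
    then have "f \<in> ker (insert v U)" by (simp add: ker_eq)
    then have "Poly_Mapping.single (rst (insert v U) (a, i)) (1 :: 'k) = Poly_Mapping.single (rst (insert v U) (b, j)) 1"
      using ij by (simp add: ker_def f_def push_diff push_single)
    then have "rst (insert v U) (a, i) = rst (insert v U) (b, j)"
      by (metis keys_single singleton_inject zero_neq_one)
    then have "Poly_Mapping.lookup a v = Poly_Mapping.lookup b v"
      using lookup_rst[of "insert v U" "(a, i)" v] lookup_rst[of "insert v U" "(b, j)" v] by simp
    then have "x $ v = 0" using nx[of v] n(1) by simp
    then show "proj (insert v U) x = 0" using xU by (auto simp: proj_def vec_eq_iff)
  qed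
  \<comment> \<open>Adding a coordinate shrinks the kernel, so the chain is built downwards: each
    new prime is put in front. The rank rises by at most one per coordinate, and only if the kernel
    shrinks.\<close>
  have "\<exists>k P. vec.dim (proj U ` ?Z) \<le> k \<and> prime_chain ?S k P \<and> P 0 = ker U" for U
    using finite[of U]
  proof (induction U rule: finite_induct)
    case empty
    have "proj {} ` ?Z \<subseteq> {0}" by (auto simp: proj_def vec_eq_iff)
    then have "vec.dim (proj {} ` ?Z) = 0" by simp
    moreover have "prime_chain ?S 0 (\<lambda>_. ker {})" using ker_prime by (simp add: prime_chain_def)
    ultimately show ?case by fastforce
  next
    case (insert v U)
    then obtain k P where P: "vec.dim (proj U ` ?Z) \<le> k" "prime_chain ?S k P" "P 0 = ker U" by blast
    show ?case
    proof (cases "ker (insert v U) = ker U")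
      case True
      then show ?thesis using P dim_eq[OF True] by auto
    next
      case False
      then have less: "ker (insert v U) \<subset> ker U" using ker_mono[of U "insert v U"] by blast
      have "vec.dim (proj (insert v U) ` ?Z) \<le> Suc k"
        using dim_proj_insert_le[of v U ?Z] P(1) by linarith
      moreover have "prime_chain ?S (Suc k) (case_nat (ker (insert v U)) P)"
        using P(2,3) less ker_prime by (auto simp: prime_chain_def split: nat.split)
      ultimately show ?thesis by (intro exI[of _ "Suc k"] exI[of _ "case_nat (ker (insert v U)) P"]) simp
    qed
  qed
  from this[of UNIV] obtain k P where P: "vec.dim (proj UNIV ` ?Z) \<le> k" "prime_chain ?S k P" "P 0 = ker UNIV"
    by blast
  have "proj UNIV ` ?Z = ?Z" by (simp add: proj_def)
  moreover have "keys_in (\<Gamma> - F) \<subseteq> P 0"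
  proof
    fix f :: "('v \<Rightarrow>\<^sub>0 nat) \<times> nat \<Rightarrow>\<^sub>0 'k" assume f: "f \<in> keys_in (\<Gamma> - F)"
    then have "push F (rst UNIV) f = 0" unfolding push_def by (intro sum.neutral) (auto simp: keys_in_def)
    then show "f \<in> P 0" using f by (auto simp: P(3) ker_def keys_in_def)
  qed
  ultimately show ?thesis using P by metis
qed

section \<open>The weight and the face that it cuts out\<close>

context block_ideals
begin

definition bsum :: "rat^'v \<Rightarrow> nat \<Rightarrow> ('v \<Rightarrow>\<^sub>0 nat) \<Rightarrow> rat" where
  "bsum w i e = (\<Sum>v\<in>{v. blk v = i}. w $ v * of_nat (Poly_Mapping.lookup e v))"

definition supported :: "nat \<Rightarrow> ('v \<Rightarrow>\<^sub>0 nat) set" where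
  "supported i = {e \<in> Q i. \<forall>v. blk v \<noteq> i \<longrightarrow> Poly_Mapping.lookup e v = 0}"

lemma dotp_eq_bsum: "dotp w (exp_vec e) = (\<Sum>i\<in>{1..r}. bsum w i e)"
  unfolding dotp_def bsum_def exp_vec_def
  using sum.group[of "UNIV :: 'v set" "{1..r}" blk "\<lambda>v. w $ v * of_nat (Poly_Mapping.lookup e v)"] blk_range
  by simp

lemma bsum_supported:
  assumes "i \<in> {1..r}" "e \<in> supported i"
  shows "dotp w (exp_vec e) = bsum w i e"
proof -
  have "bsum w j e = 0" if "j \<noteq> i" for j
    unfolding bsum_def by (rule sum.neutral) (use assms(2) that in \<open>auto simp: supported_def\<close>)
  then have "(\<Sum>j\<in>{1..r}. bsum w j e) = (\<Sum>j\<in>{1..r}. if j = i then bsum w i e else 0)"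
    by (intro sum.cong) auto
  then show ?thesis using assms(1) by (simp add: dotp_eq_bsum)
qed

text \<open>Finitely many constraints suffice, namely the exponents bounded by \<open>K\<close> and
  supported on one block. They contain a pure power of each variable, which makes them span and
  forces the weights to be positive. The all-ones weight is a feasible starting point, since no
  component contains the exponent 0.\<close>

lemma exists_weight:
  "\<exists>w. (\<forall>v. w $ v > 0) \<and> (\<forall>i\<in>{1..r}. \<forall>e\<in>Q i. 1 \<le> bsum w i e) \<and>
     vec.span (exp_vec ` (\<Union>i\<in>{1..r}. {e \<in> supported i. bsum w i e = 1})) = UNIV"
proof -
  define box where "box i = {e \<in> supported i. \<forall>v. Poly_Mapping.lookup e v \<le> K}" for i
  define B where "B = exp_vec ` (\<Union>i\<in>{1..r}. box i)"
  have "{e :: 'v \<Rightarrow>\<^sub>0 nat. \<forall>v. Poly_Mapping.lookup e v \<le> K} \<subseteq> exp_of ` (UNIV \<rightarrow>\<^sub>E {..K})"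
  proof
    fix e :: "'v \<Rightarrow>\<^sub>0 nat" assume e: "e \<in> {e. \<forall>v. Poly_Mapping.lookup e v \<le> K}"
    have "e = exp_of (Poly_Mapping.lookup e)" by (rule poly_mapping_eqI) simp
    moreover have "Poly_Mapping.lookup e \<in> UNIV \<rightarrow>\<^sub>E {..K}" using e by auto
    ultimately show "e \<in> exp_of ` (UNIV \<rightarrow>\<^sub>E {..K})" by (rule image_eqI)
  qed
  moreover have "finite (UNIV \<rightarrow>\<^sub>E {..K} :: ('v \<Rightarrow> nat) set)" by (rule finite_PiE) auto
  ultimately have fin: "finite {e :: 'v \<Rightarrow>\<^sub>0 nat. \<forall>v. Poly_Mapping.lookup e v \<le> K}" by (rule finite_surj[rotated])
  have "finite (box i)" for i by (rule finite_subset[OF _ fin]) (auto simp: box_def)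
  then have finB: "finite B" unfolding B_def by (intro finite_imageI finite_UN_I) auto
  have pure_box: "Poly_Mapping.single v (kexp v) \<in> box (blk v)" for v
    using kexp[of v] kexp_le_K[of v] by (auto simp: box_def supported_def lookup_single when_def)
  have pure_B: "of_nat (kexp v) *s axis v 1 \<in> B" for v
  proof -
    have "exp_vec (Poly_Mapping.single v (kexp v)) = of_nat (kexp v) *s axis v 1"
      by (auto simp: exp_vec_def vec_eq_iff axis_def lookup_single when_def)
    then show ?thesis unfolding B_def using pure_box[of v] blk_mem[of v] by (metis UN_I imageI)
  qed
  have spanB: "vec.span B = UNIV"
  proof -
    have "axis v 1 \<in> vec.span B" for v
    proof -
      have "inverse (of_nat (kexp v)) *s (of_nat (kexp v) *s axis v 1) \<in> vec.span B"
        by (rule vec.span_scale, rule vec.span_base, rule pure_B)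
      then show ?thesis using kexp_pos[of v] by simp
    qed
    then have "(cart_basis :: (rat^'v) set) \<subseteq> vec.span B" by (auto simp: cart_basis_def)
    then have "vec.span (cart_basis :: (rat^'v) set) \<subseteq> vec.span B" by (rule vec.span_minimal) (rule vec.subspace_span)
    then show ?thesis by auto
  qed
  have feas: "1 \<le> dotp (\<chi> v. 1) a" if a: "a \<in> B" for a
  proof -
    obtain i e where e: "i \<in> {1..r}" "e \<in> box i" "a = exp_vec e" using a by (auto simp: B_def)
    then have "e \<in> Q i" by (auto simp: box_def supported_def)
    then have "e \<noteq> 0" using Q_zero[OF e(1)] by blast
    then obtain v where v: "Poly_Mapping.lookup e v \<noteq> 0" by (auto simp: poly_mapping_eq_iff fun_eq_iff)
    have "1 \<le> (of_nat (Poly_Mapping.lookup e v) :: rat)" using v by simp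
    also have "\<dots> \<le> (\<Sum>v\<in>UNIV. of_nat (Poly_Mapping.lookup e v))" by (rule member_le_sum) auto
    finally show ?thesis by (simp add: e(3) dotp_def exp_vec_def)
  qed
  obtain w where w: "\<forall>a\<in>B. 1 \<le> dotp w a" and tight: "vec.span {a \<in> B. dotp w a = 1} = UNIV"
    using spanning_tight_constraints[OF finB spanB feas] by blast
  have wk: "1 \<le> of_nat (kexp v) * w $ v" for v
    using bspec[OF w pure_B[of v]] by (simp add: dotp_simps dotp_axis)
  have wpos: "w $ v > 0" for v
  proof (rule ccontr)
    assume "\<not> ?thesis"
    then have "of_nat (kexp v) * w $ v \<le> 0" by (intro mult_nonneg_nonpos) auto
    then show False using wk[of v] by linarith
  qed
  have "1 \<le> bsum w i e" if i: "i \<in> {1..r}" and e: "e \<in> Q i" for i e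
  \<comment> \<open>An exponent above \<open>K\<close> outweighs the pure power of its variable;
    otherwise the restriction to the block is among the finitely many constraints.\<close>
  proof (cases "\<exists>v. blk v = i \<and> Poly_Mapping.lookup e v > K")
    case True
    then obtain v where v: "blk v = i" "Poly_Mapping.lookup e v > K" by blast
    have "kexp v \<le> Poly_Mapping.lookup e v" using v(2) kexp_le_K[of v] by simp
    then have "of_nat (kexp v) * w $ v \<le> w $ v * of_nat (Poly_Mapping.lookup e v)"
      using wpos[of v] by (simp add: mult.commute mult_left_mono)
    then have "1 \<le> w $ v * of_nat (Poly_Mapping.lookup e v)" using wk[of v] by linarith
    also have "\<dots> \<le> bsum w i e"
      unfolding bsum_def
      by (rule member_le_sum) (use v(1) in \<open>auto simp: less_imp_le[OF wpos]\<close>)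
    finally show ?thesis .
  next
    case False
    have "restr i e \<in> box i"
      using Q_restr[OF i e] False by (auto simp: box_def supported_def restr_def not_less)
    then have "1 \<le> dotp w (exp_vec (restr i e))" using w i by (auto simp: B_def)
    also have "dotp w (exp_vec (restr i e)) = bsum w i (restr i e)"
      using \<open>restr i e \<in> box i\<close> by (intro bsum_supported[OF i]) (simp add: box_def)
    also have "\<dots> = bsum w i e" unfolding bsum_def by (rule sum.cong) (auto simp: restr_def)
    finally show ?thesis .
  qed
  moreover have "{a \<in> B. dotp w a = 1} \<subseteq> exp_vec ` (\<Union>i\<in>{1..r}. {e \<in> supported i. bsum w i e = 1})"
  proof
    fix a assume "a \<in> {a \<in> B. dotp w a = 1}"
    then obtain i e where e: "i \<in> {1..r}" "e \<in> box i" "a = exp_vec e" "dotp w a = 1" by (auto simp: B_def)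
    then have "e \<in> supported i" by (simp add: box_def)
    then have "bsum w i e = 1" using bsum_supported[OF e(1)] e by metis
    with e \<open>e \<in> supported i\<close> show "a \<in> exp_vec ` (\<Union>i\<in>{1..r}. {e \<in> supported i. bsum w i e = 1})" by blast
  qed
  then have "vec.span (exp_vec ` (\<Union>i\<in>{1..r}. {e \<in> supported i. bsum w i e = 1})) = UNIV"
    using tight vec.span_mono by blast
  ultimately show ?thesis using wpos by blast
qed

text \<open>Each of the \<open>j\<close> summands from \<open>E1\<close> has weight at least 1 in
  each of the \<open>r\<close> blocks.\<close>

lemma E_weight:
  assumes w: "\<And>v. w $ v > 0" "\<And>i e. i \<in> {1..r} \<Longrightarrow> e \<in> Q i \<Longrightarrow> 1 \<le> bsum w i e"
    and e: "e \<in> E j"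
  shows "of_nat (r * j) \<le> dotp w (exp_vec e)"
  using e
proof (induction j arbitrary: e)
  case 0
  have "0 \<le> dotp w (exp_vec e)"
    unfolding dotp_def by (rule sum_nonneg) (simp add: exp_vec_def less_imp_le[OF w(1)])
  then show ?case by simp
next
  case (Suc j)
  then obtain x y where xy: "e = x + y" "x \<in> E j" "y \<in> E1" by auto
  have "(\<Sum>i\<in>{1..r}. 1) \<le> (\<Sum>i\<in>{1..r}. bsum w i y)"
    by (rule sum_mono) (use w(2) xy(3) in \<open>auto simp: E1_def\<close>)
  then have "of_nat r \<le> dotp w (exp_vec y)" by (simp add: dotp_eq_bsum)
  then show ?case using Suc.IH[OF xy(2)] xy(1) by (simp add: exp_vec_add dotp_simps distrib_left)
qed

text \<open>The face where every block has the least possible weight: the tight exponents of the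
  blocks span the whole space, and passing to their sums over all blocks loses rank at
  most \<open>r - 1\<close>.\<close>

lemma lower_chain:
  "\<exists>k P. CARD('v) - r + 1 \<le> k \<and>
     prime_chain (ring_of_type_algebra\<lparr>carrier := keys_in \<Gamma> :: (('v \<Rightarrow>\<^sub>0 nat) \<times> nat \<Rightarrow>\<^sub>0 'k::idom) set\<rparr>) k P \<and>
     (\<forall>v. Poly_Mapping.single (Poly_Mapping.single v 1, 0) 1 \<in> P 0)"
proof -
  obtain w where wpos: "\<And>v. w $ v > 0" and wQ: "\<And>i e. i \<in> {1..r} \<Longrightarrow> e \<in> Q i \<Longrightarrow> 1 \<le> bsum w i e"
    and span: "vec.span (exp_vec ` (\<Union>i\<in>{1..r}. {e \<in> supported i. bsum w i e = 1})) = UNIV"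
    using exists_weight by blast
  define tight where "tight i = {e \<in> supported i. bsum w i e = 1}" for i
  have span_tight: "vec.span (exp_vec ` (\<Union>i\<in>{1..r}. tight i)) = UNIV"
    unfolding tight_def by (rule span)
  \<comment> \<open>Equality in \<open>E_weight\<close>. The weight minus \<open>r * j\<close> is
    additive and nonnegative on \<open>\<Gamma>\<close>, so its zero set is a face.\<close>
  define F where "F = {(e, j). dotp w (exp_vec e) = of_nat (r * j)}"
  have F0: "0 \<in> F" by (simp add: F_def zero_prod_def exp_vec_0 dotp_simps)
  have F_face: "x + y \<in> F \<longleftrightarrow> x \<in> F \<and> y \<in> F" if "x \<in> \<Gamma>" "y \<in> \<Gamma>" for x y
  proof -
    obtain e j e' j' where xy: "x = (e, j)" "y = (e', j')" by (metis surj_pair)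
    have "of_nat (r * j) \<le> dotp w (exp_vec e)" "of_nat (r * j') \<le> dotp w (exp_vec e')"
      using E_weight[OF wpos wQ] that xy by (auto simp: \<Gamma>_def)
    then show ?thesis unfolding xy F_def by (auto simp: exp_vec_add dotp_simps distrib_left)
  qed
  let ?Z = "exp_vec ` fst ` (\<Gamma> \<inter> F)"
  \<comment> \<open>Without a tight exponent in block \<open>i\<close>, all tight ones would vanish
    at \<open>rep i\<close> and could not span.\<close>
  have tight_ne: "tight i \<noteq> {}" if i: "i \<in> {1..r}" for i
  proof
    assume "tight i = {}"
    have "dotp (axis (rep i) 1) a = 0" if a: "a \<in> exp_vec ` (\<Union>i\<in>{1..r}. tight i)" for a
    proof -
      obtain j e where e: "j \<in> {1..r}" "e \<in> tight j" "a = exp_vec e" using a by blast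
      have "j \<noteq> i" using e(2) \<open>tight i = {}\<close> by auto
      then have "a $ rep i = 0" using e blk_rep[OF i] by (auto simp: tight_def supported_def exp_vec_def)
      moreover have "dotp (axis (rep i) 1) a = dotp a (axis (rep i) 1)" by (simp add: dotp_def mult.commute)
      ultimately show ?thesis by (simp add: dotp_axis)
    qed
    moreover have "axis (rep i) 1 \<in> vec.span (exp_vec ` (\<Union>i\<in>{1..r}. tight i))"
      unfolding span_tight by (rule UNIV_I)
    ultimately have "dotp (axis (rep i) 1) (axis (rep i) 1) = 0"
      by (rule dotp_span_eq_0)
    then show False by (simp add: dotp_axis)
  qed
  define b where "b i = (SOME e. e \<in> tight i)" for i
  have b: "b i \<in> tight i" if "i \<in> {1..r}" for i
    unfolding b_def using tight_ne[OF that] by (simp add: some_in_eq)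
  have bsum_other: "bsum w i e = 0" if "e \<in> tight j" "j \<noteq> i" for i j e
    unfolding bsum_def by (rule sum.neutral) (use that in \<open>auto simp: tight_def supported_def\<close>)
  have in_Z: "exp_vec (\<Sum>i\<in>{1..r}. c i) \<in> ?Z" if c: "\<And>i. i \<in> {1..r} \<Longrightarrow> c i \<in> tight i" for c
  proof -
    let ?c = "\<Sum>i\<in>{1..r}. c i"
    have "?c \<in> Q i" if i: "i \<in> {1..r}" for i
    proof -
      have "c i \<in> Q i" using c[OF i] by (simp add: tight_def supported_def)
      then show ?thesis using Q_up[OF i, of "c i" "\<Sum>j\<in>{1..r} - {i}. c j"] i by (simp add: sum.remove)
    qed
    then have "?c \<in> E1" by (simp add: E1_def)
    then have "0 + ?c \<in> E (Suc 0)" by (auto simp del: add_0)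
    moreover have "dotp w (exp_vec ?c) = of_nat r"
    proof -
      have "dotp w (exp_vec ?c) = (\<Sum>i\<in>{1..r}. dotp w (exp_vec (c i)))"
        unfolding exp_vec_sum dotp_sum ..
      also have "\<dots> = (\<Sum>i\<in>{1..r}. 1)"
        by (rule sum.cong) (use c bsum_supported in \<open>auto simp: tight_def\<close>)
      finally show ?thesis by simp
    qed
    ultimately have "(?c, 1) \<in> \<Gamma> \<inter> F" by (simp add: \<Gamma>_def F_def)
    then show ?thesis by (metis fst_conv imageI)
  qed
  \<comment> \<open>Together with the total sum of all \<open>b i\<close>, which lies in the face,
    the \<open>r - 1\<close> vectors of \<open>Y\<close> give back \<open>b 1\<close> as well.
    Replacing one summand \<open>b i\<close> by another tight exponent then recovers every tight
    exponent.\<close>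
  define Y where "Y = exp_vec ` b ` {2..r}"
  let ?D = "vec.span (?Z \<union> Y)"
  have bD: "exp_vec (b i) \<in> ?D" if "i \<in> {1..r}" for i
  proof (cases "i = 1")
    case False
    then show ?thesis using that by (intro vec.span_base) (auto simp: Y_def)
  next
    case True
    have "{1..r} = insert 1 {2..r}" using r_pos by auto
    then have "exp_vec (\<Sum>i\<in>{1..r}. b i) = exp_vec (b 1) + (\<Sum>i\<in>{2..r}. exp_vec (b i))"
      by (simp add: exp_vec_add exp_vec_sum)
    then have "exp_vec (b 1) = exp_vec (\<Sum>i\<in>{1..r}. b i) - (\<Sum>i\<in>{2..r}. exp_vec (b i))" by simp
    also have "\<dots> \<in> ?D"
    proof (rule vec.span_diff)
      have "exp_vec (\<Sum>i\<in>{1..r}. b i) \<in> ?Z" by (rule in_Z) (rule b)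
      then show "exp_vec (\<Sum>i\<in>{1..r}. b i) \<in> ?D" by (intro vec.span_base) blast
      show "(\<Sum>i\<in>{2..r}. exp_vec (b i)) \<in> ?D"
        by (intro vec.span_sum vec.span_base) (auto simp: Y_def)
    qed
    finally show ?thesis using True by simp
  qed
  have "exp_vec e \<in> ?D" if i: "i \<in> {1..r}" and e: "e \<in> tight i" for i e
  proof -
    have "exp_vec (\<Sum>j\<in>{1..r}. (b(i := e)) j) \<in> ?Z" by (rule in_Z) (use b e in auto)
    moreover have "exp_vec (\<Sum>j\<in>{1..r}. (b(i := e)) j) = exp_vec e + (\<Sum>j\<in>{1..r} - {i}. exp_vec (b j))"
      using i by (simp add: sum.remove exp_vec_add exp_vec_sum)
    ultimately have "exp_vec e + (\<Sum>j\<in>{1..r} - {i}. exp_vec (b j)) \<in> ?D"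
      by (metis UnI1 vec.span_base)
    moreover have "(\<Sum>j\<in>{1..r} - {i}. exp_vec (b j)) \<in> ?D" by (rule vec.span_sum) (use bD in auto)
    ultimately have "exp_vec e + (\<Sum>j\<in>{1..r} - {i}. exp_vec (b j)) - (\<Sum>j\<in>{1..r} - {i}. exp_vec (b j)) \<in> ?D"
      by (rule vec.span_diff)
    then show ?thesis by simp
  qed
  then have "vec.span (exp_vec ` (\<Union>i\<in>{1..r}. tight i)) \<subseteq> ?D"
    by (intro vec.span_minimal vec.subspace_span) auto
  then have "?D = UNIV" unfolding span_tight by blast
  then have "CARD('v) \<le> vec.dim (?Z \<union> Y)"
    using vec.dim_eq_full[of "?Z \<union> Y"] by (simp add: vec.dimension_def card_cart_basis)
  also have "\<dots> \<le> vec.dim ?Z + card Y" by (rule dim_Un_finite_le) (simp add: Y_def)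
  also have "card Y \<le> r - 1"
    unfolding Y_def image_image using card_image_le[of "{2..r}" "\<lambda>i. exp_vec (b i)"] by simp
  finally have "CARD('v) - r + 1 \<le> vec.dim ?Z" using r_pos r_le_card by linarith
  moreover obtain k P where P: "vec.dim ?Z \<le> k"
    "prime_chain (ring_of_type_algebra\<lparr>carrier := keys_in \<Gamma> :: (('v \<Rightarrow>\<^sub>0 nat) \<times> nat \<Rightarrow>\<^sub>0 'k) set\<rparr>) k P"
    "keys_in (\<Gamma> - F) \<subseteq> P 0"
    using face_chain[OF \<Gamma>_0 \<Gamma>_add F0 F_face] by blast
  \<comment> \<open>In degree 0 the face requires weight 0, but a variable has positive
    weight.\<close>
  moreover have fF: "(Poly_Mapping.single v 1, 0) \<in> \<Gamma> - F" for v
  proof -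
    have "exp_vec (Poly_Mapping.single v 1) = axis v 1"
      by (auto simp: exp_vec_def vec_eq_iff axis_def lookup_single when_def)
    then have "dotp w (exp_vec (Poly_Mapping.single v 1)) = w $ v" by (simp add: dotp_axis)
    then show ?thesis using wpos[of v] by (simp add: \<Gamma>_def F_def)
  qed
  have "Poly_Mapping.single (Poly_Mapping.single v 1, 0) 1 \<in> P 0" for v
    by (rule subsetD[OF P(3) single_in_keys_in[OF fF]])
  ultimately show ?thesis using le_trans[OF _ P(1)] by blast
qed

end

section \<open>The fibre ring\<close>

lemma poly_mapping_additive_induct [case_names single add]:
  fixes f :: "'a \<Rightarrow>\<^sub>0 'b::comm_monoid_add"
  assumes single: "\<And>x c. P (Poly_Mapping.single x c)" and add: "\<And>f g. P f \<Longrightarrow> P g \<Longrightarrow> P (f + g)"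
  shows "P f"
proof -
  have "P (\<Sum>x\<in>A. Poly_Mapping.single x (c x))" if "finite A" for A c
    using that
  proof (induction A rule: finite_induct)
    case empty
    show ?case using single[of undefined 0] by simp
  qed (simp add: single add)
  from this[of "Poly_Mapping.keys f" "Poly_Mapping.lookup f"] show ?thesis
    using poly_mapping_expand[of f] by simp
qed

lemma ideal_type_algebra_iff:
  fixes J :: "'a::comm_ring_1 set"
  shows "ideal J ring_of_type_algebra \<longleftrightarrow>
    0 \<in> J \<and> (\<forall>a\<in>J. \<forall>b\<in>J. a + b \<in> J) \<and> (\<forall>a\<in>J. \<forall>x. x * a \<in> J)"
proof
  assume id: "ideal J ring_of_type_algebra"
  note add = ideal.axioms(1)[OF id]
  show "0 \<in> J \<and> (\<forall>a\<in>J. \<forall>b\<in>J. a + b \<in> J) \<and> (\<forall>a\<in>J. \<forall>x. x * a \<in> J)"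
    using additive_subgroup.zero_closed[OF add] additive_subgroup.a_closed[OF add] ideal.I_l_closed[OF id]
    by simp
next
  assume J: "0 \<in> J \<and> (\<forall>a\<in>J. \<forall>b\<in>J. a + b \<in> J) \<and> (\<forall>a\<in>J. \<forall>x. x * a \<in> J)"
  interpret cring "ring_of_type_algebra :: 'a ring" by (rule cring_from_type_algebra)
  have minus: "\<ominus>\<^bsub>ring_of_type_algebra\<^esub> x = - x" for x :: 'a by (rule minus_equality) auto
  show "ideal J ring_of_type_algebra"
  proof (rule idealI)
    show "subgroup J (add_monoid ring_of_type_algebra)"
    proof (rule add.subgroupI)
      show "\<ominus>\<^bsub>ring_of_type_algebra\<^esub> a \<in> J" if "a \<in> J" for a
        using J that unfolding minus by (metis mult_minus1)
    qed (use J in auto)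
  qed (use J ring_axioms in \<open>auto simp: mult.commute\<close>)
qed

lemma ideal_keys_in:
  fixes E :: "'m::comm_monoid_add set"
  assumes "\<And>e c. e \<in> E \<Longrightarrow> e + c \<in> E"
  shows "ideal (keys_in E :: ('m \<Rightarrow>\<^sub>0 'k::comm_ring_1) set) ring_of_type_algebra"
proof -
  have "x * a \<in> keys_in E" if "a \<in> keys_in E" for a x :: "'m \<Rightarrow>\<^sub>0 'k"
  proof (rule keys_in_mult[of x UNIV a E])
    show "y + z \<in> E" if "z \<in> E" for y z using assms[OF that, of y] by (simp add: add.commute)
  qed (use that in \<open>auto simp: keys_in_def\<close>)
  moreover have "0 \<in> keys_in E" by (simp add: keys_in_def)
  ultimately show ?thesis
    unfolding ideal_type_algebra_iff by (simp add: keys_in_add)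
qed

lemma keys_in_subset_ideal:
  fixes J :: "('m::comm_monoid_add \<Rightarrow>\<^sub>0 'k::comm_ring_1) set"
  assumes J: "ideal J ring_of_type_algebra" and "\<And>e. e \<in> E \<Longrightarrow> Poly_Mapping.single e 1 \<in> J"
  shows "keys_in E \<subseteq> J"
proof
  note J' = J[unfolded ideal_type_algebra_iff]
  fix f :: "'m \<Rightarrow>\<^sub>0 'k" assume f: "f \<in> keys_in E"
  have "(\<Sum>x\<in>A. Poly_Mapping.single x (Poly_Mapping.lookup f x)) \<in> J" if "finite A" "A \<subseteq> E" for A
    using that
  proof (induction A rule: finite_induct)
    case (insert x A)
    have "Poly_Mapping.single 0 (Poly_Mapping.lookup f x) * Poly_Mapping.single x 1 \<in> J"
      using J' assms(2)[of x] insert by blast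
    then have "Poly_Mapping.single x (Poly_Mapping.lookup f x) \<in> J" by (simp add: mult_single)
    then show ?case using insert J' by auto
  qed (use J' in auto)
  from this[OF finite_keys, of f] show "f \<in> J" using f poly_mapping_expand[of f] by (simp add: keys_in_def)
qed

text \<open>The elements supported on the monomials of \<open>J\<close> form an ideal that contains
  the generators, so minimality of the generated ideal leaves no room. From here on a monomial ideal
  is a set of exponents.\<close>

lemma monomial_ideal_keys_in:
  fixes J :: "('v, 'k::comm_ring_1) mpoly set"
  assumes "monomial_ideal J"
  shows "J = keys_in {e. monomial e \<in> J}"
proof -
  obtain E where E: "J = Idl\<^bsub>mpoly_ring\<^esub> (monomial ` E)" using assms by (auto simp: monomial_ideal_def)
  interpret R: cring "mpoly_ring :: ('v, 'k) mpoly ring" by (rule cring_from_type_algebra)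
  have J: "ideal J mpoly_ring" unfolding E by (rule R.genideal_ideal) simp
  let ?E = "{e. monomial e \<in> J}"
  have "J \<subseteq> keys_in ?E"
  proof -
    have "monomial (e + c) \<in> J" if "monomial e \<in> J" for e c
    proof -
      have "monomial c * monomial e \<in> J" using J that by (simp add: ideal_type_algebra_iff)
      then show ?thesis by (simp add: monomial_def mult_single add.commute)
    qed
    then have id: "ideal (keys_in ?E :: ('v, 'k) mpoly set) mpoly_ring" by (intro ideal_keys_in) auto
    have "monomial ` E \<subseteq> J" unfolding E by (rule R.genideal_self) simp
    then have "monomial ` E \<subseteq> (keys_in ?E :: ('v, 'k) mpoly set)" by (auto simp: monomial_def intro!: single_in_keys_in)
    from R.genideal_minimal[OF id this] show ?thesis by (simp add: E)
  qed
  moreover have "keys_in ?E \<subseteq> J" by (rule keys_in_subset_ideal[OF J]) (simp add: monomial_def)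
  ultimately show ?thesis by blast
qed

text \<open>Products of monomials add exponents, which is what makes the powers of the ideal follow
  the recursion of \<open>E\<close>.\<close>

lemma ideal_prod_keys_in:
  fixes E E' :: "'m::comm_monoid_add set"
  defines "R \<equiv> (ring_of_type_algebra :: ('m \<Rightarrow>\<^sub>0 'k::comm_ring_1) ring)"
  assumes "\<And>e c. e \<in> E \<Longrightarrow> e + c \<in> E" "\<And>e c. e \<in> E' \<Longrightarrow> e + c \<in> E'"
  shows "ideal_prod R (keys_in E) (keys_in E') = keys_in {x + y | x y. x \<in> E \<and> y \<in> E'}"
proof
  interpret cring R unfolding R_def by (rule cring_from_type_algebra)
  show "ideal_prod R (keys_in E) (keys_in E') \<subseteq> keys_in {x + y | x y. x \<in> E \<and> y \<in> E'}"
  proof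
    fix f assume "f \<in> ideal_prod R (keys_in E) (keys_in E')"
    then show "f \<in> keys_in {x + y | x y. x \<in> E \<and> y \<in> E'}"
    proof induction
      case (prod i j)
      then show ?case unfolding R_def type_algebra_simps by (rule keys_in_mult) blast
    next
      case (sum s1 s2)
      then show ?case by (simp add: R_def keys_in_add)
    qed
  qed
  have id: "ideal (ideal_prod R (keys_in E) (keys_in E')) R"
  proof (rule ideal_prod_is_ideal)
    show "ideal (keys_in E) R" unfolding R_def by (rule ideal_keys_in) (rule assms(2))
    show "ideal (keys_in E') R" unfolding R_def by (rule ideal_keys_in) (rule assms(3))
  qed
  show "keys_in {x + y | x y. x \<in> E \<and> y \<in> E'} \<subseteq> ideal_prod R (keys_in E) (keys_in E')"
  proof (rule keys_in_subset_ideal[OF id[unfolded R_def], folded R_def])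
    fix e assume "e \<in> {x + y | x y. x \<in> E \<and> y \<in> E'}"
    then obtain x y where xy: "e = x + y" "x \<in> E" "y \<in> E'" by blast
    have "Poly_Mapping.single x 1 \<otimes>\<^bsub>R\<^esub> Poly_Mapping.single y 1 \<in> ideal_prod R (keys_in E) (keys_in E')"
      by (rule ideal_prod.prod) (use xy in \<open>auto intro: single_in_keys_in\<close>)
    then show "Poly_Mapping.single e 1 \<in> ideal_prod R (keys_in E) (keys_in E')"
      by (simp add: R_def mult_single xy)
  qed
qed

text \<open>The identification of the monoid algebra on pairs (exponent, degree) with polynomials in
  t over the polynomial ring.\<close>

definition to_UP :: "(('a \<times> nat) \<Rightarrow>\<^sub>0 'k::zero) \<Rightarrow> nat \<Rightarrow> ('a \<Rightarrow>\<^sub>0 'k)" where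
  "to_UP f j = Abs_poly_mapping (\<lambda>e. Poly_Mapping.lookup f (e, j))"

lemma lookup_to_UP [simp]: "Poly_Mapping.lookup (to_UP f j) e = Poly_Mapping.lookup f (e, j)"
proof -
  have "finite ((\<lambda>e. (e, j)) -` Poly_Mapping.keys f)" by (rule finite_vimageI) (simp_all add: inj_def)
  moreover have "(\<lambda>e. (e, j)) -` Poly_Mapping.keys f = {e. Poly_Mapping.lookup f (e, j) \<noteq> 0}"
    by (auto simp: in_keys_iff)
  ultimately show ?thesis by (simp add: to_UP_def)
qed

lemma inj_to_UP: "inj to_UP"
proof (rule injI)
  fix f g :: "('a \<times> nat) \<Rightarrow>\<^sub>0 'k::zero" assume eq: "to_UP f = to_UP g"
  show "f = g"
  proof (rule poly_mapping_eqI)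
    fix x :: "'a \<times> nat"
    show "Poly_Mapping.lookup f x = Poly_Mapping.lookup g x"
      using arg_cong[OF fun_cong[OF eq, of "snd x"], of "\<lambda>h. Poly_Mapping.lookup h (fst x)"] by simp
  qed
qed

lemma to_UP_single:
  "to_UP (Poly_Mapping.single (e, j) c) = (\<lambda>i. if i = j then Poly_Mapping.single e c else 0)"
proof (rule ext, rule poly_mapping_eqI)
  show "Poly_Mapping.lookup (to_UP (Poly_Mapping.single (e, j) c) i) x =
      Poly_Mapping.lookup (if i = j then Poly_Mapping.single e c else 0) x" for i x
    by (auto simp: lookup_single when_def)
qed

lemma to_UP_add: "to_UP (f + g) = (\<lambda>i. to_UP f i + to_UP g i)"
proof (rule ext, rule poly_mapping_eqI)
  show "Poly_Mapping.lookup (to_UP (f + g) i) x = Poly_Mapping.lookup (to_UP f i + to_UP g i) x" for i x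
    by (simp add: lookup_add)
qed

lemma to_UP_in_up: "to_UP f \<in> up ring_of_type_algebra" for f :: "'a::comm_monoid_add \<times> nat \<Rightarrow>\<^sub>0 'k::comm_ring_1"
proof (rule mem_upI)
  have "to_UP f m = 0" if "Max (insert 0 (snd ` Poly_Mapping.keys f)) < m" for m
  proof (rule poly_mapping_eqI)
    fix e
    have "(e, m) \<notin> Poly_Mapping.keys f"
    proof
      assume "(e, m) \<in> Poly_Mapping.keys f"
      then have "snd (e, m) \<in> snd ` Poly_Mapping.keys f" by (rule imageI)
      then have "m \<le> Max (insert 0 (snd ` Poly_Mapping.keys f))" by (intro Max_ge) auto
      then show False using that by simp
    qed
    then show "Poly_Mapping.lookup (to_UP f m) e = Poly_Mapping.lookup 0 e" by (simp add: in_keys_iff)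
  qed
  then have "bound \<zero>\<^bsub>ring_of_type_algebra\<^esub> (Max (insert 0 (snd ` Poly_Mapping.keys f))) (to_UP f)"
    by (intro bound.intro) (simp only: type_algebra_simps)
  then show "\<exists>n. bound \<zero>\<^bsub>ring_of_type_algebra\<^esub> n (to_UP f)" by blast
qed simp

lemma to_UP_surj:
  assumes "p \<in> up (ring_of_type_algebra :: ('a::comm_monoid_add \<Rightarrow>\<^sub>0 'k::comm_ring_1) ring)"
  obtains f where "to_UP f = p"
proof -
  obtain n where n: "bound \<zero>\<^bsub>ring_of_type_algebra :: ('a \<Rightarrow>\<^sub>0 'k) ring\<^esub> n p" using assms by (auto simp: up_def)
  define g where "g = (\<lambda>(e, j). Poly_Mapping.lookup (p j) e)"
  have "{x. g x \<noteq> 0} \<subseteq> (\<Union>j\<le>n. Poly_Mapping.keys (p j) \<times> {j})"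
  proof
    fix x assume x: "x \<in> {x. g x \<noteq> 0}"
    obtain e j where ej: "x = (e, j)" by (cases x)
    then have "Poly_Mapping.lookup (p j) e \<noteq> 0" using x by (simp add: g_def)
    moreover from this have "j \<le> n" using bound.bound[OF n, of j] by (cases "n < j") auto
    ultimately show "x \<in> (\<Union>j\<le>n. Poly_Mapping.keys (p j) \<times> {j})" using ej by (auto simp: in_keys_iff)
  qed
  then have fin: "finite {x. g x \<noteq> 0}" by (rule finite_subset) auto
  have "to_UP (Abs_poly_mapping g) = p"
  proof (rule ext, rule poly_mapping_eqI)
    show "Poly_Mapping.lookup (to_UP (Abs_poly_mapping g) j) e = Poly_Mapping.lookup (p j) e" for j e
      by (simp add: lookup_Abs_poly_mapping[OF fin]) (simp add: g_def)
  qed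
  then show thesis by (rule that)
qed

lemma UP_simps:
  "carrier (UP R) = up R"
  "\<one>\<^bsub>UP R\<^esub> = (\<lambda>i. if i = 0 then \<one>\<^bsub>R\<^esub> else \<zero>\<^bsub>R\<^esub>)"
  "p \<in> up R \<Longrightarrow> q \<in> up R \<Longrightarrow> p \<oplus>\<^bsub>UP R\<^esub> q = (\<lambda>i. p i \<oplus>\<^bsub>R\<^esub> q i)"
  "a \<in> carrier R \<Longrightarrow> up_ring.monom (UP R) a n = (\<lambda>i. if i = n then a else \<zero>\<^bsub>R\<^esub>)"
  "p \<in> up R \<Longrightarrow> up_ring.coeff (UP R) p n = p n"
  by (simp_all add: UP_def)

text \<open>By additivity in both arguments, multiplicativity reduces to single terms, where it is
  the product rule for \<open>monom\<close>.\<close>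

lemma to_UP_ring_hom:
  "to_UP \<in> ring_hom (ring_of_type_algebra :: ('a::comm_monoid_add \<times> nat \<Rightarrow>\<^sub>0 'k::comm_ring_1) ring) (UP ring_of_type_algebra)"
proof -
  interpret R: cring "ring_of_type_algebra :: ('a \<Rightarrow>\<^sub>0 'k) ring" by (rule cring_from_type_algebra)
  let ?P = "UP (ring_of_type_algebra :: ('a \<Rightarrow>\<^sub>0 'k) ring)"
  have UP: "UP_ring (ring_of_type_algebra :: ('a \<Rightarrow>\<^sub>0 'k) ring)" by (rule UP_ring.intro) (rule R.ring_axioms)
  have UPc: "UP_cring (ring_of_type_algebra :: ('a \<Rightarrow>\<^sub>0 'k) ring)" by (rule UP_cring.intro) (rule R.is_cring)
  have car: "to_UP f \<in> carrier ?P" for f unfolding UP_simps by (rule to_UP_in_up)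
  have hom_add: "to_UP (f + g) = to_UP f \<oplus>\<^bsub>?P\<^esub> to_UP g" for f g
    unfolding UP_simps(3)[OF to_UP_in_up to_UP_in_up] type_algebra_simps by (rule to_UP_add)
  have mon: "to_UP (Poly_Mapping.single x c) = up_ring.monom ?P (Poly_Mapping.single (fst x) c) (snd x)" for x c
    using to_UP_single[of "fst x" "snd x" c] by (simp add: UP_simps cong: if_cong)
  have one: "to_UP (1 :: 'a \<times> nat \<Rightarrow>\<^sub>0 'k) = \<one>\<^bsub>?P\<^esub>"
    using to_UP_single[of "0 :: 'a" 0 "1 :: 'k"] by (simp add: UP_simps cong: if_cong flip: zero_prod_def)
  interpret U: cring ?P by (rule UP_cring.UP_cring) (rule UPc)
  have mult: "to_UP (f * g) = to_UP f \<otimes>\<^bsub>?P\<^esub> to_UP g" for f g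
  proof (induction f rule: poly_mapping_additive_induct)
    case f: (single x c)
    show ?case
    proof (induction g rule: poly_mapping_additive_induct)
      case (single y d)
      have "to_UP (Poly_Mapping.single x c * Poly_Mapping.single y d)
          = up_ring.monom ?P (Poly_Mapping.single (fst x) c \<otimes>\<^bsub>ring_of_type_algebra\<^esub> Poly_Mapping.single (fst y) d) (snd x + snd y)"
        by (simp add: mult_single mon)
      also have "\<dots> = to_UP (Poly_Mapping.single x c) \<otimes>\<^bsub>?P\<^esub> to_UP (Poly_Mapping.single y d)"
        unfolding mon by (rule UP_ring.monom_mult[OF UP]) simp_all
      finally show ?case .
    next
      case (add f g)
      then show ?case by (simp add: distrib_left hom_add U.r_distr car)
    qed
  next
    case (add f g)
    then show ?case by (simp add: distrib_right hom_add U.l_distr car)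
  qed
  show ?thesis by (rule ring_hom_memI) (use car hom_add mult one in auto)
qed

text \<open>In this model, the structure map of the Rees algebra: polynomials as elements of degree
  0.\<close>

definition embed :: "('a \<Rightarrow>\<^sub>0 'k::comm_monoid_add) \<Rightarrow> ('a \<times> nat \<Rightarrow>\<^sub>0 'k)" where
  "embed = push UNIV (\<lambda>e. (e, 0))"

lemma to_UP_embed:
  "to_UP (embed a) = up_ring.monom (UP ring_of_type_algebra) a 0"
  for a :: "'a::comm_monoid_add \<Rightarrow>\<^sub>0 'k::comm_ring_1"
proof -
  have "to_UP (embed a) = (\<lambda>i. if i = 0 then a else 0)"
    unfolding embed_def
  proof (induction a rule: poly_mapping_additive_induct)
    case (single x c)
    show ?case by (simp add: push_single to_UP_single)
  next
    case (add f g)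
    show ?case unfolding push_add to_UP_add add by auto
  qed
  then show ?thesis by (simp add: UP_simps cong: if_cong)
qed

context block_ideals
begin

lemma E1_up: "e \<in> E1 \<Longrightarrow> e + c \<in> E1"
  using Q_up by (auto simp: E1_def)

lemma ideal_power_E1:
  "(keys_in E1 :: ('v, 'k::comm_ring_1) mpoly set) [^]\<^bsub>ideals_set mpoly_ring\<^esub> j = keys_in (E j)"
proof (induction j)
  case 0
  show ?case by (simp add: nat_pow_def ideals_set_def keys_in_def)
next
  case (Suc j)
  have "(keys_in E1 :: ('v, 'k) mpoly set) [^]\<^bsub>ideals_set mpoly_ring\<^esub> Suc j
      = ideal_prod mpoly_ring (keys_in (E j)) (keys_in E1)"
    unfolding Suc[symmetric] by (simp add: nat_pow_def ideals_set_def)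
  also have "\<dots> = keys_in (E (Suc j))"
    unfolding E.simps by (rule ideal_prod_keys_in[OF E_up E1_up])
  finally show ?case .
qed

text \<open>A graded piece is an ideal power, hence a condition on exponents alone, so the Rees
  algebra is the monoid algebra of \<open>\<Gamma>\<close>.\<close>

lemma rees_algebra_E1:
  "rees_algebra mpoly_ring (keys_in E1 :: ('v, 'k::comm_ring_1) mpoly set)
     = (UP mpoly_ring)\<lparr>carrier := to_UP ` keys_in \<Gamma>\<rparr>"
proof -
  have iff: "to_UP f i \<in> keys_in (E i) \<longleftrightarrow> (\<forall>e. (e, i) \<in> Poly_Mapping.keys f \<longrightarrow> e \<in> E i)"
    for f :: "('v \<Rightarrow>\<^sub>0 nat) \<times> nat \<Rightarrow>\<^sub>0 'k" and i
    by (auto simp: keys_in_def in_keys_iff subset_iff)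
  have "{f \<in> carrier (UP mpoly_ring). \<forall>i. up_ring.coeff (UP mpoly_ring) f i
      \<in> (keys_in E1 :: ('v, 'k) mpoly set) [^]\<^bsub>ideals_set mpoly_ring\<^esub> i} = to_UP ` keys_in \<Gamma>"
    (is "?L = ?R")
  proof (intro equalityI subsetI)
    fix p :: "nat \<Rightarrow> ('v, 'k) mpoly" assume p: "p \<in> ?L"
    then have up: "p \<in> up mpoly_ring" by (simp add: UP_simps)
    then obtain f where f: "to_UP f = p" by (rule to_UP_surj)
    have "to_UP f i \<in> keys_in (E i)" for i
      using p up unfolding ideal_power_E1 by (simp add: UP_simps f)
    then have "f \<in> keys_in \<Gamma>" unfolding iff by (auto simp: keys_in_def \<Gamma>_def)
    then show "p \<in> ?R" using f by blast
  next
    fix p :: "nat \<Rightarrow> ('v, 'k) mpoly" assume "p \<in> ?R"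
    then obtain f where f: "f \<in> keys_in \<Gamma>" "p = to_UP f" by blast
    have "to_UP f i \<in> keys_in (E i)" for i
      using f(1) unfolding iff by (auto simp: keys_in_def \<Gamma>_def)
    then show "p \<in> ?L"
      unfolding ideal_power_E1 f(2) using to_UP_in_up[of f] by (simp add: UP_simps)
  qed
  then show ?thesis unfolding rees_algebra_def by simp
qed

theorem analytic_spread_E1:
  "analytic_spread mpoly_ring irrelevant_ideal (keys_in E1 :: ('v, 'k::field) mpoly set)
     = ereal (real (CARD('v) - r + 1))"
proof -
  let ?d = "CARD('v) - r + 1"
  define R where "R = (mpoly_ring :: ('v, 'k) mpoly ring)"
  define S where "S = (ring_of_type_algebra\<lparr>carrier := keys_in \<Gamma>\<rparr> :: (('v \<Rightarrow>\<^sub>0 nat) \<times> nat \<Rightarrow>\<^sub>0 'k) ring)"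
  define A where "A = (UP R)\<lparr>carrier := to_UP ` keys_in \<Gamma>\<rparr>"
  define m where "m = (irrelevant_ideal :: ('v, 'k) mpoly set)"
  define f where "f = (\<lambda>a. up_ring.monom (UP R) a 0)"
  define g where "g = (\<lambda>a. m +>\<^bsub>R\<^esub> a)"
  define T where "T = tensor_algebra R A f (R Quot m) g"
  have spread: "analytic_spread mpoly_ring irrelevant_ideal (keys_in E1 :: ('v, 'k) mpoly set) = krull_dim T"
    by (simp add: analytic_spread_def T_def A_def f_def g_def rees_algebra_E1 R_def m_def)
  have cR: "cring R" unfolding R_def by (rule cring_from_type_algebra)
  have f_embed: "f a = to_UP (embed a)" for a unfolding f_def R_def by (rule to_UP_embed[symmetric])
  note K = keys_in_subalgebra[OF \<Gamma>_0 \<Gamma>_add, where ?'k = 'k]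
  have cS: "cring S" unfolding S_def by (rule cring_type_algebra_update) (use K in auto)
  have cU: "cring (UP R)" by (rule UP_cring.UP_cring, rule UP_cring.intro, rule cR)
  have S_U: "to_UP \<in> ring_hom S (UP R)"
    using to_UP_ring_hom[where ?'a = "'v \<Rightarrow>\<^sub>0 nat" and ?'k = 'k] by (auto simp: ring_hom_def S_def R_def Pi_def)
  have "ring_hom_ring S (UP R) to_UP"
    by (rule ring_hom_ringI2) (use cS cU S_U in \<open>auto simp: cring_def\<close>)
  from ring_hom_ring.img_is_cring[OF this cU] have cA: "cring A" by (simp add: A_def S_def)
  have S_A: "to_UP \<in> ring_hom S A" using S_U by (auto simp: ring_hom_def A_def S_def)
  have surj_SA: "to_UP ` carrier S = carrier A" by (simp add: S_def A_def)
  have emb\<Gamma>: "embed a \<in> keys_in \<Gamma>" for a :: "('v, 'k) mpoly"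
    unfolding embed_def push_def by (rule keys_in_sum) (auto intro!: single_in_keys_in simp: \<Gamma>_def)
  have emb_add: "embed (a + b) = embed a + embed b" for a b :: "('v, 'k) mpoly"
    unfolding embed_def by (rule push_add)
  have emb_mult: "embed (a * b) = embed a * embed b" for a b :: "('v, 'k) mpoly"
    unfolding embed_def by (rule push_mult[of _ UNIV _ UNIV]) (auto simp: keys_in_def)
  have emb_one: "embed (1 :: ('v, 'k) mpoly) = 1"
  proof -
    have "embed (Poly_Mapping.single 0 (1 :: 'k)) = Poly_Mapping.single (0 :: ('v \<Rightarrow>\<^sub>0 nat) \<times> nat) 1"
      unfolding embed_def push_single zero_prod_def by simp
    then show ?thesis by simp
  qed
  have emb_hom: "embed \<in> ring_hom R S"
    by (rule ring_hom_memI) (simp_all add: R_def S_def emb\<Gamma> emb_add emb_mult emb_one)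
  have f_hom: "f \<in> ring_hom R A"
  proof (rule ring_hom_memI)
    fix x y assume "x \<in> carrier R" "y \<in> carrier R"
    then have e: "embed x \<in> carrier S" "embed y \<in> carrier S" by (simp_all add: S_def emb\<Gamma>)
    show "f x \<in> carrier A" unfolding f_embed by (rule ring_hom_closed[OF S_A e(1)])
    show "f (x \<otimes>\<^bsub>R\<^esub> y) = f x \<otimes>\<^bsub>A\<^esub> f y"
      unfolding f_embed ring_hom_mult[OF S_A e, symmetric] by (simp add: R_def S_def emb_mult)
    show "f (x \<oplus>\<^bsub>R\<^esub> y) = f x \<oplus>\<^bsub>A\<^esub> f y"
      unfolding f_embed ring_hom_add[OF S_A e, symmetric] by (simp add: R_def S_def emb_add)
  next
    show "f \<one>\<^bsub>R\<^esub> = \<one>\<^bsub>A\<^esub>"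
      unfolding f_embed ring_hom_one[OF S_A, symmetric] by (simp add: R_def S_def emb_one)
  qed
  interpret R: cring R by (rule cR)
  have VarR: "range Var \<subseteq> carrier R" by (simp add: R_def)
  have m_Idl: "m = Idl\<^bsub>R\<^esub> (range Var)" by (simp add: m_def irrelevant_ideal_def R_def)
  interpret m: ideal m R unfolding m_Idl by (rule R.genideal_ideal) (rule VarR)
  have Var_m: "Var v \<in> m" for v
    using R.genideal_self[OF VarR] unfolding m_Idl by blast
  have cB: "cring (R Quot m)" by (rule m.quotient_is_cring) (rule cR)
  have g_hom: "g \<in> ring_hom R (R Quot m)" unfolding g_def by (rule m.rcos_ring_hom)
  have g_surj: "g ` carrier R = carrier (R Quot m)"
    by (auto simp: g_def FactRing_def A_RCOSETS_def')
  have g_ker: "{a \<in> carrier R. g a = \<zero>\<^bsub>R Quot m\<^esub>} = m"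
    unfolding g_def using m.quot_zero_iff m.a_subset by blast
  define N where "N = Idl\<^bsub>A\<^esub> (f ` m)"
  obtain h where cT: "cring T" and h: "h \<in> ring_hom A T" "h ` carrier A = carrier T"
    and h_ker: "\<And>a. a \<in> carrier A \<Longrightarrow> h a = \<zero>\<^bsub>T\<^esub> \<longleftrightarrow> a \<in> N"
    using tensor_algebra_surj[OF cR cA cB f_hom g_hom g_surj] unfolding T_def N_def g_ker by blast
  interpret A: cring A by (rule cA)
  have fmA: "f ` m \<subseteq> carrier A" using ring_hom_closed[OF f_hom] m.a_subset by blast
  have fmN: "f ` m \<subseteq> N" unfolding N_def by (rule A.genideal_self) (rule fmA)
  have hom: "(\<lambda>x. h (to_UP x)) \<in> ring_hom S T"
    by (rule ring_hom_memI)
       (simp_all add: ring_hom_closed[OF S_A] ring_hom_closed[OF h(1)] ring_hom_mult[OF S_A] ring_hom_mult[OF h(1)]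
          ring_hom_add[OF S_A] ring_hom_add[OF h(1)] ring_hom_one[OF S_A] ring_hom_one[OF h(1)])
  have surj: "(\<lambda>x. h (to_UP x)) ` carrier S = carrier T"
    using h(2) unfolding surj_SA[symmetric] image_image .
  have ker: "h (to_UP x) = \<zero>\<^bsub>T\<^esub> \<longleftrightarrow> to_UP x \<in> N" if "x \<in> carrier S" for x
    using h_ker[of "to_UP x"] that surj_SA by blast
  let ?chains = "{ereal (real k) | k. \<exists>P. prime_chain S k P \<and>
      (\<forall>a\<in>carrier S. h (to_UP a) = \<zero>\<^bsub>T\<^esub> \<longrightarrow> a \<in> P 0)}"
  have dim: "krull_dim T = Sup ?chains" by (rule krull_dim_image[OF cS cT hom surj])
  have upper: "k \<le> ?d" if chain: "prime_chain S k P"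
    and ker0: "\<forall>a\<in>carrier S. h (to_UP a) = \<zero>\<^bsub>T\<^esub> \<longrightarrow> a \<in> P 0" for k P
  proof (rule chain_length_bound[of \<Gamma> snd G K, OF \<Gamma>_0 \<Gamma>_add _ _ growth chain[unfolded S_def]])
    interpret P: primeideal "P 0" S using chain by (simp add: prime_chain_def)
    have add: "x + y \<in> P 0" if "x \<in> P 0" "y \<in> P 0" for x y
      using additive_subgroup.a_closed[OF ideal.axioms(1)[OF P.is_ideal] that] by (simp add: S_def)
    have zero: "0 \<in> P 0"
      using additive_subgroup.zero_closed[OF ideal.axioms(1)[OF P.is_ideal]] by (simp add: S_def)
    have var: "Poly_Mapping.single (Poly_Mapping.single v 1, 0) 1 \<in> P 0" for v
    proof -
      have eq: "embed (Var v :: ('v, 'k) mpoly) = Poly_Mapping.single (Poly_Mapping.single v 1, 0) 1"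
        by (simp add: embed_def Var_def monomial_def push_single)
      have "to_UP (embed (Var v)) \<in> N" using fmN Var_m[of v] unfolding f_embed by blast
      moreover have "embed (Var v :: ('v, 'k) mpoly) \<in> carrier S" by (simp add: S_def emb\<Gamma>)
      ultimately show ?thesis using ker ker0 unfolding eq by blast
    qed
    \<comment> \<open>An exponent of \<open>\<Gamma>\<close> outside \<open>G\<close> stays in the
      same power after removing some variable, so its monomial is a multiple of that variable in
      degree 0.\<close>
    have single: "Poly_Mapping.single x c \<in> P 0" if x: "x \<in> \<Gamma> - G" for x c
    proof -
      obtain e j where ej: "x = (e, j)" by (cases x)
      then obtain v e' where e': "e = e' + Poly_Mapping.single v 1" "e' \<in> E j"
        using x by (auto simp: \<Gamma>_def G_def)
      have "Poly_Mapping.single (e', j) c \<in> carrier S"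
        using e'(2) by (simp add: S_def \<Gamma>_def single_in_keys_in)
      from P.I_l_closed[OF var this, of v]
      show ?thesis by (simp add: S_def mult_single ej e')
    qed
    show "p \<in> P 0" if p: "p \<in> keys_in (\<Gamma> - G)" for p
    proof -
      have "(\<Sum>x\<in>B. Poly_Mapping.single x (Poly_Mapping.lookup p x)) \<in> P 0" if "finite B" "B \<subseteq> \<Gamma> - G" for B
        using that by (induction B rule: finite_induct) (simp_all add: zero add single)
      from this[OF finite_keys, of p] show ?thesis
        using p poly_mapping_expand[of p] by (simp add: keys_in_def)
    qed
  qed simp_all
  have lower: "\<exists>k P. ?d \<le> k \<and> prime_chain S k P \<and> (\<forall>a\<in>carrier S. h (to_UP a) = \<zero>\<^bsub>T\<^esub> \<longrightarrow> a \<in> P 0)"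
  proof -
    obtain k P where kP: "?d \<le> k" "prime_chain S k P"
      and var: "\<And>v. Poly_Mapping.single (Poly_Mapping.single v 1, 0) 1 \<in> P 0"
      using lower_chain[where ?'k = 'k] unfolding S_def by blast
    interpret P: primeideal "P 0" S using kP(2) by (simp add: prime_chain_def)
    have "m \<subseteq> {a \<in> carrier R. embed a \<in> P 0}"
      unfolding m_Idl
    proof (rule R.genideal_minimal)
      have "ring_hom_ring R S embed"
        by (rule ring_hom_ringI2) (use cS cR emb_hom in \<open>auto simp: cring_def\<close>)
      then show "ideal {a \<in> carrier R. embed a \<in> P 0} R"
        by (rule ring_hom_ring.ideal_vimage) (rule P.is_ideal)
      show "range Var \<subseteq> {a \<in> carrier R. embed a \<in> P 0}"
        using var by (auto simp: R_def embed_def Var_def monomial_def push_single)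
    qed
    \<comment> \<open>Since \<open>to_UP\<close> is an isomorphism onto the Rees algebra, the image
      of \<open>P 0\<close> is a prime there. It contains the generators of \<open>N\<close> and so
      all of \<open>N\<close>, and injectivity carries the inclusion back.\<close>
    then have "f ` m \<subseteq> to_UP ` P 0" by (auto simp: f_embed)
    moreover have "primeideal (to_UP ` P 0) A"
    proof (rule primeideal_image[OF cS cA S_A surj_SA P.primeideal])
      fix a assume a: "a \<in> carrier S" "to_UP a = \<zero>\<^bsub>A\<^esub>"
      have "to_UP \<zero>\<^bsub>S\<^esub> = \<zero>\<^bsub>A\<^esub>"
        using ring_hom_zero[OF S_A] cS cA by (simp add: cring_def)
      then have "a = \<zero>\<^bsub>S\<^esub>" using a(2) inj_to_UP by (metis injD)
      then show "a \<in> P 0" using additive_subgroup.zero_closed[OF ideal.axioms(1)[OF P.is_ideal]] by simp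
    qed
    ultimately have "N \<subseteq> to_UP ` P 0"
      unfolding N_def by (intro A.genideal_minimal primeideal.axioms(1))
    then have "\<forall>a\<in>carrier S. h (to_UP a) = \<zero>\<^bsub>T\<^esub> \<longrightarrow> a \<in> P 0"
      using ker inj_image_mem_iff[OF inj_to_UP] by blast
    with kP show ?thesis by blast
  qed
  have "Sup ?chains = ereal (real ?d)"
  proof (rule antisym)
    show "Sup ?chains \<le> ereal (real ?d)"
      by (rule Sup_least) (use upper in fastforce)
    obtain k P where kP: "?d \<le> k" "prime_chain S k P \<and> (\<forall>a\<in>carrier S. h (to_UP a) = \<zero>\<^bsub>T\<^esub> \<longrightarrow> a \<in> P 0)"
      using lower by blast
    then have "ereal (real k) \<in> ?chains" by blast
    then have "ereal (real k) \<le> Sup ?chains" by (rule Sup_upper)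
    moreover have "ereal (real ?d) \<le> ereal (real k)" using kP(1) by simp
    ultimately show "ereal (real ?d) \<le> Sup ?chains" by (rule order_trans[rotated])
  qed
  then show ?thesis by (simp add: spread dim)
qed

end

section \<open>From primary monomial ideals to blocks of variables\<close>

lemma push_eq_0_iff:
  assumes "inj h"
  shows "push UNIV h f = 0 \<longleftrightarrow> f = 0"
proof
  assume f: "push UNIV h f = 0"
  show "f = 0"
  proof (rule poly_mapping_eqI)
    fix x
    have "Poly_Mapping.lookup (push UNIV h f) (h x)
        = (\<Sum>y\<in>Poly_Mapping.keys f. if y = x then Poly_Mapping.lookup f y else 0)"
      unfolding push_def lookup_sum
      by (rule sum.cong) (auto simp: lookup_single when_def inj_eq[OF assms])
    then show "Poly_Mapping.lookup f x = Poly_Mapping.lookup 0 x"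
      using f by (simp add: in_keys_iff split: if_splits)
  qed
qed simp

text \<open>Exponents with an unordered index type are transported to \<open>nat\<close>, where the library
  knows that polynomials have no zero divisors.\<close>

lemma mpoly_mult_eq_0:
  fixes a b :: "('v::finite, 'k::idom) mpoly"
  assumes "a * b = 0"
  shows "a = 0 \<or> b = 0"
proof -
  obtain idx :: "'v \<Rightarrow> nat" where idx: "inj idx"
    using finite_imp_inj_to_nat_seg[of "UNIV :: 'v set"] by auto
  define h where "h = reindex idx UNIV"
  have lookup_h: "Poly_Mapping.lookup (h e) (idx v) = Poly_Mapping.lookup e v" for e v
    unfolding h_def by (simp add: lookup_reindex[OF idx])
  have "inj h"
  proof (rule injI)
    fix x y assume "h x = h y"
    then show "x = y" by (intro poly_mapping_eqI) (metis lookup_h)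
  qed
  have h: "h 0 = 0" "\<And>x y. h (x + y) = h x + h y"
    by (simp_all add: h_def reindex_0 reindex_add)
  interpret P: primeideal "{f \<in> keys_in UNIV. push UNIV h f = (0 :: (nat \<Rightarrow>\<^sub>0 nat) \<Rightarrow>\<^sub>0 'k)}"
    "ring_of_type_algebra\<lparr>carrier := keys_in UNIV\<rparr>"
    by (rule primeideal_push_kernel) (use h in auto)
  show ?thesis
    using P.I_prime[of a b] assms by (simp add: push_eq_0_iff[OF \<open>inj h\<close>] keys_in_def)
qed

lemma mpoly_power_neq_0: "a \<noteq> 0 \<Longrightarrow> a ^ n \<noteq> 0" for a :: "('v::finite, 'k::idom) mpoly"
proof (induction n)
  case (Suc n)
  then show ?case using mpoly_mult_eq_0[of a "a ^ n"] by auto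
qed simp

lemma nat_pow_type_algebra: "x [^]\<^bsub>ring_of_type_algebra\<^esub> (n :: nat) = x ^ n" for x :: "'a::comm_ring_1"
  by (induction n) (simp_all add: nat_pow_def mult.commute)

text \<open>A monomial dividing a variable is 1 or that variable. So for proper ideals, containing a
  variable is visible in \<open>gen_vars\<close>.\<close>

lemma Var_mem_min_monomial_gens:
  fixes J :: "('v, 'k::comm_ring_1) mpoly set"
  assumes one: "1 \<notin> J" and v: "Var v \<in> J"
  shows "Var v \<in> min_monomial_gens J"
proof -
  have "g = Var v" if g: "g \<in> J" "g \<in> range monomial" "g dvd Var v" for g
  proof -
    obtain a where a: "g = monomial a" using g(2) by blast
    obtain c where c: "Var v = g * c" using g(3) by (rule dvdE)
    have eq: "Poly_Mapping.single a (1 :: 'k) * c = Poly_Mapping.single (Poly_Mapping.single v 1) 1"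
      using c by (simp add: a Var_def monomial_def)
    have "Poly_Mapping.single v 1 \<in> Poly_Mapping.keys (Poly_Mapping.single a (1 :: 'k) * c)"
      unfolding eq by simp
    then obtain b where ab: "Poly_Mapping.single v 1 = a + b"
      using keys_mult[of "Poly_Mapping.single a (1 :: 'k)" c] by auto
    have lk: "(if u = v then 1 else 0) = Poly_Mapping.lookup a u + Poly_Mapping.lookup b u" for u
      using arg_cong[OF ab, of "\<lambda>p. Poly_Mapping.lookup p u"] by (simp add: lookup_add lookup_single when_def eq_commute)
    have a0: "Poly_Mapping.lookup a u = 0" if "u \<noteq> v" for u using lk[of u] that by simp
    have "Poly_Mapping.lookup a v = 0 \<or> Poly_Mapping.lookup a v = 1" using lk[of v] by auto
    then show ?thesis
    proof
      assume "Poly_Mapping.lookup a v = 0"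
      then have "a = 0" using a0 by (intro poly_mapping_eqI) (metis lookup_zero)
      then show ?thesis using g(1) one by (simp add: a monomial_def)
    next
      assume "Poly_Mapping.lookup a v = 1"
      then have "a = Poly_Mapping.single v 1"
        using a0 by (intro poly_mapping_eqI) (auto simp: lookup_single when_def)
      then show ?thesis by (simp add: a Var_def)
    qed
  qed
  then show ?thesis using v by (auto simp: min_monomial_gens_def Var_def)
qed

lemma monomial_mult: "monomial a * monomial b = monomial (a + b)"
  by (simp add: monomial_def mult_single)

lemma Var_power: "Var v ^ n = monomial (Poly_Mapping.single v n)"
  by (induction n) (simp_all add: Var_def monomial_mult flip: single_add, simp add: monomial_def)

text \<open>The condition \<open>p i \<noteq> {0}\<close> makes every block nonempty: the zero ideal
  has no monomial generators, is therefore disjointly generated from every ideal, and would count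
  towards \<open>r\<close> without owning a variable. Nonempty blocks give \<open>r \<le> n\<close>,
  so the real difference agrees with the truncated one of \<open>analytic_spread_E1\<close>.\<close>

theorem theorem5p8:
  fixes r :: nat
    and p q :: "nat \<Rightarrow> ('v::finite, 'k::field) mpoly set"
  assumes "infinite (UNIV :: 'k set)"
    and "\<And>i. i \<in> {1..r} \<Longrightarrow> monomial_ideal (q i)"
    and "\<And>i. i \<in> {1..r} \<Longrightarrow> primary_to mpoly_ring (p i) (q i)"
    and "\<And>i. i \<in> {1..r} \<Longrightarrow> p i \<noteq> {0}"
    and "\<And>i j. i \<in> {1..r} \<Longrightarrow> j \<in> {1..r} \<Longrightarrow> i \<noteq> j \<Longrightarrow> disjointly_generated (p i) (p j)"
    and "\<And>v. \<exists>i\<in>{1..r}. Var v \<in> min_monomial_gens (p i)"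
  shows "analytic_spread mpoly_ring irrelevant_ideal (\<Inter>i\<in>{1..r}. q i)
           = ereal (real (card (UNIV :: 'v set)) - real r + 1)"
proof -
  define Q where "Q i = {e. monomial e \<in> q i}" for i
  have q_eq: "q i = keys_in (Q i)" if "i \<in> {1..r}" for i
    unfolding Q_def using monomial_ideal_keys_in[OF assms(2)[OF that]] .
  have primary: "primary_ideal mpoly_ring (q i)" if "i \<in> {1..r}" for i
    using assms(3)[OF that] by (simp add: primary_to_def)
  have p_iff: "a \<in> p i \<longleftrightarrow> (\<exists>k. a ^ k \<in> q i)" if "i \<in> {1..r}" for a i
  proof -
    have "p i = radical mpoly_ring (q i)" using assms(3)[OF that] by (simp add: primary_to_def)
    then show ?thesis by (simp add: radical_def nat_pow_type_algebra)
  qed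
  have ideal: "ideal (q i) mpoly_ring" if "i \<in> {1..r}" for i
    using primary[OF that] by (simp add: primary_ideal_def)
  have up: "x * a \<in> q i" if "i \<in> {1..r}" "a \<in> q i" for i a x
    using ideal[OF that(1)] that(2) by (simp add: ideal_type_algebra_iff)
  have one_q: "1 \<notin> q i" if i: "i \<in> {1..r}" for i
  proof
    assume "1 \<in> q i"
    then have "q i = UNIV" using up[OF i, of 1] by auto
    then show False using primary[OF i] by (simp add: primary_ideal_def)
  qed
  have one_p: "1 \<notin> p i" if i: "i \<in> {1..r}" for i
    using one_q[OF i] by (simp add: p_iff[OF i])
  \<comment> \<open>No power of the variable lies in the primary ideal \<open>q i\<close>, so it can
    be cancelled modulo \<open>q i\<close>.\<close>
  have remove: "e \<in> Q i" if i: "i \<in> {1..r}" and v: "Var v \<notin> p i" and e: "e + Poly_Mapping.single v 1 \<in> Q i"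
    for i v e
  proof -
    have "monomial e * Var v \<in> q i" using e by (simp add: Q_def Var_def monomial_mult)
    then have "monomial e \<in> q i \<or> (\<exists>k. Var v ^ k \<in> q i)"
      using primary[OF i] by (simp add: primary_ideal_def nat_pow_type_algebra)
    then show ?thesis using v by (simp add: p_iff[OF i] Q_def)
  qed
  have zero_Q: "0 \<notin> Q i" if "i \<in> {1..r}" for i
    using one_q[OF that] by (simp add: Q_def monomial_def)
  \<comment> \<open>Disjointness makes the chosen index the only possible one; this is the content
    of \<open>Var_p\<close>.\<close>
  define blk where "blk v = (SOME i. i \<in> {1..r} \<and> Var v \<in> min_monomial_gens (p i))" for v
  have blk: "blk v \<in> {1..r} \<and> Var v \<in> min_monomial_gens (p (blk v))" for v
    unfolding blk_def by (rule someI_ex) (use assms(6) in blast)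
  have Var_p: "Var v \<in> p i \<longleftrightarrow> blk v = i" if i: "i \<in> {1..r}" for v i
  proof
    have gen: "v \<in> gen_vars (p j)" if "Var v \<in> min_monomial_gens (p j)" for j
      using that by (auto simp: gen_vars_def Var_def intro!: exI[of _ "Poly_Mapping.single v 1"])
    assume "Var v \<in> p i"
    then have "v \<in> gen_vars (p i)" by (intro gen Var_mem_min_monomial_gens one_p i)
    moreover have "v \<in> gen_vars (p (blk v))" by (intro gen) (use blk in blast)
    ultimately show "blk v = i"
      using assms(5)[of "blk v" i] blk[of v] i by (auto simp: disjointly_generated_def)
  next
    assume "blk v = i"
    then show "Var v \<in> p i" using blk[of v] by (auto simp: min_monomial_gens_def)
  qed
  interpret block_ideals r blk Q
  proof
    show "range blk = {1..r}"
    proof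
      show "{1..r} \<subseteq> range blk"
      proof
        fix i assume i: "i \<in> {1..r}"
        show "i \<in> range blk"
        proof (rule ccontr)
          \<comment> \<open>If no variable belonged to \<open>p i\<close>, a nonzero element of
            \<open>p i\<close> would have a nonzero power in \<open>q i\<close>, and every variable
            could be cancelled from one of its monomials, leaving 1 in \<open>q i\<close>.\<close>
          assume ni: "i \<notin> range blk"
          have "0 \<in> p i" unfolding p_iff[OF i] using ideal[OF i]
            by (intro exI[of _ 1]) (simp add: ideal_type_algebra_iff)
          then obtain a where a: "a \<in> p i" "a \<noteq> 0" using assms(4)[OF i] by blast
          then obtain k where k: "a ^ k \<in> q i" using p_iff[OF i] by blast
          have "a ^ k \<noteq> 0" using mpoly_power_neq_0[OF a(2)] .
          then obtain e where "e \<in> Poly_Mapping.keys (a ^ k)" by (metis ex_in_conv keys_eq_empty)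
          then have e: "e \<in> Q i" using k unfolding q_eq[OF i] by (auto simp: keys_in_def)
          have "exp_of (\<lambda>v. if v \<in> {} then Poly_Mapping.lookup e v else 0) \<in> Q i"
            by (rule exp_restrict_mem[OF remove[OF i] e]) (use Var_p[OF i] ni in auto)
          moreover have "exp_of (\<lambda>v. if v \<in> {} then Poly_Mapping.lookup e v else 0) = 0"
            by (rule poly_mapping_eqI) simp
          ultimately show False using zero_Q[OF i] by simp
        qed
      qed
    qed (use blk in auto)
    show "e + c \<in> Q i" if "i \<in> {1..r}" "e \<in> Q i" for i e c
      using up[OF that(1), of "monomial e" "monomial c"] that(2) by (simp add: Q_def monomial_mult add.commute)
    show "\<exists>k. Poly_Mapping.single v k \<in> Q (blk v)" for v
      using Var_p[of "blk v" v] blk[of v] p_iff[of "blk v" "Var v"] by (simp add: Q_def Var_power)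
    show "e \<in> Q i" if "i \<in> {1..r}" "blk v \<noteq> i" "e + Poly_Mapping.single v 1 \<in> Q i" for i v e
      using remove[of i v e] Var_p[of i v] that by blast
  qed (rule zero_Q)
  have "(\<Inter>i\<in>{1..r}. q i) = keys_in E1"
    using q_eq r_pos by (auto simp: keys_in_def E1_def)
  then show ?thesis
    using analytic_spread_E1[where ?'k = 'k] r_le_card by (simp add: of_nat_diff)
qed

end
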